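(* Every acyclic directed cactus $G$ with a single source or with a single sink admits an upward-leftward outerplanar L-drawing. Moreover, if $G$ has no transitive edges (e.g., if $G$ is a tree), then such a drawing can be constructed so that it maintains any given outerplanar embedding of $G$.
   Context: A cactus is a connected graph in which each edge lies on at most one cycle. An edge $(u,v)$ is transitive if there is another directed $u$-$v$-path. In an L-drawing of a digraph, vertices are points and each edge $e$ is drawn as a polyline consisting of a vertical segment incident to the tail of $e$ and a horizontal segment incident to the head of $e$. It is planar if distinct edges may overlap but do not cross; upward if for every edge the lowest endpoint of its vertical segment is its tail; upward-leftward if moreover every edge points to the left (head to the left of tail); outerplanar if it is planar and all vertices lie on the outer face. *)

theory Defs
  imports
    "HOL-Analysis.Analysis"
    "HOL-Combinatorics.Orbits"
    "Graph_Theory.Digraph_Component"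
begin

subsection \<open>Directed cactuses\<close>

definition single_source :: "'a pair_pre_digraph \<Rightarrow> bool" where
  "single_source G \<longleftrightarrow> (\<exists>!v. v \<in> pverts G \<and> in_degree (with_proj G) v = 0)"

definition single_sink :: "'a pair_pre_digraph \<Rightarrow> bool" where
  "single_sink G \<longleftrightarrow> (\<exists>!v. v \<in> pverts G \<and> out_degree (with_proj G) v = 0)"

text \<open>
  Cycles of a cactus are cycles of the underlying undirected graph, identified with their sets of
  undirected edges. The length bound excludes the closed walk that traverses one edge back and
  forth, which is a \<^term>\<open>pre_digraph.cycle\<close> of the symmetric closure.
\<close>

definition undirected_cycle :: "'a pair_pre_digraph \<Rightarrow> 'a set set \<Rightarrow> bool" where
  "undirected_cycle G C \<longleftrightarrow>
     (\<exists>c. pre_digraph.cycle (with_proj (mk_symmetric (with_proj G))) c \<and> 3 \<le> length c \<and>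
          C = (\<lambda>(u, v). {u, v}) ` set c)"

definition cactus :: "'a pair_pre_digraph \<Rightarrow> bool" where
  "cactus G \<longleftrightarrow> Digraph_Component.connected (with_proj G) \<and>
     (\<forall>(u, v)\<in>parcs G. \<forall>C D. undirected_cycle G C \<and> undirected_cycle G D \<and>
        {u, v} \<in> C \<and> {u, v} \<in> D \<longrightarrow> C = D)"

definition transitive_arc :: "'a pair_pre_digraph \<Rightarrow> 'a \<times> 'a \<Rightarrow> bool" where
  "transitive_arc G e \<longleftrightarrow> e \<in> parcs G \<and>
     (\<exists>c. pre_digraph.apath (with_proj G) (fst e) c (snd e) \<and> c \<noteq> [e])"


subsection \<open>Outerplanar embeddings\<close>

text \<open>
  Planar embeddings are combinatorial: a dart \<open>(u, v)\<close> is an edge seen from its end \<open>u\<close>, and the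
  rotation \<open>\<sigma>\<close> maps each dart at \<open>u\<close> to the clockwise next dart at \<open>u\<close>. Following a dart, reversing
  it and rotating clockwise traverses the boundary of the face to the left of the dart.
\<close>

definition darts :: "'a pair_pre_digraph \<Rightarrow> ('a \<times> 'a) set" where
  "darts G = parcs (mk_symmetric (with_proj G))"

definition darts_at :: "'a pair_pre_digraph \<Rightarrow> 'a \<Rightarrow> ('a \<times> 'a) set" where
  "darts_at G v = {d \<in> darts G. fst d = v}"

definition rotation_system :: "'a pair_pre_digraph \<Rightarrow> ('a \<times> 'a \<Rightarrow> 'a \<times> 'a) \<Rightarrow> bool" where
  "rotation_system G \<sigma> \<longleftrightarrow> \<sigma> permutes darts G \<and>
     (\<forall>v\<in>pverts G. darts_at G v \<noteq> {} \<longrightarrow> cyclic_on \<sigma> (darts_at G v))"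

text \<open>
  A face is given by the set of darts on its boundary walk. The one-vertex graph has a
  single face, whose boundary contains no dart.
\<close>

definition faces :: "'a pair_pre_digraph \<Rightarrow> ('a \<times> 'a \<Rightarrow> 'a \<times> 'a) \<Rightarrow> ('a \<times> 'a) set set" where
  "faces G \<sigma> = (if darts G = {} then {{}} else orbit (\<sigma> \<circ> prod.swap) ` darts G)"

definition on_face :: "'a pair_pre_digraph \<Rightarrow> 'a \<Rightarrow> ('a \<times> 'a) set \<Rightarrow> bool" where
  "on_face G v f \<longleftrightarrow> darts_at G v = {} \<or> darts_at G v \<inter> f \<noteq> {}"

text \<open>
  For a connected graph, Euler's formula says that the rotation system has genus zero. Every
  edge contributes two darts.
\<close>

definition planar_rotation_system :: "'a pair_pre_digraph \<Rightarrow> ('a \<times> 'a \<Rightarrow> 'a \<times> 'a) \<Rightarrow> bool" where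
  "planar_rotation_system G \<sigma> \<longleftrightarrow> rotation_system G \<sigma> \<and>
     card (pverts G) + card (faces G \<sigma>) = card (darts G) div 2 + 2"

definition outerplanar_embedding ::
    "'a pair_pre_digraph \<Rightarrow> ('a \<times> 'a \<Rightarrow> 'a \<times> 'a) \<Rightarrow> ('a \<times> 'a) set \<Rightarrow> bool" where
  "outerplanar_embedding G \<sigma> f \<longleftrightarrow> planar_rotation_system G \<sigma> \<and>
     f \<in> faces G \<sigma> \<and> (\<forall>v\<in>pverts G. on_face G v f)"


subsection \<open>L-drawings\<close>

text \<open>
  The vertex positions determine the drawing: the vertical segment at the tail and the
  horizontal segment at the head of an arc meet at its bend.
\<close>

definition bend :: "('a \<Rightarrow> real \<times> real) \<Rightarrow> 'a \<times> 'a \<Rightarrow> real \<times> real" where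
  "bend p e = (fst (p (fst e)), snd (p (snd e)))"

definition edge_curve :: "('a \<Rightarrow> real \<times> real) \<Rightarrow> 'a \<times> 'a \<Rightarrow> (real \<times> real) set" where
  "edge_curve p e = closed_segment (p (fst e)) (bend p e) \<union> closed_segment (bend p e) (p (snd e))"

definition drawing :: "'a pair_pre_digraph \<Rightarrow> ('a \<Rightarrow> real \<times> real) \<Rightarrow> (real \<times> real) set" where
  "drawing G p = p ` pverts G \<union> (\<Union>e\<in>parcs G. edge_curve p e)"

text \<open>
  As usual for L-drawings, vertices have pairwise distinct x-coordinates and pairwise distinct
  y-coordinates. Hence no edge passes through a vertex other than its ends.
\<close>

definition L_drawing :: "'a pair_pre_digraph \<Rightarrow> ('a \<Rightarrow> real \<times> real) \<Rightarrow> bool" where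
  "L_drawing G p \<longleftrightarrow> inj_on (fst \<circ> p) (pverts G) \<and> inj_on (snd \<circ> p) (pverts G)"

text \<open>
  Because the coordinates are distinct, collinear segments of two distinct arcs overlap only if
  the arcs share their tail (vertical segments) or their head (horizontal segments); after the
  common part they diverge, which is an overlap but not a crossing. The same holds if the bend of
  one arc lies on the other arc. So two arcs cross precisely where a vertical and a horizontal
  segment meet in a point interior to both.
\<close>

definition cross :: "('a \<Rightarrow> real \<times> real) \<Rightarrow> 'a \<times> 'a \<Rightarrow> 'a \<times> 'a \<Rightarrow> bool" where
  "cross p e e' \<longleftrightarrow>
     open_segment (p (fst e)) (bend p e) \<inter> open_segment (bend p e') (p (snd e')) \<noteq> {} \<or>
     open_segment (p (fst e')) (bend p e') \<inter> open_segment (bend p e) (p (snd e)) \<noteq> {}"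

definition planar_L_drawing :: "'a pair_pre_digraph \<Rightarrow> ('a \<Rightarrow> real \<times> real) \<Rightarrow> bool" where
  "planar_L_drawing G p \<longleftrightarrow> L_drawing G p \<and>
     (\<forall>e\<in>parcs G. \<forall>e'\<in>parcs G. e \<noteq> e' \<longrightarrow> \<not> cross p e e')"

definition upward :: "'a pair_pre_digraph \<Rightarrow> ('a \<Rightarrow> real \<times> real) \<Rightarrow> bool" where
  "upward G p \<longleftrightarrow> (\<forall>e\<in>parcs G. snd (p (fst e)) < snd (bend p e))"

definition leftward :: "'a pair_pre_digraph \<Rightarrow> ('a \<Rightarrow> real \<times> real) \<Rightarrow> bool" where
  "leftward G p \<longleftrightarrow> (\<forall>e\<in>parcs G. fst (p (snd e)) < fst (p (fst e)))"

definition outerplanar_L_drawing :: "'a pair_pre_digraph \<Rightarrow> ('a \<Rightarrow> real \<times> real) \<Rightarrow> bool" where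
  "outerplanar_L_drawing G p \<longleftrightarrow> planar_L_drawing G p \<and>
     (\<forall>v\<in>pverts G. p v \<in> frontier (outside (drawing G p)))"

definition upward_leftward_outerplanar_L_drawing ::
    "'a pair_pre_digraph \<Rightarrow> ('a \<Rightarrow> real \<times> real) \<Rightarrow> bool" where
  "upward_leftward_outerplanar_L_drawing G p \<longleftrightarrow>
     outerplanar_L_drawing G p \<and> upward G p \<and> leftward G p"


subsection \<open>The embedding given by an upward-leftward planar L-drawing\<close>

text \<open>
  All outgoing arcs of \<open>v\<close> leave upwards, overlap, and turn left at the height of their heads: the
  lower the head, the further left the arc is. All incoming arcs of \<open>v\<close> arrive from the right,
  overlap, and come up from below at the x-coordinates of their tails: the further right the tail,
  the higher the arc is. So, clockwise and starting from the left below of \<open>v\<close>, there are first the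
  outgoing arcs by increasing height of their heads, and then the incoming arcs by decreasing
  x-coordinates of their tails.
\<close>

definition clockwise_neighbours ::
    "'a pair_pre_digraph \<Rightarrow> ('a \<Rightarrow> real \<times> real) \<Rightarrow> 'a \<Rightarrow> 'a list" where
  "clockwise_neighbours G p v =
     sorted_key_list_of_set (snd \<circ> p) {w. (v, w) \<in> parcs G} @
     rev (sorted_key_list_of_set (fst \<circ> p) {u. (u, v) \<in> parcs G})"

definition maintains_rotation ::
    "'a pair_pre_digraph \<Rightarrow> ('a \<Rightarrow> real \<times> real) \<Rightarrow> ('a \<times> 'a \<Rightarrow> 'a \<times> 'a) \<Rightarrow> bool" where
  "maintains_rotation G p \<sigma> \<longleftrightarrow>
     (\<forall>v\<in>pverts G. let ns = clockwise_neighbours G p v in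
        \<forall>i<length ns. \<sigma> (v, ns ! i) = (v, ns ! (Suc i mod length ns)))"

text \<open>
  The outer face \<open>f\<close> is maintained if \<open>f\<close> is the unbounded face of the drawing. The face to the left
  of an arc contains all points that are slightly below and to the left of its bend; there, no
  overlapping arc can be in between. It suffices to look at the darts of \<open>f\<close> that are arcs: all
  darts of \<open>f\<close> have the same face of the drawing to their left, and since the boundary walk of a
  face is closed, at least one of its darts is an arc if the digraph is acyclic and has an arc.
\<close>

definition maintains_outer_face ::
    "'a pair_pre_digraph \<Rightarrow> ('a \<Rightarrow> real \<times> real) \<Rightarrow> ('a \<times> 'a) set \<Rightarrow> bool" where
  "maintains_outer_face G p f \<longleftrightarrow>
     (\<forall>e \<in> parcs G \<inter> f. \<forall>\<^sub>F \<epsilon> in at_right 0. bend p e - (\<epsilon>, \<epsilon>) \<in> outside (drawing G p))"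

definition maintains_embedding ::
    "'a pair_pre_digraph \<Rightarrow> ('a \<Rightarrow> real \<times> real) \<Rightarrow> ('a \<times> 'a \<Rightarrow> 'a \<times> 'a) \<Rightarrow> ('a \<times> 'a) set \<Rightarrow> bool"
  where
  "maintains_embedding G p \<sigma> f \<longleftrightarrow> maintains_rotation G p \<sigma> \<and> maintains_outer_face G p f"

end

theory Submission
  imports Defs "HOL-Library.List_Lexorder" "HOL-Library.Sublist"
begin

text \<open>
  Let the cactus have a single source. A vertex with two parents is the sink of a cycle formed by
  two directed paths, a left and a right one, from a common root, and every other vertex except
  the source has one parent. Always choosing the right parent, or always the left one, yields two
  spanning trees. Put the vertices at the heights given by the preorder of the first tree, and from
  right to left in the preorder of the second tree with the children reversed. If the two paths of
  each cycle leave its root next to each other, and the cycle goes on with the last child along the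
  left path and with the first child along the right path, then no arcs cross. The horizontal ray
  to the left of a vertex is free unless the vertex is inside a right path; then the vertical ray
  just to the right of the vertex is free. A transitive arc can serve as the right path of its
  cycle.

  In an outerplanar embedding, every cycle bounds a face other than the outer face \<open>f\<close>: by Euler's
  formula, the boundaries of the sets of faces without \<open>f\<close> are exactly the even arc sets, so the
  cycle is the boundary of such a set, and no vertex can be separated from \<open>f\<close>. Hence the given
  rotation has the shape required above. A cactus with a single sink is reversed and reflected at
  the diagonal.
\<close>

subsection \<open>Lexicographic order and prefixes\<close>

text \<open>For a tree, the two preorders alone would do. The obstacle is the sink of a cycle: each
  of the two spanning trees keeps one of its incoming arcs and loses the other. For a lost arc, the
  conditions on the paths bound what the preorder visits between its ends, namely earlier subtrees
  at its tail and the inner vertices of the other path (\<open>between\<close>); crossings and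
  blocked rays are refuted from this fact and its mirror image. The mirror image is available only
  for \<open>half_layout\<close>: \<open>layout\<close> is asymmetric, since the left path of a
  cycle must have an inner vertex. This is why a transitive arc has to go to the right, and why
  transitive arcs are excluded when the embedding decides which path is the left one. Integer
  coordinates leave unit gaps in which rays can start. The count behind the argument on faces: with
  F faces, E arcs and n vertices there are \<open>2 ^ (F - 1)\<close> sets of faces without
  \<open>f\<close> and at most \<open>2 ^ (E - n + 1)\<close> even arc sets, and Euler's formula
  makes the exponents equal.\<close>

lemma append_less_cancel: "xs @ ys < xs @ zs \<longleftrightarrow> ys < zs" for xs ys zs :: "'b::linorder list"
  by (induction xs) auto

lemma less_append_Cons: "xs < xs @ y # ys" for xs ys :: "'b::linorder list"
  by (induction xs) auto

lemma strict_prefix_less: "prefix xs ys \<Longrightarrow> xs \<noteq> ys \<Longrightarrow> xs < ys" for xs ys :: "'b::linorder list"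
  by (metis append_Nil2 less_append_Cons neq_Nil_conv prefix_def)

lemma prefix_le: "prefix xs ys \<Longrightarrow> xs \<le> ys" for xs ys :: "'b::linorder list"
  by (metis order.refl order.strict_implies_order strict_prefix_less)

text \<open>For keys this means that subtrees are intervals of the preorder.\<close>

lemma between_prefix: "xs \<le> zs \<Longrightarrow> zs \<le> xs @ ys \<Longrightarrow> prefix xs zs" for xs ys zs :: "'b::linorder list"
proof (induction xs arbitrary: zs)
  case (Cons x xs)
  then show ?case by (cases zs) auto
qed simp

text \<open>The lists differ at a position inside both of them, which suffixes cannot change. For
  keys: the whole subtree of \<open>xs\<close> precedes the whole subtree of
  \<open>ys\<close>.\<close>

lemma less_append_append:
  "xs < ys \<Longrightarrow> \<not> prefix xs ys \<Longrightarrow> xs @ us < ys @ vs" for xs ys us vs :: "'b::linorder list"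
proof (induction xs arbitrary: ys)
  case (Cons x xs)
  then show ?case by (cases ys) auto
qed simp

subsection \<open>Drawing orders\<close>

text \<open>
  \<open>pX v\<close> and \<open>pY v\<close> are the left and the right parent of \<open>v\<close>; they differ if \<open>v\<close> is the sink of a
  cycle, which then consists of the left path \<open>R v # As v @ [v]\<close> and the right path
  \<open>R v # Bs v @ [v]\<close>. The ranks order the arcs leaving a vertex clockwise. The assumptions are
  invariant under reflection, which exchanges left and right and negates the ranks.
\<close>

locale half_layout =
  fixes V :: "'a set" and E :: "('a \<times> 'a) set" and s :: 'a
    and pX pY :: "'a \<Rightarrow> 'a" and rk :: "'a \<times> 'a \<Rightarrow> int"
    and R :: "'a \<Rightarrow> 'a" and As Bs :: "'a \<Rightarrow> 'a list"
  assumes finite_V: "finite V" and E_sub: "E \<subseteq> V \<times> (V - {s})" and acyclic_E: "acyclic E"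
    and s_in: "s \<in> V"
    and parents: "v \<in> V - {s} \<Longrightarrow> (pX v, v) \<in> E \<and> (pY v, v) \<in> E"
    and arc_parent: "(u, v) \<in> E \<Longrightarrow> u = pX v \<or> u = pY v"
    and rk_inj: "(u, v) \<in> E \<Longrightarrow> (u, w) \<in> E \<Longrightarrow> rk (u, v) = rk (u, w) \<Longrightarrow> v = w"
    and left_path: "t \<in> V - {s} \<Longrightarrow> pX t \<noteq> pY t \<Longrightarrow> successively (\<lambda>x y. pX y = x) (R t # As t @ [t])"
    and right_path: "t \<in> V - {s} \<Longrightarrow> pX t \<noteq> pY t \<Longrightarrow> successively (\<lambda>x y. pY y = x) (R t # Bs t @ [t])"
    and inner: "t \<in> V - {s} \<Longrightarrow> pX t \<noteq> pY t \<Longrightarrow> z \<in> set (As t) \<union> set (Bs t) \<Longrightarrow>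
      z \<in> V - {s} \<and> pX z = pY z"
    and left_last: "t \<in> V - {s} \<Longrightarrow> pX t \<noteq> pY t \<Longrightarrow>
      successively (\<lambda>x y. \<forall>w. (x, w) \<in> E \<longrightarrow> rk (x, w) \<le> rk (x, y)) (As t @ [t])"
    and right_first: "t \<in> V - {s} \<Longrightarrow> pX t \<noteq> pY t \<Longrightarrow>
      successively (\<lambda>x y. \<forall>w. (x, w) \<in> E \<longrightarrow> rk (x, y) \<le> rk (x, w)) (Bs t @ [t])"
    and split: "t \<in> V - {s} \<Longrightarrow> pX t \<noteq> pY t \<Longrightarrow>
      rk (R t, hd (As t @ [t])) < rk (R t, hd (Bs t @ [t]))"
    and adjacent: "t \<in> V - {s} \<Longrightarrow> pX t \<noteq> pY t \<Longrightarrow> (R t, w) \<in> E \<Longrightarrow>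
      rk (R t, w) \<le> rk (R t, hd (As t @ [t])) \<or> rk (R t, hd (Bs t @ [t])) \<le> rk (R t, w)"
begin

lemma inner_in: "t \<in> V - {s} \<Longrightarrow> pX t \<noteq> pY t \<Longrightarrow> set (As t) \<subseteq> V - {s} \<and> set (Bs t) \<subseteq> V - {s}"
  using inner by blast

lemma wf_E: "wf E"
  using finite_acyclic_wf[OF _ acyclic_E] finite_subset[OF E_sub] finite_V by blast

text \<open>Turns every fact about \<open>key\<close> into one about \<open>mirror.key\<close>, the
  preorder that determines the x-coordinates.\<close>

lemma mirror: "half_layout V E s pY pX (\<lambda>e. - rk e) R Bs As"
proof
  show "finite V" "E \<subseteq> V \<times> (V - {s})" "acyclic E" "s \<in> V"
    using finite_V E_sub acyclic_E s_in by blast+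
  show "(pY v, v) \<in> E \<and> (pX v, v) \<in> E" if "v \<in> V - {s}" for v
    using parents that by blast
  show "u = pY v \<or> u = pX v" if "(u, v) \<in> E" for u v
    using arc_parent that by blast
  show "v = w" if "(u, v) \<in> E" "(u, w) \<in> E" "- rk (u, v) = - rk (u, w)" for u v w
    using rk_inj that by auto
  fix t assume t: "t \<in> V - {s}" "pY t \<noteq> pX t"
  note t' = t(1) not_sym[OF t(2)]
  show "successively (\<lambda>x y. pY y = x) (R t # Bs t @ [t])" "successively (\<lambda>x y. pX y = x) (R t # As t @ [t])"
    by (fact right_path[OF t'] left_path[OF t'])+
  show "z \<in> V - {s} \<and> pY z = pX z" if "z \<in> set (Bs t) \<union> set (As t)" for z
    using inner[OF t', of z] that by auto
  show "successively (\<lambda>x y. \<forall>w. (x, w) \<in> E \<longrightarrow> - rk (x, w) \<le> - rk (x, y)) (Bs t @ [t])"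
    using right_first[OF t'] by (simp only: neg_le_iff_le)
  show "successively (\<lambda>x y. \<forall>w. (x, w) \<in> E \<longrightarrow> - rk (x, y) \<le> - rk (x, w)) (As t @ [t])"
    using left_last[OF t'] by (simp only: neg_le_iff_le)
  show "- rk (R t, hd (Bs t @ [t])) < - rk (R t, hd (As t @ [t]))"
    using split[OF t'] by simp
  show "- rk (R t, w) \<le> - rk (R t, hd (Bs t @ [t])) \<or> - rk (R t, hd (As t @ [t])) \<le> - rk (R t, w)"
    if "(R t, w) \<in> E" for w
    using adjacent[OF t' that] by auto
qed

text \<open>
  \<open>key v\<close> lists the ranks on the way from the source to \<open>v\<close> in the tree of right parents, so the
  lexicographic order of the keys is the preorder of this tree, and prefixes are ancestors.
\<close>

function key :: "'a \<Rightarrow> int list" where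
  "key v = (if v \<in> V - {s} then key (pY v) @ [rk (pY v, v)] else [])"
  by auto
termination by (relation E) (use wf_E parents in auto)

declare key.simps [simp del]

lemma key_s: "key s = []"
  by (simp add: key.simps)

lemma key_parent: "v \<in> V - {s} \<Longrightarrow> key v = key (pY v) @ [rk (pY v, v)]"
  by (subst key.simps) simp

lemma key_child: "v \<in> V - {s} \<Longrightarrow> pY v = u \<Longrightarrow> key v = key u @ [rk (u, v)]"
  using key_parent by blast

lemma parent_in_V: "v \<in> V - {s} \<Longrightarrow> pY v \<in> V"
  using parents E_sub by blast

lemma key_inj: "u \<in> V \<Longrightarrow> v \<in> V \<Longrightarrow> key u = key v \<Longrightarrow> u = v"
proof (induction v arbitrary: u rule: wf_induct_rule[OF wf_E])
  case (1 v)
  show ?case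
  proof (cases "u = s \<or> v = s")
    case True
    then show ?thesis using 1 key_parent[of u] key_parent[of v] key_s by fastforce
  next
    case False
    then have "key (pY u) = key (pY v)" and rk: "rk (pY u, u) = rk (pY v, v)"
      using 1 key_parent[of u] key_parent[of v] by auto
    moreover have "(pY v, v) \<in> E" "(pY u, u) \<in> E" using 1 False parents by auto
    ultimately have "pY u = pY v"
      using 1(1)[of "pY v" "pY u"] E_sub by blast
    then show ?thesis using rk \<open>(pY v, v) \<in> E\<close> \<open>(pY u, u) \<in> E\<close> rk_inj by metis
  qed
qed

lemma prefix_reach: "u \<in> V \<Longrightarrow> v \<in> V \<Longrightarrow> prefix (key u) (key v) \<Longrightarrow> (u, v) \<in> E\<^sup>*"
proof (induction v rule: wf_induct_rule[OF wf_E])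
  case (1 v)
  show ?case
  proof (cases "key u = key v")
    case True
    then show ?thesis using key_inj 1 by auto
  next
    case False
    then have v: "v \<in> V - {s}" using 1 key_s by auto
    then have "prefix (key u) (key (pY v))"
      using 1 False key_parent[OF v] by (auto simp: prefix_snoc)
    then show ?thesis using 1(1)[of "pY v"] parents[OF v] 1(2) parent_in_V[OF v]
      by (auto intro: rtrancl_into_rtrancl)
  qed
qed

lemma child_towards:
  assumes "u \<in> V" "v \<in> V" "prefix (key u) (key v)" "u \<noteq> v"
  obtains c where "c \<in> V - {s}" "pY c = u" "prefix (key c) (key v)"
proof -
  have "\<exists>c \<in> V - {s}. pY c = u \<and> prefix (key c) (key v)"
    using assms
  proof (induction v rule: wf_induct_rule[OF wf_E])
    case (1 v)
    then have v: "v \<in> V - {s}" using key_s key_inj by fastforce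
    show ?case
    proof (cases "pY v = u")
      case True then show ?thesis using v by auto
    next
      case False
      have "prefix (key u) (key (pY v))"
        using 1 key_inj[of u v] key_parent[OF v] by (auto simp: prefix_snoc)
      then obtain c where "c \<in> V - {s}" "pY c = u" "prefix (key c) (key (pY v))"
        using 1(1)[of "pY v"] parents[OF v] 1(2) parent_in_V[OF v] False by auto
      then show ?thesis using key_parent[OF v] by (auto simp: prefix_def)
    qed
  qed
  then show thesis using that by blast
qed

section \<open>The two paths of a cycle inside the tree of right parents\<close>

lemma prefix_path_elem:
  "successively (\<lambda>x y. pY y = x) (x # xs) \<Longrightarrow> set xs \<subseteq> V - {s} \<Longrightarrow> z \<in> set (x # xs) \<Longrightarrow>
    prefix (key x) (key z)"
proof (induction xs arbitrary: x)
  case (Cons y ys)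
  then have "prefix (key x) (key y)" using key_child[of y x] by auto
  with Cons show ?case by (force intro: prefix_order.trans)
qed simp

lemma prefix_path:
  "successively (\<lambda>x y. pY y = x) (x # xs) \<Longrightarrow> set xs \<subseteq> V - {s} \<Longrightarrow>
    prefix (key x) (key (last (x # xs)))"
  using prefix_path_elem[of x xs "last (x # xs)"] last_in_set[of "x # xs"] by blast

text \<open>Inner vertices have only one parent, so the left path without its last arc is also a
  path in the tree of right parents.\<close>

lemma left_path':
  assumes "t \<in> V - {s}" "pX t \<noteq> pY t"
  shows "successively (\<lambda>x y. pY y = x) (R t # As t)" "last (R t # As t) = pX t"
proof -
  have *: "successively (\<lambda>x y. pX y = x) ((R t # As t) @ [t])" using left_path[OF assms] by simp
  show "last (R t # As t) = pX t"
    using * unfolding successively_append_iff by auto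
  have "successively (\<lambda>x y. pX y = x) (R t # As t)" using * unfolding successively_append_iff by auto
  moreover have "\<And>xs x. successively (\<lambda>x y. pX y = x) (x # xs) \<Longrightarrow> \<forall>z\<in>set xs. pX z = pY z \<Longrightarrow>
    successively (\<lambda>x y. pY y = x) (x # xs)"
    subgoal for xs x by (induction xs arbitrary: x) simp_all
    done
  ultimately show "successively (\<lambda>x y. pY y = x) (R t # As t)" using inner[OF assms] by blast
qed

lemma right_path':
  assumes "t \<in> V - {s}" "pX t \<noteq> pY t"
  shows "last (R t # Bs t) = pY t"
proof -
  have *: "successively (\<lambda>x y. pY y = x) ((R t # Bs t) @ [t])" using right_path[OF assms] by simp
  then show ?thesis unfolding successively_append_iff by auto
qed

lemma R_in_V: assumes "t \<in> V - {s}" "pX t \<noteq> pY t" shows "R t \<in> V"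
proof -
  have "pX (hd (As t @ [t])) = R t" using left_path[OF assms] by (cases "As t") auto
  moreover have "hd (As t @ [t]) \<in> V - {s}" using inner_in[OF assms] assms by (cases "As t") auto
  ultimately show ?thesis using parents[of "hd (As t @ [t])"] E_sub by auto
qed

lemma key_right:
  assumes "t \<in> V - {s}" "pX t \<noteq> pY t"
  shows "key (hd (Bs t @ [t])) = key (R t) @ [rk (R t, hd (Bs t @ [t]))]"
    "prefix (key (hd (Bs t @ [t]))) (key t)"
proof -
  have b: "hd (Bs t @ [t]) \<in> V - {s}" using inner_in[OF assms] assms by (cases "Bs t") auto
  have pb: "pY (hd (Bs t @ [t])) = R t" using right_path[OF assms] by (cases "Bs t") auto
  then show "key (hd (Bs t @ [t])) = key (R t) @ [rk (R t, hd (Bs t @ [t]))]"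
    using key_child b by blast
  show "prefix (key (hd (Bs t @ [t]))) (key t)"
    using right_path[OF assms] inner_in[OF assms] assms
      prefix_path[of "hd (Bs t @ [t])" "tl (Bs t @ [t])"]
    by (cases "Bs t") (auto simp: successively_Cons)
qed

lemma key_left:
  assumes "t \<in> V - {s}" "pX t \<noteq> pY t" "As t \<noteq> []"
  shows "key (hd (As t)) = key (R t) @ [rk (R t, hd (As t))]"
    "prefix (key (hd (As t))) (key (pX t))"
proof -
  have a: "hd (As t) \<in> V - {s}" using inner_in[OF assms(1,2)] assms by (cases "As t") auto
  have "pY (hd (As t)) = R t" using left_path'[OF assms(1,2)] assms(3) by (cases "As t") auto
  then show "key (hd (As t)) = key (R t) @ [rk (R t, hd (As t))]"
    using key_child a by blast
  show "prefix (key (hd (As t))) (key (pX t))"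
    using left_path'[OF assms(1,2)] inner_in[OF assms(1,2)] assms(3)
      prefix_path[of "hd (As t)" "tl (As t)"]
    by (cases "As t") (auto simp: successively_Cons split: if_splits)
qed

text \<open>The root of the cycle ranks the left path before the right one, so the subtree at the
  first inner vertex on the left precedes the subtree at the first vertex on the right.\<close>

lemma less_merge:
  assumes t: "t \<in> V - {s}" "pX t \<noteq> pY t" and "As t \<noteq> []"
    and u: "prefix (key (hd (As t))) (key u)" and w: "prefix (key (hd (Bs t @ [t]))) (key w)"
  shows "key u < key w"
proof -
  have "key (hd (As t)) < key (hd (Bs t @ [t]))" "\<not> prefix (key (hd (As t))) (key (hd (Bs t @ [t])))"
    using key_left[OF assms(1,2,3)] key_right[OF assms(1,2)] split[OF t] assms(3)
    by (auto simp: append_less_cancel)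
  then show ?thesis using u w less_append_append by (metis prefix_def)
qed

text \<open>The only arcs missing in the tree are those from a left parent into a sink. The tail of
  such an arc is either the root of the cycle, an ancestor of the sink, or lies in the subtree of
  the left path, which precedes the right path and its sink.\<close>

lemma arc_less: assumes "(u, v) \<in> E" shows "key u < key v"
proof -
  have v: "v \<in> V - {s}" using assms E_sub by blast
  show ?thesis
  proof (cases "u = pY v")
    case True then show ?thesis using key_parent[OF v] less_append_Cons by simp
  next
    case False
    then have t: "pX v \<noteq> pY v" and u: "u = pX v" using arc_parent[OF assms] by auto
    show ?thesis
    proof (cases "As v = []")
      case True
      then have "u = R v" using left_path'(2)[OF v t] u by simp
      then have "prefix (key u @ [rk (R v, hd (Bs v @ [v]))]) (key v)" using key_right[OF v t] by simp
      then show ?thesis by (metis append_prefixD less_append_Cons prefix_def prefix_le order_less_le_trans)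
    next
      case False
      then show ?thesis using less_merge[OF v t False] key_left(2)[OF v t] key_right(2)[OF v t] u by auto
    qed
  qed
qed

lemma reach_le: "(u, v) \<in> E\<^sup>* \<Longrightarrow> key u \<le> key v"
  by (induction rule: rtrancl_induct) (auto dest: arc_less)

text \<open>The path always goes on to the last child, so nothing in the subtree of its first vertex
  comes after the subtree of its last vertex.\<close>

lemma last_path_prefix:
  "successively (\<lambda>x y. pY y = x) (x # xs) \<Longrightarrow> set (x # xs) \<subseteq> V - {s} \<Longrightarrow>
   successively (\<lambda>x y. \<forall>w. (x, w) \<in> E \<longrightarrow> rk (x, w) \<le> rk (x, y)) (x # xs) \<Longrightarrow>
   v \<in> V \<Longrightarrow> prefix (key x) (key v) \<Longrightarrow> key (last (x # xs)) \<le> key v \<Longrightarrow>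
   prefix (key (last (x # xs))) (key v)"
proof (induction xs arbitrary: x)
  case (Cons y ys)
  have y: "y \<in> V - {s}" "pY y = x" using Cons by auto
  have le: "key y \<le> key v"
  proof -
    have "prefix (key y) (key (last (y # ys)))" using prefix_path[of y ys] Cons by auto
    then show ?thesis using Cons(7) prefix_le by (auto intro: order_trans)
  qed
  have "key x < key y" using arc_less parents[of y] y by auto
  then have "x \<noteq> v" using le by auto
  then obtain c where c: "c \<in> V - {s}" "pY c = x" "prefix (key c) (key v)"
    using child_towards[of x v] Cons(3,5,6) by auto
  have "(x, c) \<in> E" using parents[OF c(1)] c by auto
  then have "rk (x, c) \<le> rk (x, y)" using Cons(4) by auto
  moreover have "key c = key x @ [rk (x, c)]" "key y = key x @ [rk (x, y)]"
    using key_child c y by auto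
  moreover have "\<not> rk (x, c) < rk (x, y)"
  proof
    assume "rk (x, c) < rk (x, y)"
    then have "key c < key y" "\<not> prefix (key c) (key y)" using calculation
      by (auto simp: append_less_cancel)
    then have "key v < key y" using c(3) less_append_append by (metis append_Nil2 prefix_def)
    then show False using le by simp
  qed
  ultimately have "rk (x, c) = rk (x, y)" by simp
  then have "c = y" using rk_inj \<open>(x, c) \<in> E\<close> parents[of y] y by auto
  then show ?case using Cons c by auto
qed simp

text \<open>The path always goes on to the first child, so on the way down to \<open>t\<close> the
  preorder visits nothing but the path.\<close>

lemma first_path_between:
  "successively (\<lambda>x y. pY y = x) (xs @ [t]) \<Longrightarrow> set (xs @ [t]) \<subseteq> V - {s} \<Longrightarrow>
   successively (\<lambda>x y. \<forall>w. (x, w) \<in> E \<longrightarrow> rk (x, y) \<le> rk (x, w)) (xs @ [t]) \<Longrightarrow>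
   v \<in> V \<Longrightarrow> prefix (key (hd (xs @ [t]))) (key v) \<Longrightarrow> key v < key t \<Longrightarrow> v \<in> set xs"
proof (induction xs)
  case Nil
  then show ?case using prefix_le[of "key t" "key v"] by auto
next
  case (Cons x xs)
  let ?y = "hd (xs @ [t])"
  show ?case
  proof (cases "v = x")
    case False
    then obtain c where c: "c \<in> V - {s}" "pY c = x" "prefix (key c) (key v)"
      using child_towards[of x v] Cons by auto
    have y: "?y \<in> V - {s}" "pY ?y = x" using Cons(2,3) by (cases xs; auto)+
    have "(x, c) \<in> E" using parents[OF c(1)] c by auto
    then have "rk (x, ?y) \<le> rk (x, c)" using Cons(4) by (auto simp: successively_Cons)
    moreover have kc: "key c = key x @ [rk (x, c)]" "key ?y = key x @ [rk (x, ?y)]"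
      using key_child c y by auto
    ultimately have "key ?y \<le> key v"
      using prefix_le[OF c(3)] append_less_cancel[of "key x" "[rk (x, ?y)]" "[rk (x, c)]"]
      by (cases "rk (x, ?y) = rk (x, c)") auto
    moreover have "prefix (key ?y) (key t)"
      using prefix_path[of ?y "tl (xs @ [t])"] Cons(2,3) by (cases xs) (auto simp: successively_Cons)
    ultimately have "prefix (key ?y) (key v)"
      using Cons(7) between_prefix by (metis order.strict_implies_order prefix_def)
    then show ?thesis using Cons by (auto simp: successively_Cons)
  qed simp
qed

text \<open>For a tree arc, the preorder visits the subtrees of earlier children in between. An arc
  from a left parent leaves the end of a chain of last children and enters the end of a chain of
  first children. Both chains start next to each other at the root of the cycle, so in between there
  is only what lies below the tail, followed by the inner vertices of the right path.\<close>

lemma between: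
  assumes "(u, w) \<in> E" "v \<in> V" "key u < key v" "key v < key w"
  shows "(\<exists>c \<in> V - {s}. pY c = u \<and> prefix (key c) (key v) \<and> rk (u, c) < rk (u, w)) \<or>
    u = pX w \<and> pX w \<noteq> pY w \<and> v \<in> set (Bs w)"
proof -
  have w: "w \<in> V - {s}" and u: "u \<in> V" using assms E_sub by auto
  show ?thesis
  proof (cases "pY w = u")
    case True
    have kw: "key w = key u @ [rk (u, w)]" using key_child w True by blast
    then have "prefix (key u) (key v)" using between_prefix assms by (metis order.strict_implies_order)
    then obtain c where c: "c \<in> V - {s}" "pY c = u" "prefix (key c) (key v)"
      using child_towards[of u v] u assms by auto
    have "key c < key w" using prefix_le[OF c(3)] assms by auto
    then show ?thesis using kw key_child[OF c(1,2)] c by (auto simp: append_less_cancel)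
  next
    case False
    then have t: "pX w \<noteq> pY w" and pu: "u = pX w" using arc_parent[OF assms(1)] by auto
    note kr = key_right[OF w t]
    have kR: "key (R w) \<le> key u"
    proof (cases "As w = []")
      case True then show ?thesis using left_path'[OF w t] pu by simp
    next
      case False
      then show ?thesis using key_left[OF w t] pu prefix_le append_prefixD by metis
    qed
    obtain zs where zs: "key w = key (R w) @ rk (R w, hd (Bs w @ [w])) # zs"
      using kr by (auto simp: prefix_def)
    have "prefix (key (R w)) (key v)"
      using between_prefix[of "key (R w)" "key v"] kR assms zs by (metis order.strict_implies_order order_trans)
    moreover have "R w \<noteq> v" using kR assms by auto
    \<comment> \<open>Both ends of the missing arc and \<open>v\<close> lie below the root of the
      cycle; the child \<open>c\<close> of the root towards \<open>v\<close> decides the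
      case.\<close>
    ultimately obtain c where c: "c \<in> V - {s}" "pY c = R w" "prefix (key c) (key v)"
      using child_towards[of "R w" v] R_in_V[OF w t] assms by blast
    have Ec: "(R w, c) \<in> E" using parents[OF c(1)] c by auto
    have kc: "key c = key (R w) @ [rk (R w, c)]" using key_child c by blast
    have "key c < key w" using prefix_le[OF c(3)] assms by auto
    then have c_le: "rk (R w, c) \<le> rk (R w, hd (Bs w @ [w]))" using kc zs by (auto simp: append_less_cancel)
    have b: "hd (Bs w @ [w]) \<in> V - {s}" using inner_in[OF w t] w by (cases "Bs w") auto
    have pb: "pY (hd (Bs w @ [w])) = R w" using right_path[OF w t] by (cases "Bs w") auto
    show ?thesis
    proof (cases "rk (R w, c) = rk (R w, hd (Bs w @ [w]))")
      case True
      then have "c = hd (Bs w @ [w])" using rk_inj[OF Ec] parents[OF b] pb by metis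
      then have "v \<in> set (Bs w)"
        using first_path_between[of "Bs w" w v] right_path[OF w t] right_first[OF w t] inner_in[OF w t] w c assms
        by (auto simp: successively_Cons)
      then show ?thesis using t pu by simp
    next
      case False
      \<comment> \<open>No child of the root ranks strictly between the first vertices of the two
        paths.\<close>
      then have le: "rk (R w, c) \<le> rk (R w, hd (As w @ [w]))"
        using adjacent[OF w t Ec] c_le by auto
      show ?thesis
      proof (cases "As w = []")
        case True
        then have Ru: "R w = u" using left_path'[OF w t] pu by simp
        have "c \<noteq> w" using c pu Ru t by auto
        then have "rk (R w, c) \<noteq> rk (R w, w)" using rk_inj[OF Ec] assms Ru by metis
        then show ?thesis using le True Ru c by auto
      next
        case False
        have a: "hd (As w) \<in> V - {s}" using inner_in[OF w t] False by (cases "As w") auto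
        have pa: "pY (hd (As w)) = R w" using left_path'[OF w t] False by (cases "As w") auto
        have "\<not> rk (R w, c) < rk (R w, hd (As w))"
        proof
          assume "rk (R w, c) < rk (R w, hd (As w))"
          then have "key c < key (hd (As w))" "\<not> prefix (key c) (key (hd (As w)))"
            using kc key_left[OF w t False] by (auto simp: append_less_cancel)
          then have "key v < key u" using c(3) key_left(2)[OF w t False] pu less_append_append
            by (metis prefix_def)
          then show False using assms by simp
        qed
        then have "rk (R w, c) = rk (R w, hd (As w))" using le False by simp
        then have "c = hd (As w)" using rk_inj[OF Ec] parents[OF a] pa by metis
        have ll: "last (As w) = u" using left_path'(2)[OF w t] pu False by simp
        have "prefix (key (last (hd (As w) # tl (As w)))) (key v)"
          using last_path_prefix[of "hd (As w)" "tl (As w)" v] left_path'(1)[OF w t] left_last[OF w t]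
            inner_in[OF w t] False c(3) \<open>c = hd (As w)\<close> ll assms
          by (auto simp: successively_Cons successively_append_iff)
        then have "prefix (key u) (key v)" using ll False by simp
        moreover have "u \<noteq> v" using assms by auto
        ultimately obtain d where d: "d \<in> V - {s}" "pY d = u" "prefix (key d) (key v)"
          using child_towards[of u v] u assms by blast
        have Ed: "(u, d) \<in> E" using parents[OF d(1)] d by auto
        \<comment> \<open>In the tree, \<open>w\<close> hangs below its right parent, so it is not a
          child of \<open>u\<close>.\<close>
        have "d \<noteq> w" using d pu t by auto
        then have "rk (u, d) \<noteq> rk (u, w)" using rk_inj[OF Ed assms(1)] by auto
        moreover have "\<forall>w'. (u, w') \<in> E \<longrightarrow> rk (u, w') \<le> rk (u, w)"
          using left_last[OF w t] False ll unfolding successively_append_iff by simp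
        then have "rk (u, d) \<le> rk (u, w)" using Ed by simp
        ultimately have "rk (u, d) < rk (u, w)" by simp
        then show ?thesis using d by blast
      qed
    qed
  qed
qed

end

section \<open>Crossings and free rays when both preorders are combined\<close>

locale layout = half_layout +
  assumes left_nonempty: "t \<in> V - {s} \<Longrightarrow> pX t \<noteq> pY t \<Longrightarrow> As t \<noteq> []"
    and left_right: "t \<in> V - {s} \<Longrightarrow> pX t \<noteq> pY t \<Longrightarrow> t' \<in> V - {s} \<Longrightarrow> pX t' \<noteq> pY t' \<Longrightarrow>
      set (As t) \<inter> set (Bs t') = {}"
begin

interpretation mirror: half_layout V E s pY pX "\<lambda>e. - rk e" R Bs As
  by (rule mirror)

text \<open>With the children reversed, the root visits the right path before the left one; if the
  right path has no inner vertex, \<open>z\<close> is the root itself. Geometrically, the left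
  parent of a sink lies to the left of the right path.\<close>

lemma right_before_left:
  assumes t: "t \<in> V - {s}" "pX t \<noteq> pY t" and z: "z \<in> set (Bs t) \<or> z = pY t"
  shows "mirror.key z < mirror.key (pX t)"
proof -
  note t' = t(1) not_sym[OF t(2)]
  have "pX t \<in> set (As t)"
    using left_path'(2)[OF t] left_nonempty[OF t] last_in_set by fastforce
  moreover obtain a as where as: "As t = a # as" using left_nonempty[OF t] by (cases "As t") auto
  moreover have "successively (\<lambda>x y. pX y = x) ([R t] @ (a # as) @ [t])"
    using left_path[OF t] as by (simp del: successively.simps)
  then have "successively (\<lambda>x y. pX y = x) (a # as)" unfolding successively_append_iff by blast
  moreover have "set as \<subseteq> V - {s}" using inner_in[OF t] as by simp
  ultimately have left: "prefix (mirror.key (hd (As t))) (mirror.key (pX t))"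
    using mirror.prefix_path_elem[of a as "pX t"] by simp
  show ?thesis
  proof (cases "Bs t = []")
    case True
    then have "z = R t" using z right_path'[OF t] by simp
    have "mirror.key (R t) < mirror.key (hd (As t))"
      using mirror.key_right(1)[OF t'] less_append_Cons left_nonempty[OF t] by simp
    then show ?thesis using prefix_le[OF left] \<open>z = R t\<close> by simp
  next
    case False
    have "z \<in> set (Bs t)" using z right_path'[OF t] False last_in_set[OF False] by auto
    then have "prefix (mirror.key (hd (Bs t))) (mirror.key z)"
      using mirror.prefix_path_elem[of "hd (Bs t)" "tl (Bs t)" z] mirror.left_path'(1)[OF t']
        inner_in[OF t] False
      by (cases "Bs t") (auto simp: successively_Cons)
    then show ?thesis using mirror.less_merge[OF t' False] left left_nonempty[OF t] by simp
  qed
qed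

text \<open>The left path has an inner vertex, so the left parent is one, and the left path leaves
  its inner vertices by their last arcs. With an empty left path the left parent would be the root,
  which may have later arcs; hence a transitive arc must be taken as the right path.\<close>

lemma last_arc:
  assumes t: "t \<in> V - {s}" "pX t \<noteq> pY t" and "(pX t, w) \<in> E"
  shows "rk (pX t, w) \<le> rk (pX t, t)"
  using left_last[OF t] left_path'(2)[OF t] left_nonempty[OF t] assms(3)
  by (auto simp: successively_append_iff)

text \<open>The right parent of \<open>v\<close> is still reachable from \<open>u\<close>, and both
  preorders respect reachability.\<close>

lemma below_parent:
  assumes "u \<in> V" "v \<in> V" "u \<noteq> v" "prefix (key u) (key v)"
  shows "mirror.key u \<le> mirror.key (pY v)"
proof -
  have v: "v \<in> V - {s}" using assms key_s key_inj by fastforce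
  have "prefix (key u) (key (pY v))"
    using assms key_inj[of u v] key_parent[OF v] by (auto simp: prefix_snoc)
  then show ?thesis using prefix_reach mirror.reach_le assms(1) parent_in_V[OF v] by blast
qed

lemma prefix_parent: "c \<in> V - {s} \<Longrightarrow> pY c = u \<Longrightarrow> prefix (key c) (key v) \<Longrightarrow> prefix (key u) (key v)"
  using key_child append_prefixD by metis

text \<open>The vertical segment of \<open>(u, v)\<close> would meet the horizontal segment of
  \<open>(u', v')\<close>. If \<open>v'\<close> is in the subtree of \<open>u\<close>, then
  \<open>u'\<close> is too far right to be the right parent of \<open>v'\<close>; so it is the left
  one, and \<open>mirror.between\<close> yields an arc that leaves \<open>u'\<close> after
  \<open>(u', v')\<close>, against \<open>last_arc\<close>. Otherwise \<open>v'\<close> is inside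
  the right path of the cycle with sink \<open>v\<close>, and \<open>u\<close>, the left parent of
  \<open>v\<close>, is to the left of that path.\<close>

lemma no_crossing:
  assumes e: "(u, v) \<in> E" and e': "(u', v') \<in> E"
    and x: "mirror.key u' < mirror.key u" "mirror.key u < mirror.key v'"
    and y: "key u < key v'" "key v' < key v"
  shows False
proof -
  have V: "u \<in> V" "v \<in> V - {s}" "u' \<in> V" "v' \<in> V - {s}" using e e' E_sub by auto
  from V(4) have "v' \<in> V" by simp
  from between[OF e this y] show False
  proof (elim disjE bexE conjE)
    fix c assume c: "c \<in> V - {s}" "pY c = u" "prefix (key c) (key v')"
    have "mirror.key u \<le> mirror.key (pY v')"
      using below_parent[of u v'] prefix_parent[OF c] V y by auto
    then have ne: "u' \<noteq> pY v'" using x by auto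
    then have u': "u' = pX v'" using arc_parent e' by blast
    from mirror.between[OF e' V(1) x] ne obtain c' where
      "c' \<in> V - {s}" "pX c' = u'" "rk (u', v') < rk (u', c')" by auto
    then show False using last_arc[of v' c'] parents[of c'] u' ne V by fastforce
  next
    assume "u = pX v" "pX v \<noteq> pY v" "v' \<in> set (Bs v)"
    then show False using right_before_left[of v v'] V x by auto
  qed
qed

text \<open>A vertical segment at \<open>u'\<close> blocks the view to the left from just below the
  bend of \<open>(u, w)\<close>. If \<open>w\<close> were below \<open>u'\<close> in the tree, then
  \<open>u\<close> would be further right than the right parent of \<open>w\<close>, which no parent
  of \<open>w\<close> is. If \<open>w = w'\<close>, the blocked parent is the right one.\<close>

lemma left_free:
  assumes e: "(u, w) \<in> E" and e': "(u', w') \<in> E"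
    and "mirror.key u < mirror.key u'" "key u' < key w" "key w \<le> key w'"
  shows "pX w \<noteq> pY w \<and> u = pY w \<or> (\<exists>t \<in> V - {s}. pX t \<noteq> pY t \<and> w \<in> set (Bs t))"
proof -
  have V: "u \<in> V" "w \<in> V - {s}" "u' \<in> V" "w' \<in> V - {s}" using e e' E_sub by auto
  show ?thesis
  proof (cases "w = w'")
    case True
    then have "u \<noteq> u'" using assms by auto
    then have "pX w \<noteq> pY w" "u = pX w \<and> u' = pY w \<or> u = pY w \<and> u' = pX w"
      using arc_parent e e' True by metis+
    then show ?thesis using right_before_left[of w "pY w"] V assms by auto
  next
    case False
    then have y: "key u' < key w" "key w < key w'" using assms key_inj V by (auto simp: le_less)
    from V(2) have "w \<in> V" by simp
    from between[OF e' this y] show ?thesis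
    proof (elim disjE bexE conjE)
      fix c assume c: "c \<in> V - {s}" "pY c = u'" "prefix (key c) (key w)"
      have "mirror.key u' \<le> mirror.key (pY w)"
        using below_parent[of u' w] prefix_parent[OF c] V y by auto
      then have "u \<noteq> pY w" "mirror.key u < mirror.key (pY w)" using assms by auto
      then show ?thesis using right_before_left[of w "pY w"] arc_parent[OF e] V by auto
    qed (use V in auto)
  qed
qed

text \<open>Descendants of \<open>u'\<close> lie to its left, whereas \<open>v\<close> lies to its
  right; so \<open>between\<close> leaves only the case of a right path.\<close>

lemma left_free_vertex:
  assumes "v \<in> V" and e': "(u', w') \<in> E"
    and "mirror.key v < mirror.key u'" "key u' < key v" "key v < key w'"
  shows "\<exists>t \<in> V - {s}. pX t \<noteq> pY t \<and> v \<in> set (Bs t)"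
proof -
  have V: "u' \<in> V" "w' \<in> V - {s}" using e' E_sub by auto
  from between[OF e' assms(1,4,5)] show ?thesis
  proof (elim disjE bexE conjE)
    fix c assume "c \<in> V - {s}" "pY c = u'" "prefix (key c) (key v)"
    then have "(u', v) \<in> E\<^sup>*" using prefix_parent prefix_reach V assms(1) by blast
    then show ?thesis using mirror.reach_le[of u' v] assms by auto
  qed (use V in auto)
qed

text \<open>By \<open>last_arc\<close>, an arc that is not the last one at its tail is a tree arc.
  So \<open>w\<close> is a child of \<open>u\<close>, and \<open>c\<close> is a later child or a
  sink with left parent \<open>u\<close>; in the latter case \<open>c\<close> is outside the subtree
  of \<open>u\<close> and comes after all of it. Hence the drawn clockwise order of outgoing arcs is
  the order of their ranks.\<close>

lemma out_order:
  assumes e: "(u, w) \<in> E" and e': "(u, c) \<in> E" and rk: "rk (u, w) < rk (u, c)"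
  shows "key w < key c"
proof -
  have V: "u \<in> V" "w \<in> V - {s}" "c \<in> V - {s}" using e e' E_sub by auto
  have w: "pY w = u"
    using last_arc[of w c] arc_parent[OF e] V e' rk by (cases "pX w = pY w") auto
  show ?thesis
  proof (cases "pY c = u")
    case True
    then show ?thesis using key_child V w rk by (simp add: append_less_cancel)
  next
    case False
    then have c: "pX c \<noteq> pY c" "u = pX c" using arc_parent[OF e'] by auto
    have "\<not> prefix (key u) (key c)"
    proof
      assume "prefix (key u) (key c)"
      then have "mirror.key u \<le> mirror.key (pY c)" using below_parent[of u c] V arc_less[OF e'] by auto
      then show False using right_before_left[of c "pY c"] V c by auto
    qed
    then have "key u @ [rk (u, w)] < key c @ []"
      using less_append_append[OF arc_less[OF e']] by blast
    then show ?thesis using key_child[of w u] V w by simp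
  qed
qed

text \<open>The arc passes above \<open>v\<close>. By \<open>mirror.between\<close>,
  \<open>v\<close> is inside a left path or reachable from a child of \<open>u\<close> ranked after
  \<open>w\<close>; such a child is higher than \<open>w\<close> by \<open>out_order\<close>, and so
  would be \<open>v\<close>.\<close>

lemma up_free_vertex:
  assumes v: "v \<in> V" and e: "(u, w) \<in> E"
    and x: "mirror.key u < mirror.key v" "mirror.key v < mirror.key w" and y: "key v < key w"
  shows "\<exists>t \<in> V - {s}. pX t \<noteq> pY t \<and> v \<in> set (As t)"
proof -
  have w: "w \<in> V - {s}" using e E_sub by blast
  from mirror.between[OF e v x] show ?thesis
  proof (elim disjE bexE conjE)
    fix c assume c: "c \<in> V - {s}" "pX c = u" "prefix (mirror.key c) (mirror.key v)" "- rk (u, c) < - rk (u, w)"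
    then have "key w < key c" using out_order[OF e, of c] parents[of c] by auto
    moreover have "key c \<le> key v" using mirror.prefix_reach[of c v] reach_le c v by auto
    ultimately show ?thesis using y by auto
  qed (use w in metis)
qed

text \<open>Counting predecessors replaces keys by integers in the same order. The x-coordinate is
  negated because the mirrored preorder runs from right to left.\<close>

definition pos :: "'a \<Rightarrow> int \<times> int" where
  "pos v = (- int (card {w \<in> V. mirror.key w < mirror.key v}), int (card {w \<in> V. key w < key v}))"

lemma card_less_iff:
  fixes f :: "'a \<Rightarrow> 'b::linorder"
  assumes "v \<in> V"
  shows "card {u \<in> V. f u < f v} < card {u \<in> V. f u < f w} \<longleftrightarrow> f v < f w"
proof (cases "f v < f w")
  case True
  then have "{u \<in> V. f u < f v} \<subset> {u \<in> V. f u < f w}" using assms by (auto intro: less_trans)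
  then show ?thesis using True finite_V by (simp add: psubset_card_mono)
next
  case False
  then have "{u \<in> V. f u < f w} \<subseteq> {u \<in> V. f u < f v}" by auto
  then have "card {u \<in> V. f u < f w} \<le> card {u \<in> V. f u < f v}"
    using finite_V by (simp add: card_mono)
  then show ?thesis using False by simp
qed

lemma pos_less:
  assumes "v \<in> V" "w \<in> V"
  shows "fst (pos v) < fst (pos w) \<longleftrightarrow> mirror.key w < mirror.key v"
    "snd (pos v) < snd (pos w) \<longleftrightarrow> key v < key w"
  using assms card_less_iff[of w mirror.key v] card_less_iff[of v key w] by (auto simp: pos_def)

end

subsection \<open>Drawings on an integer grid\<close>

text \<open>A ray is connected and unbounded, so the component that contains it is
  unbounded.\<close>

lemma outside_ray:
  fixes S :: "'b::real_normed_vector set"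
  assumes ray: "\<And>c. c \<ge> 0 \<Longrightarrow> q + c *\<^sub>R d \<notin> S" and "d \<noteq> 0"
  shows "q \<in> outside S"
proof -
  let ?ray = "(\<lambda>c. q + c *\<^sub>R d) ` {0..}"
  have "topological_space_class.connected ?ray"
    by (intro connected_continuous_image continuous_intros) auto
  moreover have "q \<in> ?ray" by (rule image_eqI[of _ _ 0]) auto
  moreover have "?ray \<subseteq> - S" using ray by auto
  ultimately have sub: "?ray \<subseteq> connected_component_set (- S) q"
    by (intro connected_component_maximal) auto
  have "\<not> bounded ?ray"
  proof
    assume "bounded ?ray"
    then obtain B where B: "\<And>c. c \<ge> 0 \<Longrightarrow> norm (q + c *\<^sub>R d) \<le> B"
      unfolding bounded_iff by auto
    define c where "c = (\<bar>B\<bar> + norm q + 1) / norm d"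
    have "c \<ge> 0" "c * norm d = \<bar>B\<bar> + norm q + 1" using assms(2) by (auto simp: c_def)
    moreover have "norm (c *\<^sub>R d) \<le> norm (q + c *\<^sub>R d) + norm q"
      using norm_triangle_ineq4[of "q + c *\<^sub>R d" q] by simp
    ultimately show False using B[of c] by simp
  qed
  then show ?thesis using sub ray[of 0] bounded_subset by (auto simp: outside_def)
qed

lemma no_int_between: "real_of_int a < real_of_int b \<Longrightarrow> real_of_int b < real_of_int a + 1 \<Longrightarrow> False"
  using of_int_less_iff[of b "a + 1", where 'a = real] by simp

text \<open>With integer coordinates, a line at a fractional x-coordinate meets no vertex and no
  vertical segment, and a line at a fractional height meets no vertex and no horizontal
  segment.\<close>

locale grid_drawing =
  fixes G :: "'a pair_pre_digraph" and X Y :: "'a \<Rightarrow> int"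
  assumes arcs_sub: "parcs G \<subseteq> pverts G \<times> pverts G"
    and inj: "inj_on X (pverts G)" "inj_on Y (pverts G)"
    and arc: "(u, v) \<in> parcs G \<Longrightarrow> X v < X u \<and> Y u < Y v"
    and no_crossing: "(u, v) \<in> parcs G \<Longrightarrow> (u', v') \<in> parcs G \<Longrightarrow>
      X v' < X u \<Longrightarrow> X u < X u' \<Longrightarrow> Y u < Y v' \<Longrightarrow> Y v' < Y v \<Longrightarrow> False"
begin

definition p :: "'a \<Rightarrow> real \<times> real" where
  "p v = (real_of_int (X v), real_of_int (Y v))"

lemma vertical_open:
  fixes x y :: real
  assumes "(u, v) \<in> parcs G" "(x, y) \<in> open_segment (p u) (bend p (u, v))"
  shows "x = X u \<and> Y u < y \<and> y < Y v"
  using assms(2) arc[OF assms(1)] open_segment_PairD[of x y "X u" "Y u" "X u" "Y v"]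
    closed_segment_PairD[of x y "X u" "Y u" "X u" "Y v"] open_closed_segment
  by (auto simp: p_def bend_def open_segment_eq_real_ivl)

lemma horizontal_open:
  fixes x y :: real
  assumes "(u, v) \<in> parcs G" "(x, y) \<in> open_segment (bend p (u, v)) (p v)"
  shows "y = Y v \<and> X v < x \<and> x < X u"
  using assms(2) arc[OF assms(1)] open_segment_PairD[of x y "X u" "Y v" "X v" "Y v"]
    closed_segment_PairD[of x y "X u" "Y v" "X v" "Y v"] open_closed_segment
  by (auto simp: p_def bend_def open_segment_eq_real_ivl)

lemma drawing_cases:
  fixes x y :: real
  assumes "(x, y) \<in> drawing G p"
  obtains v where "v \<in> pverts G" "x = X v" "y = Y v"
  | u v where "(u, v) \<in> parcs G" "x = X u" "Y u \<le> y" "y \<le> Y v"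
  | u v where "(u, v) \<in> parcs G" "y = Y v" "X v \<le> x" "x \<le> X u"
proof -
  consider v where "v \<in> pverts G" "(x, y) = p v"
    | u v where "(u, v) \<in> parcs G" "(x, y) \<in> closed_segment (p u) (bend p (u, v))"
    | u v where "(u, v) \<in> parcs G" "(x, y) \<in> closed_segment (bend p (u, v)) (p v)"
    using assms by (auto simp: drawing_def edge_curve_def)
  then show thesis
  proof cases
    case 1 then show ?thesis using that(1) by (auto simp: p_def)
  next
    case 2
    then show ?thesis using that(2)[of u v] arc[OF 2(1)]
      closed_segment_PairD[of x y "X u" "Y u" "X u" "Y v"]
      by (auto simp: p_def bend_def closed_segment_eq_real_ivl)
  next
    case 3
    then show ?thesis using that(3)[of u v] arc[OF 3(1)]
      closed_segment_PairD[of x y "X u" "Y v" "X v" "Y v"]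
      by (auto simp: p_def bend_def closed_segment_eq_real_ivl)
  qed
qed

lemma planar: "planar_L_drawing G p"
  unfolding planar_L_drawing_def
proof (intro conjI ballI impI)
  show "L_drawing G p"
    using inj by (auto simp: L_drawing_def inj_on_def p_def)
  have no: "open_segment (p (fst e)) (bend p e) \<inter> open_segment (bend p e') (p (snd e')) = {}"
    if "e \<in> parcs G" "e' \<in> parcs G" for e e'
  proof (rule ccontr)
    assume "\<not> ?thesis"
    then obtain x y where z: "(x, y) \<in> open_segment (p (fst e)) (bend p e)"
      "(x, y) \<in> open_segment (bend p e') (p (snd e'))" by auto
    have "x = X (fst e) \<and> Y (fst e) < y \<and> y < Y (snd e)"
      using vertical_open[of "fst e" "snd e" x y] that z by simp
    moreover have "y = Y (snd e') \<and> X (snd e') < x \<and> x < X (fst e')"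
      using horizontal_open[of "fst e'" "snd e'" x y] that z by simp
    ultimately show False
      using no_crossing[of "fst e" "snd e" "fst e'" "snd e'"] that by auto
  qed
  fix e e' assume "e \<in> parcs G" "e' \<in> parcs G" "e \<noteq> e'"
  then show "\<not> cross p e e'" using no by (auto simp: cross_def)
qed

lemma upward_leftward: "upward G p" "leftward G p"
  using arc by (auto simp: upward_def leftward_def bend_def p_def)

text \<open>A vertex belongs to the drawing, so it only remains to approach it from outside. The
  bound \<open>2 * e\<close> allows an offset of \<open>e\<close> in both coordinates.\<close>

lemma frontier_outsideI:
  assumes "v \<in> pverts G" and "\<And>e. 0 < e \<Longrightarrow> e < 1 \<Longrightarrow> \<exists>z \<in> outside (drawing G p). dist z (p v) \<le> 2 * e"
  shows "p v \<in> frontier (outside (drawing G p))"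
proof -
  have "p v \<in> drawing G p" using assms(1) by (simp add: drawing_def)
  then have "p v \<notin> interior (outside (drawing G p))"
    using interior_subset outside_no_overlap by fastforce
  moreover have "p v \<in> closure (outside (drawing G p))"
    unfolding closure_approachable
  proof (intro allI impI)
    fix e :: real assume "e > 0"
    then obtain z where "z \<in> outside (drawing G p)" "dist z (p v) \<le> 2 * min (1/2) (e/3)"
      \<comment> \<open>\<open>1/2\<close> keeps the offset below the grid width, and
        \<open>e/3\<close> makes the distance strictly smaller than \<open>e\<close>.\<close>
      using assms(2)[of "min (1/2) (e/3)"] by fastforce
    then show "\<exists>z\<in>outside (drawing G p). dist z (p v) < e"
      using \<open>e > 0\<close> by (intro bexI[of _ z]) auto
  qed
  ultimately show ?thesis by (simp add: frontier_def)
qed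

text \<open>Arcs entering \<open>v\<close> arrive from the right, and all other horizontal segments
  have other heights. So only vertical segments could block the ray.\<close>

lemma left_ray:
  assumes v: "v \<in> pverts G"
    and free: "\<And>u w. (u, w) \<in> parcs G \<Longrightarrow> X u < X v \<Longrightarrow> Y u < Y v \<Longrightarrow> Y v < Y w \<Longrightarrow> False"
  shows "p v \<in> frontier (outside (drawing G p))"
proof (rule frontier_outsideI[OF v])
  fix e :: real assume e: "0 < e" "e < 1"
  have "(X v - e, real_of_int (Y v)) + c *\<^sub>R (- 1, 0) \<notin> drawing G p" if c: "c \<ge> 0" for c
  proof
    assume "(X v - e, real_of_int (Y v)) + c *\<^sub>R (- 1, 0) \<in> drawing G p"
    then have "(X v - e - c, real_of_int (Y v)) \<in> drawing G p" by simp
    then show False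
    proof (cases rule: drawing_cases)
      case (1 w)
      then have "w = v" using inj(2) v by (auto simp: inj_on_def)
      then show False using 1 e c by simp
    next
      case (2 u w)
      have "X u < X v" using 2(2) e c by linarith
      moreover have "u \<in> pverts G" "w \<in> pverts G" using arcs_sub 2(1) by auto
      moreover have "Y u \<noteq> Y v" using inj(2) v calculation by (auto simp: inj_on_def)
      moreover have "Y w \<noteq> Y v"
        using inj(2) v calculation arc[OF 2(1)] by (auto simp: inj_on_def)
      ultimately show False using free[OF 2(1)] 2 by auto
    next
      case (3 u w)
      have "w \<in> pverts G" using arcs_sub 3(1) by auto
      then have "w = v" using inj(2) v 3 by (auto simp: inj_on_def)
      then show False using 3 e c by simp
    qed
  qed
  then have "(X v - e, real_of_int (Y v)) \<in> outside (drawing G p)"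
    by (rule outside_ray) (simp_all add: zero_prod_def)
  then show "\<exists>z \<in> outside (drawing G p). dist z (p v) \<le> 2 * e"
    using e by (intro bexI[of _ "(X v - e, real_of_int (Y v))"]) (auto simp: p_def dist_Pair_Pair dist_real_def)
qed

text \<open>The shift to the right leaves the vertical grid lines; the shift upwards avoids the arcs
  that enter \<open>v\<close> from the right. So only horizontal segments above \<open>v\<close>
  could block the ray.\<close>

lemma up_ray:
  assumes v: "v \<in> pverts G"
    and free: "\<And>u w. (u, w) \<in> parcs G \<Longrightarrow> X w < X v \<Longrightarrow> X v < X u \<Longrightarrow> Y v < Y w \<Longrightarrow> False"
  shows "p v \<in> frontier (outside (drawing G p))"
proof (rule frontier_outsideI[OF v])
  fix e :: real assume e: "0 < e" "e < 1"
  have "(X v + e, Y v + e) + c *\<^sub>R (0, 1) \<notin> drawing G p" if c: "c \<ge> 0" for c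
  proof
    assume "(X v + e, Y v + e) + c *\<^sub>R (0, 1) \<in> drawing G p"
    then have "(X v + e, Y v + e + c) \<in> drawing G p" by simp
    then show False
    proof (cases rule: drawing_cases)
      case (3 u w)
      have "Y v < Y w" "X w \<le> X v" "X v < X u" using 3 e c by linarith+
      moreover have "w \<in> pverts G" using arcs_sub 3(1) by auto
      then have "X v \<noteq> X w" using inj(1) v \<open>Y v < Y w\<close> by (auto simp: inj_on_def)
      ultimately show False using free[OF 3(1)] by auto
    next
      case (1 w)
      then show False using e no_int_between[of "X v" "X w"] by simp
    next
      case (2 u w)
      then show False using e no_int_between[of "X v" "X u"] by simp
    qed
  qed
  then have "(X v + e, Y v + e) \<in> outside (drawing G p)"
    by (rule outside_ray) (simp_all add: zero_prod_def)
  moreover have "dist (X v + e, Y v + e) (p v) \<le> 2 * e"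
  proof -
    have "dist (X v + e, Y v + e) (p v) = sqrt (e\<^sup>2 + e\<^sup>2)"
      by (simp add: p_def dist_Pair_Pair dist_real_def)
    also have "\<dots> \<le> \<bar>e\<bar> + \<bar>e\<bar>" by (rule sqrt_sum_squares_le_sum_abs)
    finally show ?thesis using e by simp
  qed
  ultimately show "\<exists>z \<in> outside (drawing G p). dist z (p v) \<le> 2 * e" by blast
qed

text \<open>The ray to the left runs at a fractional height, so only vertical segments could block
  it.\<close>

lemma below_arc:
  assumes a: "(u, w) \<in> parcs G" and e: "0 < e" "e < 1"
    and free: "\<And>u' w'. (u', w') \<in> parcs G \<Longrightarrow> X u' < X u \<Longrightarrow> Y u' < Y w \<Longrightarrow> Y w \<le> Y w' \<Longrightarrow> False"
  shows "bend p (u, w) - (e, e) \<in> outside (drawing G p)"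
proof -
  have "(X u - e, Y w - e) + c *\<^sub>R (- 1, 0) \<notin> drawing G p" if c: "c \<ge> 0" for c
  proof
    assume "(X u - e, Y w - e) + c *\<^sub>R (- 1, 0) \<in> drawing G p"
    then have "(X u - e - c, Y w - e) \<in> drawing G p" by simp
    then show False
    proof (cases rule: drawing_cases)
      case (2 u' w')
      have "X u' < X u" "Y u' < Y w" "Y w \<le> Y w'" using 2 e c by linarith+
      then show False using free[OF 2(1)] by auto
    next
      case (1 v)
      then show False using e no_int_between[of "Y v" "Y w"] by simp
    next
      case (3 u' w')
      then show False using e no_int_between[of "Y w'" "Y w"] by simp
    qed
  qed
  then have "(X u - e, Y w - e) \<in> outside (drawing G p)"
    by (rule outside_ray) (simp_all add: zero_prod_def)
  then show ?thesis by (simp add: bend_def p_def)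
qed

end

section \<open>The drawing given by a layout\<close>

context layout
begin

definition place :: "'a \<Rightarrow> real \<times> real" where
  "place v = (real_of_int (fst (pos v)), real_of_int (snd (pos v)))"

text \<open>The arcs on right paths: an inner vertex has a single incoming arc, so its head
  identifies the arc, while at the sink the tail must be checked.\<close>

definition right_arc :: "'a \<times> 'a \<Rightarrow> bool" where
  "right_arc e \<longleftrightarrow> (\<exists>t \<in> V - {s}. pX t \<noteq> pY t \<and> (snd e = t \<and> fst e = pY t \<or> snd e \<in> set (Bs t)))"

lemma arc_place: "(u, v) \<in> E \<Longrightarrow> fst (pos v) < fst (pos u) \<and> snd (pos u) < snd (pos v)"
  using E_sub pos_less arc_less half_layout.arc_less[OF mirror, of u v] by blast

lemma place_out_order:
  "(u, v) \<in> E \<Longrightarrow> (u, w) \<in> E \<Longrightarrow> rk (u, v) < rk (u, w) \<Longrightarrow> snd (place v) < snd (place w)"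
  using out_order[of u v w] E_sub pos_less(2)[of v w] by (auto simp: place_def)

lemma place_in_order: "t \<in> V - {s} \<Longrightarrow> pX t \<noteq> pY t \<Longrightarrow> fst (place (pX t)) < fst (place (pY t))"
  using right_before_left[of t "pY t"] parents[of t] E_sub pos_less(1)[of "pX t" "pY t"]
  by (auto simp: place_def)

context
  fixes G :: "'a pair_pre_digraph"
  assumes V: "pverts G = V" and E: "parcs G = E"
begin

interpretation mirror: half_layout V E s pY pX "\<lambda>e. - rk e" R Bs As
  by (rule mirror)

interpretation grid_drawing G "fst \<circ> pos" "snd \<circ> pos"
  rewrites "grid_drawing.p (fst \<circ> pos) (snd \<circ> pos) = place"
proof -
  show "grid_drawing G (fst \<circ> pos) (snd \<circ> pos)"
  proof
    show "parcs G \<subseteq> pverts G \<times> pverts G" using E_sub V E by auto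
    show "inj_on (fst \<circ> pos) (pverts G)"
    proof (rule inj_onI)
      fix u v assume "u \<in> pverts G" "v \<in> pverts G" "(fst \<circ> pos) u = (fst \<circ> pos) v"
      then have "u \<in> V" "v \<in> V" "\<not> mirror.key u < mirror.key v" "\<not> mirror.key v < mirror.key u"
        using pos_less(1)[of u v] pos_less(1)[of v u] V by auto
      then show "u = v" using mirror.key_inj linorder_neqE by metis
    qed
    show "inj_on (snd \<circ> pos) (pverts G)"
    proof (rule inj_onI)
      fix u v assume "u \<in> pverts G" "v \<in> pverts G" "(snd \<circ> pos) u = (snd \<circ> pos) v"
      then have "u \<in> V" "v \<in> V" "\<not> key u < key v" "\<not> key v < key u"
        using pos_less(2)[of u v] pos_less(2)[of v u] V by auto
      then show "u = v" using key_inj linorder_neqE by metis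
    qed
    show "(fst \<circ> pos) v < (fst \<circ> pos) u \<and> (snd \<circ> pos) u < (snd \<circ> pos) v" if "(u, v) \<in> parcs G" for u v
      using arc_place that E by simp
    show False if "(u, v) \<in> parcs G" "(u', v') \<in> parcs G"
      "(fst \<circ> pos) v' < (fst \<circ> pos) u" "(fst \<circ> pos) u < (fst \<circ> pos) u'"
      "(snd \<circ> pos) u < (snd \<circ> pos) v'" "(snd \<circ> pos) v' < (snd \<circ> pos) v" for u v u' v'
    proof -
      have "u \<in> V" "v \<in> V" "u' \<in> V" "v' \<in> V" using that E E_sub by auto
      then show False using no_crossing[of u v u' v'] that E pos_less by simp
    qed
  qed
  then show "grid_drawing.p (fst \<circ> pos) (snd \<circ> pos) = place"
    by (simp add: grid_drawing.p_def place_def fun_eq_iff)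
qed

lemma place_drawing: "upward_leftward_outerplanar_L_drawing G place"
proof -
  have "place v \<in> frontier (outside (drawing G place))" if v: "v \<in> V" for v
  proof (cases "\<exists>t \<in> V - {s}. pX t \<noteq> pY t \<and> v \<in> set (Bs t)")
    case True
    show ?thesis
    proof (rule up_ray)
      fix u w assume *: "(u, w) \<in> parcs G" "(fst \<circ> pos) w < (fst \<circ> pos) v" "(fst \<circ> pos) v < (fst \<circ> pos) u"
        "(snd \<circ> pos) v < (snd \<circ> pos) w"
      then have "u \<in> V" "w \<in> V" using E E_sub by auto
      then have "\<exists>t \<in> V - {s}. pX t \<noteq> pY t \<and> v \<in> set (As t)"
        using up_free_vertex[of v u w] * v E pos_less by simp
      then show False using True left_right by blast
    qed (use v V in simp)
  next
    case False
    show ?thesis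
    proof (rule left_ray)
      fix u w assume *: "(u, w) \<in> parcs G" "(fst \<circ> pos) u < (fst \<circ> pos) v"
        "(snd \<circ> pos) u < (snd \<circ> pos) v" "(snd \<circ> pos) v < (snd \<circ> pos) w"
      then have "u \<in> V" "w \<in> V" using E E_sub by auto
      then show False using left_free_vertex[of v u w] * v E pos_less False by simp
    qed (use v V in simp)
  qed
  then show ?thesis
    using planar upward_leftward V
    by (simp add: upward_leftward_outerplanar_L_drawing_def outerplanar_L_drawing_def)
qed

text \<open>By \<open>left_free\<close>, only arcs on right paths can have an obstacle to the left
  just below the bend.\<close>

lemma place_outer_face:
  assumes "\<And>e. e \<in> parcs G \<inter> f \<Longrightarrow> \<not> right_arc e"
  shows "maintains_outer_face G place f"
  unfolding maintains_outer_face_def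
proof
  fix e assume e: "e \<in> parcs G \<inter> f"
  obtain u w where uw: "e = (u, w)" by fastforce
  have "bend place e - (x, x) \<in> outside (drawing G place)" if x: "0 < x" "x < 1" for x
    unfolding uw
  proof (rule below_arc[OF _ x])
    fix u' w' assume *: "(u', w') \<in> parcs G" "(fst \<circ> pos) u' < (fst \<circ> pos) u"
      "(snd \<circ> pos) u' < (snd \<circ> pos) w" "(snd \<circ> pos) w \<le> (snd \<circ> pos) w'"
    have V': "u \<in> V" "w \<in> V - {s}" "u' \<in> V" "w' \<in> V" using * e E E_sub uw by auto
    then have "\<not> key w' < key w" using * pos_less(2)[of w' w] by auto
    then have "key w \<le> key w'" by simp
    moreover have "mirror.key u < mirror.key u'" "key u' < key w"
      using * V' pos_less(1)[of u' u] pos_less(2)[of u' w] by simp_all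
    moreover have "(u, w) \<in> E" "(u', w') \<in> E" using e * E uw by simp_all
    ultimately have "pX w \<noteq> pY w \<and> u = pY w \<or> (\<exists>t \<in> V - {s}. pX t \<noteq> pY t \<and> w \<in> set (Bs t))"
      using left_free by blast
    then have "right_arc (u, w)" using V'(2) unfolding right_arc_def by auto
    then show False using assms[OF e] uw by simp
  qed (use e uw in auto)
  then show "\<forall>\<^sub>F x in at_right 0. bend place e - (x, x) \<in> outside (drawing G place)"
    unfolding eventually_at_right_field by (intro exI[of _ 1]) auto
qed

end

end

subsection \<open>Cycles with a single source and a single sink\<close>

primrec path_arcs :: "'a \<Rightarrow> 'a list \<Rightarrow> 'a \<Rightarrow> ('a \<times> 'a) list" where
  "path_arcs u [] v = [(u, v)]"
| "path_arcs u (x # xs) v = (u, x) # path_arcs x xs v"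

lemma path_arcs_append: "path_arcs u (xs @ x # ys) v = path_arcs u xs x @ path_arcs x ys v"
  by (induction xs arbitrary: u) auto

lemma path_arcs_rev: "path_arcs v (rev xs) u = rev (map prod.swap (path_arcs u xs v))"
  by (induction xs arbitrary: u) (auto simp: path_arcs_append)

lemma path_arcs_verts:
  "(x, y) \<in> set (path_arcs u xs v) \<Longrightarrow> x \<in> set (u # xs) \<and> y \<in> set (xs @ [v])"
  by (induction xs arbitrary: u) auto

lemma path_arcs_succ:
  "distinct (u # xs @ [v]) \<Longrightarrow> (x, y) \<in> set (path_arcs u xs v) \<Longrightarrow> (x, z) \<in> set (path_arcs u xs v) \<Longrightarrow> y = z"
proof (induction xs arbitrary: u)
  case (Cons a xs)
  then show ?case
    using path_arcs_verts[of u y a xs v] path_arcs_verts[of u z a xs v] Cons.IH[of a] by auto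
qed auto

lemma path_arcs_first: "(u, hd (xs @ [v])) \<in> set (path_arcs u xs v)"
  by (cases xs) auto

lemma path_arcs_last: "(last (u # xs), v) \<in> set (path_arcs u xs v)"
  by (induction xs arbitrary: u) auto

lemma path_arcs_pred_ex: "z \<in> set xs \<Longrightarrow> \<exists>x \<in> set (u # xs). (x, z) \<in> set (path_arcs u xs v)"
  by (induction xs arbitrary: u) auto

lemma path_arcs_succ_ex: "z \<in> set (u # xs) \<Longrightarrow> \<exists>y \<in> set (xs @ [v]). (z, y) \<in> set (path_arcs u xs v)"
  by (induction xs arbitrary: u) auto

lemma path_arcs_into_last:
  "distinct (u # xs @ [v]) \<Longrightarrow> (x, v) \<in> set (path_arcs u xs v) \<Longrightarrow> x = last (u # xs)"
  by (induction xs arbitrary: u) fastforce+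

lemma successively_path_arcs:
  "successively P (u # xs @ [v]) \<longleftrightarrow> (\<forall>(x, y) \<in> set (path_arcs u xs v). P x y)"
  by (induction xs arbitrary: u) auto

lemma successively_tl_path_arcs:
  assumes "\<And>x y. (x, y) \<in> set (path_arcs u xs v) \<Longrightarrow> x \<in> set xs \<Longrightarrow> P x y"
  shows "successively P (xs @ [v])"
proof (cases xs)
  case (Cons a as)
  then have "\<forall>(x, y) \<in> set (path_arcs a as v). P x y"
    using assms path_arcs_verts[of _ _ a as v] by fastforce
  then show ?thesis using Cons successively_path_arcs[of P a as v] by simp
qed simp

lemma path_arcs_pcas: "pcas u (path_arcs u xs v) v"
  by (induction xs arbitrary: u) auto

lemma path_arcs_pawalk_verts: "pawalk_verts u (path_arcs u xs v) = u # xs @ [v]"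
  by (induction xs arbitrary: u) auto

lemma length_path_arcs: "length (path_arcs u xs v) = Suc (length xs)"
  by (induction xs arbitrary: u) auto

lemma path_arcs_trancl:
  assumes "set (path_arcs u xs v) \<subseteq> E"
  shows "(u, v) \<in> E\<^sup>+" "z \<in> set xs \<Longrightarrow> (u, z) \<in> E\<^sup>+ \<and> (z, v) \<in> E\<^sup>+"
proof -
  have "(u, v) \<in> E\<^sup>+ \<and> (\<forall>z \<in> set xs. (u, z) \<in> E\<^sup>+ \<and> (z, v) \<in> E\<^sup>+)"
    using assms
  proof (induction xs arbitrary: u)
    case (Cons x xs)
    then have "(u, x) \<in> E" "(x, v) \<in> E\<^sup>+" "\<forall>z \<in> set xs. (x, z) \<in> E\<^sup>+ \<and> (z, v) \<in> E\<^sup>+" by auto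
    then show ?case by (auto intro: trancl_into_trancl2)
  qed auto
  then show "(u, v) \<in> E\<^sup>+" "z \<in> set xs \<Longrightarrow> (u, z) \<in> E\<^sup>+ \<and> (z, v) \<in> E\<^sup>+" by auto
qed

lemma path_arcs_distinct:
  assumes "acyclic E" "set (path_arcs u xs v) \<subseteq> E"
  shows "distinct (u # xs @ [v])"
  using assms(2)
proof (induction xs arbitrary: u)
  case Nil
  then show ?case using assms(1) by (auto simp: acyclic_def)
next
  case (Cons x xs)
  have "distinct (x # xs @ [v])" using Cons.IH[of x] Cons.prems by simp
  moreover have "(u, z) \<in> E\<^sup>+" if "z \<in> set (x # xs @ [v])" for z
    using that path_arcs_trancl[OF Cons(2)] by auto
  then have "u \<notin> set (x # xs @ [v])" using assms(1) unfolding acyclic_def by blast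
  ultimately show ?case by simp
qed

lemma path_arcs_exists:
  "(u, w) \<in> E\<^sup>* \<Longrightarrow> (w, v) \<in> E \<Longrightarrow> \<exists>xs. set (path_arcs u xs v) \<subseteq> E \<and> last (u # xs) = w"
proof (induction rule: converse_rtrancl_induct)
  case base
  then show ?case by (intro exI[of _ "[]"]) simp
next
  case (step x y)
  then obtain xs where "set (path_arcs y xs v) \<subseteq> E" "last (y # xs) = w" by blast
  then show ?case using step(1) by (intro exI[of _ "y # xs"]) simp
qed

lemma path_arcs_reach_last:
  "set (path_arcs u xs v) \<subseteq> E \<Longrightarrow> z \<in> set (u # xs) \<Longrightarrow> (z, last (u # xs)) \<in> E\<^sup>*"
proof (induction xs arbitrary: u z)
  case (Cons x xs)
  have "(u, x) \<in> E" "(x, last (x # xs)) \<in> E\<^sup>*" using Cons.IH[of x x] Cons.prems by auto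
  then show ?case
    using converse_rtrancl_into_rtrancl[of u x E "last (x # xs)"] Cons.IH[of x z] Cons.prems
    by (cases "z = u") auto
qed simp

text \<open>A cycle with the single source \<open>r\<close> and the single sink \<open>t\<close>.
  The last condition excludes that both paths are the arc \<open>(r, t)\<close>; if one list is
  empty, this arc is transitive.\<close>

definition diamond :: "('a \<times> 'a) set \<Rightarrow> 'a \<Rightarrow> 'a \<Rightarrow> 'a list \<Rightarrow> 'a list \<Rightarrow> bool" where
  "diamond E t r as bs \<longleftrightarrow> set (path_arcs r as t) \<union> set (path_arcs r bs t) \<subseteq> E \<and>
     distinct (r # as @ t # bs) \<and> (as \<noteq> [] \<or> bs \<noteq> [])"

definition diamond_arcs :: "'a \<Rightarrow> 'a \<Rightarrow> 'a list \<Rightarrow> 'a list \<Rightarrow> ('a \<times> 'a) set" where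
  "diamond_arcs t r as bs = set (path_arcs r as t) \<union> set (path_arcs r bs t)"

lemma diamond_swap: "diamond E t r as bs \<longleftrightarrow> diamond E t r bs as"
  by (auto simp: diamond_def)

lemma diamond_arcs_swap: "diamond_arcs t r as bs = diamond_arcs t r bs as"
  by (auto simp: diamond_arcs_def)

text \<open>Of the unique cycle through an edge of a cactus, this keeps only the case of diamonds,
  with directed arc sets in place of sets of undirected edges.\<close>

locale merging_dag =
  fixes V :: "'a set" and E :: "('a \<times> 'a) set" and s :: 'a
  assumes finite_V: "finite V" and E_in: "E \<subseteq> V \<times> V" and acyclic_E: "acyclic E" and s_in: "s \<in> V"
    and source: "v \<in> V \<Longrightarrow> (v = s \<longleftrightarrow> (\<forall>u. (u, v) \<notin> E))"
    and diamond_unique: "diamond E t r as bs \<Longrightarrow> diamond E t' r' as' bs' \<Longrightarrow>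
      e \<in> diamond_arcs t r as bs \<Longrightarrow> e \<in> diamond_arcs t' r' as' bs' \<Longrightarrow>
      diamond_arcs t r as bs = diamond_arcs t' r' as' bs'"
begin

lemma finite_E: "finite E"
  using finite_V E_in finite_subset by blast

lemma reach_source: "v \<in> V \<Longrightarrow> (s, v) \<in> E\<^sup>*"
proof (induction v rule: wf_induct_rule[OF finite_acyclic_wf[OF finite_E acyclic_E]])
  case (1 v)
  show ?case
  proof (cases "v = s")
    case False
    then obtain u where "(u, v) \<in> E" using source 1 by auto
    then show ?thesis using 1 E_in by (auto intro: rtrancl_into_rtrancl)
  qed simp
qed

text \<open>The source is a common ancestor of both parents. Take for \<open>r\<close> a common
  ancestor from which no other one is reachable; then paths from \<open>r\<close> to the two parents
  cannot meet again.\<close>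

lemma diamond_exists:
  assumes "(u1, t) \<in> E" "(u2, t) \<in> E" "u1 \<noteq> u2"
  obtains r as bs where "diamond E t r as bs" "last (r # as) = u1" "last (r # bs) = u2"
proof -
  let ?S = "{z. (z, u1) \<in> E\<^sup>* \<and> (z, u2) \<in> E\<^sup>*}"
  have "wf ((E\<inverse>)\<^sup>+)"
    using finite_acyclic_wf_converse[OF finite_E acyclic_E] wf_trancl by blast
  moreover have "s \<in> ?S" using reach_source assms E_in by auto
  ultimately obtain r where r: "r \<in> ?S" and max': "\<And>z. (z, r) \<in> (E\<inverse>)\<^sup>+ \<Longrightarrow> z \<notin> ?S"
    by (rule wfE_min) blast
  have max: "z \<notin> ?S" if "(r, z) \<in> E\<^sup>+" for z
    using max' that unfolding trancl_converse by simp
  obtain as where as: "set (path_arcs r as t) \<subseteq> E" "last (r # as) = u1"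
    using path_arcs_exists[OF _ assms(1), of r] r by auto
  obtain bs where bs: "set (path_arcs r bs t) \<subseteq> E" "last (r # bs) = u2"
    using path_arcs_exists[OF _ assms(2), of r] r by auto
  have "set as \<inter> set bs = {}"
  proof (rule ccontr)
    assume "set as \<inter> set bs \<noteq> {}"
    then obtain z where z: "z \<in> set as" "z \<in> set bs" by auto
    then have "z \<in> ?S" using path_arcs_reach_last[OF as(1), of z] path_arcs_reach_last[OF bs(1), of z] as(2) bs(2) by simp
    then show False using max path_arcs_trancl(2)[OF as(1) z(1)] by blast
  qed
  moreover have "as \<noteq> [] \<or> bs \<noteq> []" using as(2) bs(2) assms(3) by auto
  ultimately have "diamond E t r as bs"
    using path_arcs_distinct[OF acyclic_E as(1)] path_arcs_distinct[OF acyclic_E bs(1)] as(1) bs(1)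
    by (auto simp: diamond_def)
  then show thesis using that as(2) bs(2) by blast
qed

lemma diamond_into_sink:
  assumes "diamond E t r as bs"
  shows "(x, t) \<in> diamond_arcs t r as bs \<longleftrightarrow> x = last (r # as) \<or> x = last (r # bs)"
  using assms path_arcs_into_last[of r as t x] path_arcs_into_last[of r bs t x]
    path_arcs_last[of r as t] path_arcs_last[of r bs t]
  by (auto simp: diamond_def diamond_arcs_def)

lemma diamond_lasts:
  assumes "diamond E t r as bs"
  shows "last (r # as) \<noteq> last (r # bs)" "(last (r # as), t) \<in> E" "(last (r # bs), t) \<in> E"
proof -
  show "(last (r # as), t) \<in> E" "(last (r # bs), t) \<in> E"
    using assms path_arcs_last[of r as t] path_arcs_last[of r bs t] by (auto simp: diamond_def)
  have "last as \<noteq> last bs" if "as \<noteq> []" "bs \<noteq> []"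
    using assms last_in_set[OF that(1)] last_in_set[OF that(2)] by (auto simp: diamond_def)
  moreover have "last xs \<noteq> r" if "xs \<noteq> []" "xs = as \<or> xs = bs" for xs
    using assms last_in_set[OF that(1)] that(2) by (auto simp: diamond_def)
  ultimately show "last (r # as) \<noteq> last (r # bs)"
    using assms by (auto simp: diamond_def)
qed

lemma diamond_sink_out: "diamond E t r as bs \<Longrightarrow> (t, x) \<notin> diamond_arcs t r as bs"
  by (auto simp: diamond_def diamond_arcs_def dest!: path_arcs_verts)

text \<open>A third parent would yield another diamond through one of the two known arcs into
  \<open>t\<close>. Both diamonds would have the same arcs, but a diamond has only two arcs into its
  sink.\<close>

lemma in_neighbours_sink:
  assumes d: "diamond E t r as bs"
  shows "(x, t) \<in> E \<longleftrightarrow> x = last (r # as) \<or> x = last (r # bs)"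
proof
  assume x: "(x, t) \<in> E"
  show "x = last (r # as) \<or> x = last (r # bs)"
  proof (rule ccontr)
    assume *: "\<not> ?thesis"
    then obtain r' as' bs' where d': "diamond E t r' as' bs'"
      "last (r' # as') = last (r # as)" "last (r' # bs') = x"
      using diamond_exists[OF diamond_lasts(2)[OF d] x] by metis
    have "(last (r # as), t) \<in> diamond_arcs t r as bs" using diamond_into_sink[OF d] by simp
    moreover have "(last (r # as), t) \<in> diamond_arcs t r' as' bs'"
      using diamond_into_sink[OF d'(1)] d'(2) by simp
    ultimately have "diamond_arcs t r as bs = diamond_arcs t r' as' bs'"
      using diamond_unique[OF d d'(1)] by simp
    moreover have "(x, t) \<in> diamond_arcs t r' as' bs'" using diamond_into_sink[OF d'(1)] d'(3) by simp
    ultimately show False using diamond_into_sink[OF d] * by simp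
  qed
qed (use diamond_lasts[OF d] in auto)

lemma diamond_inner_in_out:
  assumes "diamond E t r as bs" "z \<in> set as \<union> set bs"
  shows "\<exists>x. (x, z) \<in> diamond_arcs t r as bs" "\<exists>y. (z, y) \<in> diamond_arcs t r as bs"
  using assms(2) path_arcs_pred_ex[of z as r t] path_arcs_pred_ex[of z bs r t]
    path_arcs_succ_ex[of z r as t] path_arcs_succ_ex[of z r bs t]
  by (auto simp: diamond_arcs_def)

lemma diamond_arcs_subset: "diamond E t r as bs \<Longrightarrow> diamond_arcs t r as bs \<subseteq> E"
  by (auto simp: diamond_def diamond_arcs_def)

text \<open>A second parent would make \<open>z\<close> the sink of a diamond that shares the arc
  \<open>(p, z)\<close> with the given one. The arc sets would be equal, although only the given one
  has an arc leaving \<open>z\<close>.\<close>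

lemma in_neighbour_inner:
  assumes d: "diamond E t r as bs" and z: "z \<in> set as \<union> set bs"
    and xz: "(x, z) \<in> E" and wz: "(w, z) \<in> E"
  shows "w = x"
proof -
  obtain p where p: "(p, z) \<in> diamond_arcs t r as bs" using diamond_inner_in_out(1)[OF d z] by blast
  have only: "w = p" if w: "(w, z) \<in> E" for w
  proof (rule ccontr)
    assume "w \<noteq> p"
    then obtain r' as' bs' where d': "diamond E z r' as' bs'"
      "last (r' # as') = p" "last (r' # bs') = w"
      using diamond_exists[of p z w] diamond_arcs_subset[OF d] p w by blast
    have "(p, z) \<in> diamond_arcs z r' as' bs'" using diamond_into_sink[OF d'(1)] d'(2) by simp
    then have "diamond_arcs t r as bs = diamond_arcs z r' as' bs'"
      using diamond_unique[OF d d'(1) p] by simp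
    then show False using diamond_inner_in_out(2)[OF d z] diamond_sink_out[OF d'(1)] by blast
  qed
  show ?thesis using only[OF xz] only[OF wz] by simp
qed

text \<open>The common arc set enters only one vertex without leaving it.\<close>

lemma diamond_sink_unique:
  assumes d: "diamond E t r as bs" and d': "diamond E t' r' as' bs'"
    and "e \<in> diamond_arcs t r as bs" "e \<in> diamond_arcs t' r' as' bs'"
  shows "t = t'"
proof -
  have eq: "diamond_arcs t r as bs = diamond_arcs t' r' as' bs'" using diamond_unique assms by blast
  have "(last (r' # as'), t') \<in> diamond_arcs t r as bs"
    using eq diamond_into_sink[OF d'] by simp
  then have "t' \<in> set as \<union> set bs \<union> {t}" by (auto simp: diamond_arcs_def dest!: path_arcs_verts)
  then show ?thesis using diamond_inner_in_out(2)[OF d] diamond_sink_out[OF d'] eq by blast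
qed

lemma inner_sink_unique:
  assumes d: "diamond E t r as bs" and d': "diamond E t' r' as' bs'"
    and z: "z \<in> set as \<union> set bs" "z \<in> set as' \<union> set bs'"
  shows "t = t'"
proof -
  obtain x x' where x: "(x, z) \<in> diamond_arcs t r as bs" "(x', z) \<in> diamond_arcs t' r' as' bs'"
    using diamond_inner_in_out(1)[OF d z(1)] diamond_inner_in_out(1)[OF d' z(2)] by blast
  then have "(x, z) \<in> E" "(x', z) \<in> E"
    using diamond_arcs_subset[OF d] diamond_arcs_subset[OF d'] by auto
  then have "x = x'" using in_neighbour_inner[OF d z(1)] by simp
  then show ?thesis using diamond_sink_unique[OF d d'] x by blast
qed

end

text \<open>Fixes for each vertex with two parents which path of its cycle is the left one;
  \<open>last_arc\<close> requires that this path has an inner vertex.\<close>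

locale oriented_dag = merging_dag +
  fixes R :: "'a \<Rightarrow> 'a" and As Bs :: "'a \<Rightarrow> 'a list"
  assumes merge_diamond: "(u, t) \<in> E \<Longrightarrow> (w, t) \<in> E \<Longrightarrow> u \<noteq> w \<Longrightarrow>
    diamond E t (R t) (As t) (Bs t) \<and> As t \<noteq> []"
begin

definition merge :: "'a \<Rightarrow> bool" where
  "merge t \<longleftrightarrow> (\<exists>u w. (u, t) \<in> E \<and> (w, t) \<in> E \<and> u \<noteq> w)"

text \<open>For a vertex without two parents, \<open>pX\<close> and \<open>pY\<close> make the same
  choice, so they differ exactly at the sinks of cycles.\<close>

definition pX :: "'a \<Rightarrow> 'a" where
  "pX t = (if merge t then last (R t # As t) else SOME u. (u, t) \<in> E)"

definition pY :: "'a \<Rightarrow> 'a" where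
  "pY t = (if merge t then last (R t # Bs t) else SOME u. (u, t) \<in> E)"

lemma merge_dia: "merge t \<Longrightarrow> diamond E t (R t) (As t) (Bs t)"
  and merge_left: "merge t \<Longrightarrow> As t \<noteq> []"
  using merge_diamond by (auto simp: merge_def)

lemma merge_in_V: "merge t \<Longrightarrow> t \<in> V"
  using E_in by (auto simp: merge_def)

lemma merge_iff: "merge t \<longleftrightarrow> pX t \<noteq> pY t"
  using diamond_lasts(1)[OF merge_dia, of t] unfolding pX_def pY_def by presburger

lemma parents_arcs: "v \<in> V - {s} \<Longrightarrow> (pX v, v) \<in> E \<and> (pY v, v) \<in> E"
proof (cases "merge v")
  case True
  then show ?thesis using diamond_lasts(2,3)[OF merge_dia[OF True]] by (simp add: pX_def pY_def)
next
  case False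
  assume "v \<in> V - {s}"
  then obtain u where "(u, v) \<in> E" using source by auto
  then show ?thesis using False someI[of "\<lambda>u. (u, v) \<in> E" u] by (simp add: pX_def pY_def)
qed

lemma E_sub_source: "E \<subseteq> V \<times> (V - {s})"
  using E_in source s_in by auto

lemma arc_from_parent: assumes "(u, v) \<in> E" shows "u = pX v \<or> u = pY v"
proof (cases "merge v")
  case True
  then show ?thesis using in_neighbours_sink[OF merge_dia[OF True]] assms by (simp add: pX_def pY_def)
next
  case False
  then show ?thesis using parents_arcs[of v] assms E_sub_source unfolding merge_def by blast
qed

lemma inner_parent:
  assumes t: "merge t" and "(x, z) \<in> diamond_arcs t (R t) (As t) (Bs t)" and "z \<in> set (As t) \<union> set (Bs t)"
  shows "pX z = x" "pY z = x" "z \<in> V - {s}"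
proof -
  have "(x, z) \<in> E" using diamond_arcs_subset[OF merge_dia[OF t]] assms(2) by blast
  moreover from this show z: "z \<in> V - {s}" using E_sub_source by blast
  ultimately show "pX z = x" "pY z = x"
    using in_neighbour_inner[OF merge_dia[OF t] assms(3)] parents_arcs[OF z] by simp_all
qed

text \<open>All conditions on parents and paths follow from the diamonds, which leaves those on the
  ranks. It serves both for freely chosen ranks and for ranks read off a rotation.\<close>

lemma layoutI:
  fixes rk :: "'a \<times> 'a \<Rightarrow> int"
  assumes rk_inj: "\<And>u v w. (u, v) \<in> E \<Longrightarrow> (u, w) \<in> E \<Longrightarrow> rk (u, v) = rk (u, w) \<Longrightarrow> v = w"
    and left_last: "\<And>t x y w. merge t \<Longrightarrow> (x, y) \<in> set (path_arcs (R t) (As t) t) \<Longrightarrow> x \<in> set (As t) \<Longrightarrow>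
      (x, w) \<in> E \<Longrightarrow> rk (x, w) \<le> rk (x, y)"
    and right_first: "\<And>t x y w. merge t \<Longrightarrow> (x, y) \<in> set (path_arcs (R t) (Bs t) t) \<Longrightarrow> x \<in> set (Bs t) \<Longrightarrow>
      (x, w) \<in> E \<Longrightarrow> rk (x, y) \<le> rk (x, w)"
    and split: "\<And>t. merge t \<Longrightarrow> rk (R t, hd (As t @ [t])) < rk (R t, hd (Bs t @ [t]))"
    and adjacent: "\<And>t w. merge t \<Longrightarrow> (R t, w) \<in> E \<Longrightarrow>
      rk (R t, w) \<le> rk (R t, hd (As t @ [t])) \<or> rk (R t, hd (Bs t @ [t])) \<le> rk (R t, w)"
  shows "layout V E s pX pY rk R As Bs"
proof
  show "finite V" "acyclic E" "s \<in> V" "E \<subseteq> V \<times> (V - {s})"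
    using finite_V acyclic_E s_in E_sub_source by auto
  show "(pX v, v) \<in> E \<and> (pY v, v) \<in> E" if "v \<in> V - {s}" for v by (rule parents_arcs[OF that])
  show "u = pX v \<or> u = pY v" if "(u, v) \<in> E" for u v by (rule arc_from_parent[OF that])
  show "v = w" if "(u, v) \<in> E" "(u, w) \<in> E" "rk (u, v) = rk (u, w)" for u v w by (rule rk_inj[OF that])
  fix t assume "t \<in> V - {s}" "pX t \<noteq> pY t"
  then have t: "merge t" using merge_iff by simp
  note d = merge_dia[OF t]
  show "successively (\<lambda>x y. pX y = x) (R t # As t @ [t])"
    unfolding successively_path_arcs
  proof (clarify)
    fix x y assume xy: "(x, y) \<in> set (path_arcs (R t) (As t) t)"
    show "pX y = x"
    proof (cases "y = t")
      case True
      then show ?thesis using path_arcs_into_last[of "R t" "As t" t x] d xy t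
        by (simp add: diamond_def pX_def)
    next
      case False
      then show ?thesis using inner_parent(1)[OF t, of x y] path_arcs_verts[OF xy] xy
        by (simp add: diamond_arcs_def)
    qed
  qed
  show "successively (\<lambda>x y. pY y = x) (R t # Bs t @ [t])"
    unfolding successively_path_arcs
  proof (clarify)
    fix x y assume xy: "(x, y) \<in> set (path_arcs (R t) (Bs t) t)"
    show "pY y = x"
    proof (cases "y = t")
      case True
      then show ?thesis using path_arcs_into_last[of "R t" "Bs t" t x] d xy t
        by (simp add: diamond_def pY_def)
    next
      case False
      then show ?thesis using inner_parent(2)[OF t, of x y] path_arcs_verts[OF xy] xy
        by (simp add: diamond_arcs_def)
    qed
  qed
  show "z \<in> V - {s} \<and> pX z = pY z" if z: "z \<in> set (As t) \<union> set (Bs t)" for z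
  proof -
    obtain x where "(x, z) \<in> diamond_arcs t (R t) (As t) (Bs t)"
      using diamond_inner_in_out(1)[OF d z] by blast
    then show ?thesis using inner_parent[OF t _ z] by metis
  qed
  show "successively (\<lambda>x y. \<forall>w. (x, w) \<in> E \<longrightarrow> rk (x, w) \<le> rk (x, y)) (As t @ [t])"
    by (rule successively_tl_path_arcs[of "R t"]) (use left_last[OF t] in auto)
  show "successively (\<lambda>x y. \<forall>w. (x, w) \<in> E \<longrightarrow> rk (x, y) \<le> rk (x, w)) (Bs t @ [t])"
    by (rule successively_tl_path_arcs[of "R t"]) (use right_first[OF t] in auto)
  show "rk (R t, hd (As t @ [t])) < rk (R t, hd (Bs t @ [t]))" by (rule split[OF t])
  show "rk (R t, w) \<le> rk (R t, hd (As t @ [t])) \<or> rk (R t, hd (Bs t @ [t])) \<le> rk (R t, w)"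
    if "(R t, w) \<in> E" for w by (rule adjacent[OF t that])
  show "As t \<noteq> []" by (rule merge_left[OF t])
  fix t' assume "t' \<in> V - {s}" "pX t' \<noteq> pY t'"
  then have t': "merge t'" using merge_iff by simp
  show "set (As t) \<inter> set (Bs t') = {}"
  proof (rule ccontr)
    assume "\<not> ?thesis"
    then obtain z where z: "z \<in> set (As t)" "z \<in> set (Bs t')" by auto
    then have "t = t'" using inner_sink_unique[OF d merge_dia[OF t'], of z] by simp
    then show False using z d by (auto simp: diamond_def)
  qed
qed

section \<open>Ranks when no embedding is prescribed\<close>

definition on_diamond :: "'a \<times> 'a \<Rightarrow> bool" where
  "on_diamond e \<longleftrightarrow> (\<exists>t. merge t \<and> e \<in> diamond_arcs t (R t) (As t) (Bs t))"

definition group :: "'a \<times> 'a \<Rightarrow> 'a" where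
  "group e = (if on_diamond e then THE t. merge t \<and> e \<in> diamond_arcs t (R t) (As t) (Bs t) else snd e)"

lemma group_diamond:
  assumes "merge t" "e \<in> diamond_arcs t (R t) (As t) (Bs t)"
  shows "group e = t" "on_diamond e"
proof -
  show *: "on_diamond e" using assms by (auto simp: on_diamond_def)
  have "(THE t. merge t \<and> e \<in> diamond_arcs t (R t) (As t) (Bs t)) = t"
    by (rule the_equality) (use assms diamond_sink_unique[OF merge_dia merge_dia] in blast)+
  then show "group e = t" using * by (simp add: group_def)
qed

lemma group_on_diamond: "on_diamond e \<Longrightarrow> merge (group e) \<and> e \<in> diamond_arcs (group e) (R (group e)) (As (group e)) (Bs (group e))"
  unfolding on_diamond_def by (elim exE conjE) (simp add: group_diamond(1))

text \<open>Both arcs into a sink belong to its diamond. So the group of an arc outside all diamonds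
  is never the group of a diamond.\<close>

lemma not_on_diamond: "(u, w) \<in> E \<Longrightarrow> \<not> on_diamond (u, w) \<Longrightarrow> \<not> merge w \<and> group (u, w) = w"
  using in_neighbours_sink[OF merge_dia] diamond_into_sink[OF merge_dia]
  by (auto simp: group_def on_diamond_def)

lemma group_in_V: "e \<in> E \<Longrightarrow> group e \<in> V"
  using group_on_diamond merge_in_V E_in by (cases "on_diamond e") (auto simp: group_def)

text \<open>The children of a vertex are ordered by diamond, with the left path of a diamond directly
  before its right path; a right path inside a diamond comes first, a left path last.\<close>

definition rank :: "('a \<Rightarrow> nat) \<Rightarrow> int \<Rightarrow> 'a \<times> 'a \<Rightarrow> int" where
  "rank n M e = (let t = group e in
     if on_diamond e \<and> fst e \<in> set (Bs t) then - 1
     else if on_diamond e \<and> fst e \<in> set (As t) then M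
     else if on_diamond e \<and> e \<in> set (path_arcs (R t) (Bs t) t) then 2 * int (n t) + 1
     else 2 * int (n t))"

text \<open>For injectivity: a vertex is inside at most one cycle, so \<open>- 1\<close> and
  \<open>M\<close>, which lie outside the range of the other ranks, are each taken at most once at a
  vertex. Any other rank gives the group by halving and the side by parity.\<close>

lemma rank_layout:
  assumes inj: "inj_on n V" and bound: "\<And>v. v \<in> V \<Longrightarrow> 2 * int (n v) + 1 < M"
  shows "layout V E s pX pY (rank n M) R As Bs"
proof (rule layoutI)
  have M: "0 < M" using bound[OF s_in] by linarith
  have range: "- 1 \<le> rank n M e \<and> rank n M e \<le> M" if "e \<in> E" for e
    using bound[OF group_in_V[OF that]] M by (auto simp: rank_def Let_def)
  have dist: "distinct (R t # As t @ [t])" "distinct (R t # Bs t @ [t])" "set (As t) \<inter> set (Bs t) = {}"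
    if "merge t" for t
    using merge_dia[OF that] by (auto simp: diamond_def)
  show "v = w" if e: "(u, v) \<in> E" "(u, w) \<in> E" and eq: "rank n M (u, v) = rank n M (u, w)" for u v w
  proof -
    let ?t = "group (u, v)" and ?t' = "group (u, w)"
    note b = bound[OF group_in_V[OF e(1)]] bound[OF group_in_V[OF e(2)]]
    have same: "?t = ?t'" if "n ?t = n ?t'"
      using inj_onD[OF inj that] group_in_V e by blast
    have uniq: "v = w" if "on_diamond (u, v)" "on_diamond (u, w)" "?t = ?t'"
      "(u, v) \<in> set (path_arcs (R ?t) (xs ?t) ?t)" "(u, w) \<in> set (path_arcs (R ?t) (xs ?t) ?t)"
      "xs = As \<or> xs = Bs" for xs
      using path_arcs_succ[of "R ?t" "xs ?t" ?t u v w] dist group_on_diamond that by blast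
    have side: "(u, y) \<in> set (path_arcs (R t) (As t) t)" if "u \<in> set (As t)" "merge t"
      "(u, y) \<in> diamond_arcs t (R t) (As t) (Bs t)" for t y
      using that dist[OF that(2)] path_arcs_verts[of u y "R t" "Bs t" t] by (auto simp: diamond_arcs_def)
    have side': "(u, y) \<in> set (path_arcs (R t) (Bs t) t)" if "u \<in> set (Bs t)" "merge t"
      "(u, y) \<in> diamond_arcs t (R t) (As t) (Bs t)" for t y
      using that dist[OF that(2)] path_arcs_verts[of u y "R t" "As t" t] by (auto simp: diamond_arcs_def)
    show ?thesis
    proof (cases "on_diamond (u, v)")
      case v: True
      note gv = group_on_diamond[OF v]
      show ?thesis
      proof (cases "on_diamond (u, w)")
        case w: True
        note gw = group_on_diamond[OF w]
        consider "u \<in> set (Bs ?t)" | "u \<in> set (As ?t)" | "u \<notin> set (As ?t)" "u \<notin> set (Bs ?t)" by blast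
        then show ?thesis
        proof cases
          case 1
          then have "rank n M (u, w) = - 1" using eq v by (simp add: rank_def Let_def)
          then have "u \<in> set (Bs ?t')" using M w b by (auto simp: rank_def Let_def split: if_splits)
          moreover from this have "?t = ?t'"
            using inner_sink_unique[OF merge_dia merge_dia, of ?t ?t' u] 1 gv gw by simp
          ultimately show ?thesis using uniq[OF v w, of Bs] side' 1 gv gw by simp
        next
          case 2
          then have "u \<notin> set (Bs ?t)" using dist gv by blast
          then have "rank n M (u, w) = M" using eq v 2 by (simp add: rank_def Let_def)
          then have "u \<in> set (As ?t')" using M w b by (auto simp: rank_def Let_def split: if_splits)
          moreover from this have "?t = ?t'"
            using inner_sink_unique[OF merge_dia merge_dia, of ?t ?t' u] 2 gv gw by simp
          ultimately show ?thesis using uniq[OF v w, of As] side 2 gv gw by simp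
        next
          case 3
          then have rv: "(u, v) \<in> set (path_arcs (R ?t) (Bs ?t) ?t) \<and> rank n M (u, v) = 2 * int (n ?t) + 1 \<or>
            (u, v) \<in> set (path_arcs (R ?t) (As ?t) ?t) \<and> rank n M (u, v) = 2 * int (n ?t)"
            using gv v by (auto simp: rank_def Let_def diamond_arcs_def)
          have "u \<notin> set (Bs ?t')" "u \<notin> set (As ?t')"
            using rv eq M w b by (auto simp: rank_def Let_def split: if_splits)
          then have rw: "(u, w) \<in> set (path_arcs (R ?t') (Bs ?t') ?t') \<and> rank n M (u, w) = 2 * int (n ?t') + 1 \<or>
            (u, w) \<in> set (path_arcs (R ?t') (As ?t') ?t') \<and> rank n M (u, w) = 2 * int (n ?t')"
            using gw w by (auto simp: rank_def Let_def diamond_arcs_def)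
          have "n ?t = n ?t'" using rv rw eq by (elim disjE conjE) presburger+
          then have "?t = ?t'" using same by simp
          have "(u, v) \<in> set (path_arcs (R ?t) (Bs ?t) ?t) \<and> (u, w) \<in> set (path_arcs (R ?t) (Bs ?t) ?t) \<or>
            (u, v) \<in> set (path_arcs (R ?t) (As ?t) ?t) \<and> (u, w) \<in> set (path_arcs (R ?t) (As ?t) ?t)"
            using rv rw eq \<open>?t = ?t'\<close> by (elim disjE conjE) simp_all
          then show ?thesis using uniq[OF v w \<open>?t = ?t'\<close>] by blast
        qed
      next
        case w: False
        then have "rank n M (u, v) = 2 * int (n ?t')" using eq by (simp add: rank_def Let_def)
        then have "n ?t = n ?t'" using b M v by (auto simp: rank_def Let_def split: if_splits)
        then show ?thesis using same gv not_on_diamond[OF e(2) w] by simp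
      qed
    next
      case v: False
      then have r: "rank n M (u, w) = 2 * int (n ?t)" using eq by (simp add: rank_def Let_def)
      then have "n ?t = n ?t'" using b M by (auto simp: rank_def Let_def split: if_splits)
      then show ?thesis using same group_on_diamond[of "(u, w)"] not_on_diamond[OF e(1) v] not_on_diamond[OF e(2)]
        by (cases "on_diamond (u, w)") auto
    qed
  qed
  fix t assume t: "merge t"
  have in_d: "e \<in> diamond_arcs t (R t) (As t) (Bs t)" if "e \<in> set (path_arcs (R t) (As t) t) \<or> e \<in> set (path_arcs (R t) (Bs t) t)" for e
    using that by (auto simp: diamond_arcs_def)
  show "rank n M (x, w) \<le> rank n M (x, y)"
    if "(x, y) \<in> set (path_arcs (R t) (As t) t)" "x \<in> set (As t)" "(x, w) \<in> E" for x y w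
  proof -
    have "x \<notin> set (Bs t)" using dist(3)[OF t] that by blast
    then have "rank n M (x, y) = M" using group_diamond[OF t in_d, of "(x, y)"] that
      by (simp add: rank_def Let_def)
    then show ?thesis using range[OF that(3)] by simp
  qed
  show "rank n M (x, y) \<le> rank n M (x, w)"
    if "(x, y) \<in> set (path_arcs (R t) (Bs t) t)" "x \<in> set (Bs t)" "(x, w) \<in> E" for x y w
  proof -
    have "rank n M (x, y) = - 1" using group_diamond[OF t in_d, of "(x, y)"] that
      by (simp add: rank_def Let_def)
    then show ?thesis using range[OF that(3)] by simp
  qed
  have R: "R t \<notin> set (As t)" "R t \<notin> set (Bs t)" using dist[OF t] by auto
  have l: "(R t, hd (As t @ [t])) \<in> set (path_arcs (R t) (As t) t)"
    and r: "(R t, hd (Bs t @ [t])) \<in> set (path_arcs (R t) (Bs t) t)"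
    by (rule path_arcs_first)+
  have "hd (As t @ [t]) \<noteq> hd (Bs t @ [t])"
  proof -
    have "hd (As t @ [t]) \<in> set (As t)" using merge_left[OF t] by simp
    moreover have "hd (Bs t @ [t]) \<in> set (Bs t) \<union> {t}" by (cases "Bs t") auto
    ultimately show ?thesis using dist[OF t] by auto
  qed
  then have "(R t, hd (As t @ [t])) \<notin> set (path_arcs (R t) (Bs t) t)"
    using path_arcs_succ[OF dist(2)[OF t] _ r] by blast
  then have ranks: "rank n M (R t, hd (As t @ [t])) = 2 * int (n t)"
    "rank n M (R t, hd (Bs t @ [t])) = 2 * int (n t) + 1"
    using group_diamond[OF t in_d, of "(R t, hd (As t @ [t]))"] group_diamond[OF t in_d, of "(R t, hd (Bs t @ [t]))"]
      l r R by (simp_all add: rank_def Let_def)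
  then show "rank n M (R t, hd (As t @ [t])) < rank n M (R t, hd (Bs t @ [t]))" by simp
  show "rank n M (R t, w) \<le> rank n M (R t, hd (As t @ [t])) \<or> rank n M (R t, hd (Bs t @ [t])) \<le> rank n M (R t, w)"
    if "(R t, w) \<in> E" for w unfolding ranks by linarith
qed

lemma layout_exists: "\<exists>rk. layout V E s pX pY rk R As Bs"
proof -
  obtain n :: "'a \<Rightarrow> nat" where "inj_on n V"
    using finite_imp_inj_to_nat_seg[OF finite_V] by auto
  moreover have "2 * int (n v) + 1 < 2 * int (Max (n ` V)) + 2" if "v \<in> V" for v
  proof -
    have "n v \<le> Max (n ` V)" using finite_V that by simp
    then show ?thesis by linarith
  qed
  ultimately show ?thesis using rank_layout by blast
qed

end

text \<open>At most one path of a diamond has no inner vertex; if needed, the paths are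
  exchanged.\<close>

lemma (in merging_dag) orientation_exists: "\<exists>R As Bs. oriented_dag V E s R As Bs"
proof -
  have "\<exists>x. \<forall>u w. (u, t) \<in> E \<longrightarrow> (w, t) \<in> E \<longrightarrow> u \<noteq> w \<longrightarrow>
    diamond E t (fst x) (fst (snd x)) (snd (snd x)) \<and> fst (snd x) \<noteq> []" for t
  proof (cases "\<exists>u w. (u, t) \<in> E \<and> (w, t) \<in> E \<and> u \<noteq> w")
    case True
    then obtain r as bs where d: "diamond E t r as bs" using diamond_exists by metis
    show ?thesis
    proof (cases "as = []")
      case True
      then have "diamond E t r bs as \<and> bs \<noteq> []" using d by (auto simp: diamond_def)
      then show ?thesis by (intro exI[of _ "(r, bs, as)"]) simp
    next
      case False
      then show ?thesis using d by (intro exI[of _ "(r, as, bs)"]) simp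
    qed
  qed auto
  then obtain f where "\<forall>t u w. (u, t) \<in> E \<longrightarrow> (w, t) \<in> E \<longrightarrow> u \<noteq> w \<longrightarrow>
    diamond E t (fst (f t)) (fst (snd (f t))) (snd (snd (f t))) \<and> fst (snd (f t)) \<noteq> []"
    by metis
  then have "oriented_dag V E s (\<lambda>t. fst (f t)) (\<lambda>t. fst (snd (f t))) (\<lambda>t. snd (snd (f t)))"
    by unfold_locales blast
  then show ?thesis by blast
qed

subsection \<open>Cactuses\<close>

abbreviation ends :: "'a \<times> 'a \<Rightarrow> 'a set" where
  "ends \<equiv> \<lambda>(u, v). {u, v}"

lemma darts_iff: "(x, y) \<in> darts G \<longleftrightarrow> (x, y) \<in> parcs G \<or> (y, x) \<in> parcs G"
proof
  show "(x, y) \<in> darts G \<Longrightarrow> (x, y) \<in> parcs G \<or> (y, x) \<in> parcs G"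
    by (auto simp: darts_def parcs_mk_symmetric)
  have "(u, v) \<in> darts G \<and> (v, u) \<in> darts G" if "(u, v) \<in> parcs G" for u v
    unfolding darts_def parcs_mk_symmetric using that by (intro conjI UN_I[of "(u, v)"]) simp_all
  then show "(x, y) \<in> parcs G \<or> (y, x) \<in> parcs G \<Longrightarrow> (x, y) \<in> darts G" by blast
qed

lemma undirected_cycleI:
  assumes "pair_digraph G" "distinct (u # xs)" "2 \<le> length xs" "set (path_arcs u xs u) \<subseteq> darts G"
  shows "undirected_cycle G (ends ` set (path_arcs u xs u))"
proof -
  interpret pair_digraph G by fact
  have "(last (u # xs), u) \<in> darts G" using assms(4) path_arcs_last[of u xs u] by blast
  then have "u \<in> pverts G" unfolding darts_iff using wellformed' by blast
  moreover have "set (path_arcs u xs u) \<subseteq> parcs (mk_symmetric (with_proj G))"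
    using assms(4) by (simp add: darts_def)
  ultimately have "pre_digraph.cycle (with_proj (mk_symmetric (with_proj G))) (path_arcs u xs u)"
    unfolding pre_digraph.cycle_def pre_digraph.awalk_def cas_with_proj_eq awalk_verts_with_proj_eq
    using assms(2) by (intro exI[of _ u] conjI) (simp_all add: path_arcs_pcas path_arcs_pawalk_verts, cases xs, simp_all)
  then show ?thesis unfolding undirected_cycle_def using assms(3)
    by (intro exI[of _ "path_arcs u xs u"]) (auto simp: length_path_arcs)
qed

text \<open>Go along one path and return along the other. As one path has an inner vertex, the cycle
  has length at least three.\<close>

lemma diamond_undirected_cycle:
  assumes "pair_digraph G" "diamond (parcs G) t r as bs"
  shows "undirected_cycle G (ends ` diamond_arcs t r as bs)"
proof -
  have eq: "set (path_arcs r (as @ t # rev bs) r) = set (path_arcs r as t) \<union> prod.swap ` set (path_arcs r bs t)"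
    by (simp add: path_arcs_append path_arcs_rev)
  have "undirected_cycle G (ends ` set (path_arcs r (as @ t # rev bs) r))"
  proof (rule undirected_cycleI[OF assms(1)])
    show "distinct (r # as @ t # rev bs)" "2 \<le> length (as @ t # rev bs)"
      using assms(2) by (auto simp: diamond_def Suc_le_eq)
    show "set (path_arcs r (as @ t # rev bs) r) \<subseteq> darts G"
      using assms(2) unfolding eq by (auto simp: diamond_def darts_iff)
  qed
  moreover have "ends ` set (path_arcs r (as @ t # rev bs) r) = ends ` diamond_arcs t r as bs"
    unfolding eq diamond_arcs_def image_Un image_image by (auto simp: insert_commute)
  ultimately show ?thesis by simp
qed

lemma acyclic_antisym: "acyclic E \<Longrightarrow> (x, y) \<in> E \<Longrightarrow> (y, x) \<notin> E"
  by (meson acyclic_def r_into_trancl trancl_trans)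

text \<open>Acyclicity excludes opposite arcs. This lets uniqueness of undirected cycles carry over
  to arc sets.\<close>

lemma ends_eq_arc:
  assumes "acyclic E" "e \<in> E" "e' \<in> E" "ends e = ends e'"
  shows "e = e'"
proof -
  obtain a b c d where e: "e = (a, b)" "e' = (c, d)" by fastforce
  then have "a = c \<and> b = d \<or> a = d \<and> b = c" using assms(4) by (auto simp: doubleton_eq_iff)
  then show ?thesis using acyclic_antisym[OF assms(1), of a b] assms(2,3) e by auto
qed

lemma cactus_merging_dag:
  assumes G: "pair_digraph G" and ac: "acyclic (parcs G)" and cactus: "cactus G"
    and s: "s \<in> pverts G" "\<And>v. v \<in> pverts G \<Longrightarrow> in_degree (with_proj G) v = 0 \<longleftrightarrow> v = s"
  shows "merging_dag (pverts G) (parcs G) s"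
proof
  interpret pair_digraph G by fact
  show "finite (pverts G)" by (rule pair_finite_verts)
  show "parcs G \<subseteq> pverts G \<times> pverts G" using wellformed' by auto
  show "acyclic (parcs G)" "s \<in> pverts G" by fact+
  show "v = s \<longleftrightarrow> (\<forall>u. (u, v) \<notin> parcs G)" if "v \<in> pverts G" for v
    using s(2)[OF that] pair_finite_arcs by (auto simp: in_degree_def in_arcs_def)
  fix t r as bs t' r' as' bs' e
  assume d: "diamond (parcs G) t r as bs" "diamond (parcs G) t' r' as' bs'"
    "e \<in> diamond_arcs t r as bs" "e \<in> diamond_arcs t' r' as' bs'"
  have sub: "diamond_arcs t r as bs \<subseteq> parcs G" "diamond_arcs t' r' as' bs' \<subseteq> parcs G"
    using d by (auto simp: diamond_def diamond_arcs_def)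
  obtain u v where e: "e = (u, v)" by fastforce
  then have "(u, v) \<in> parcs G" using sub d(3) by auto
  then have unique: "\<And>C D. undirected_cycle G C \<Longrightarrow> undirected_cycle G D \<Longrightarrow> {u, v} \<in> C \<Longrightarrow> {u, v} \<in> D \<Longrightarrow> C = D"
    using cactus unfolding cactus_def by blast
  have eq: "ends ` diamond_arcs t r as bs = ends ` diamond_arcs t' r' as' bs'"
    by (rule unique) (use diamond_undirected_cycle[OF G] d e in \<open>force+\<close>)
  have "inj_on ends (parcs G)" by (rule inj_onI) (rule ends_eq_arc[OF ac])
  then show "diamond_arcs t r as bs = diamond_arcs t' r' as' bs'"
    using inj_on_image_eq_iff[OF _ sub] eq by blast
qed

lemma apath_path_arcs: "pcas u c v \<Longrightarrow> c \<noteq> [] \<Longrightarrow> \<exists>xs. c = path_arcs u xs v"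
proof (induction c arbitrary: u)
  case (Cons e c)
  show ?case
  proof (cases "c = []")
    case True
    then show ?thesis using Cons by (intro exI[of _ "[]"]) (cases e, auto)
  next
    case False
    then obtain xs where "c = path_arcs (snd e) xs v" using Cons by fastforce
    then show ?thesis using Cons by (intro exI[of _ "snd e # xs"]) (cases e, auto)
  qed
qed simp

lemma transitive_arc_iff:
  assumes "pair_digraph G"
  shows "transitive_arc G (u, v) \<longleftrightarrow> (u, v) \<in> parcs G \<and>
    (\<exists>xs. xs \<noteq> [] \<and> set (path_arcs u xs v) \<subseteq> parcs G \<and> distinct (u # xs @ [v]))"
proof -
  interpret pair_digraph G by fact
  have *: "apath u (path_arcs u xs v) v \<longleftrightarrow> set (path_arcs u xs v) \<subseteq> parcs G \<and> distinct (u # xs @ [v])"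
    if "(u, v) \<in> parcs G" for xs
    unfolding apath_def awalk_def path_arcs_pawalk_verts using wellformed'[OF that] by (simp add: path_arcs_pcas)
  have path: "\<exists>xs. xs \<noteq> [] \<and> c = path_arcs u xs v" if "(u, v) \<in> parcs G" "apath u c v" "c \<noteq> [(u, v)]" for c
  proof -
    have "pcas u c v" using that(2) by (simp add: apath_def awalk_def)
    \<comment> \<open>The empty path would make \<open>(u, v)\<close> a loop.\<close>
    moreover have "c \<noteq> []" using calculation no_loops'[OF that(1)] by auto
    ultimately show ?thesis using apath_path_arcs that(3) by (metis path_arcs.simps(1))
  qed
  have long: "path_arcs u xs v \<noteq> [(u, v)]" if "xs \<noteq> []" for xs
    using that by (cases xs; cases "tl xs") auto
  show ?thesis
  proof (cases "(u, v) \<in> parcs G")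
    case True
    have "(\<exists>c. apath u c v \<and> c \<noteq> [(u, v)]) \<longleftrightarrow>
      (\<exists>xs. xs \<noteq> [] \<and> set (path_arcs u xs v) \<subseteq> parcs G \<and> distinct (u # xs @ [v]))"
    proof
      assume "\<exists>c. apath u c v \<and> c \<noteq> [(u, v)]"
      then obtain c where c: "apath u c v" "c \<noteq> [(u, v)]" by blast
      obtain xs where "xs \<noteq> []" "c = path_arcs u xs v" using path[OF True c] by blast
      then show "\<exists>xs. xs \<noteq> [] \<and> set (path_arcs u xs v) \<subseteq> parcs G \<and> distinct (u # xs @ [v])"
        using *[OF True] c(1) by blast
    next
      assume "\<exists>xs. xs \<noteq> [] \<and> set (path_arcs u xs v) \<subseteq> parcs G \<and> distinct (u # xs @ [v])"
      then obtain xs where "xs \<noteq> []" "apath u (path_arcs u xs v) v" using *[OF True] by blast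
      then show "\<exists>c. apath u c v \<and> c \<noteq> [(u, v)]" using long by blast
    qed
    then show ?thesis using True by (simp add: transitive_arc_def)
  qed (simp add: transitive_arc_def)
qed

text \<open>The transitive arc, traversed backwards, closes the longer path to a cycle; so a tree
  has no transitive arc.\<close>

lemma transitive_arc_undirected_cycle:
  assumes "pair_digraph G" "transitive_arc G e"
  shows "\<exists>C. undirected_cycle G C"
proof -
  obtain u v where e: "e = (u, v)" by fastforce
  obtain xs where xs: "(u, v) \<in> parcs G" "xs \<noteq> []" "set (path_arcs u xs v) \<subseteq> parcs G" "distinct (u # xs @ [v])"
    using assms(2) unfolding e transitive_arc_iff[OF assms(1)] by blast
  then have "undirected_cycle G (ends ` set (path_arcs u (xs @ [v]) u))"
    by (intro undirected_cycleI[OF assms(1)]) (auto simp: path_arcs_append darts_iff Suc_le_eq)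
  then show ?thesis by blast
qed

subsection \<open>Cycles in outerplanar embeddings\<close>

definition sdiff :: "'b set \<Rightarrow> 'b set \<Rightarrow> 'b set" where
  "sdiff A B = (A - B) \<union> (B - A)"

lemma in_sdiff: "x \<in> sdiff A B \<longleftrightarrow> (x \<in> A) \<noteq> (x \<in> B)"
  by (auto simp: sdiff_def)

lemma sdiff_cancel: "sdiff (sdiff A B) B = A"
  by (auto simp: sdiff_def)

lemma sdiff_Diff: "sdiff A B - S = sdiff (A - S) (B - S)"
  by (auto simp: sdiff_def)

lemma odd_card_sdiff:
  assumes "finite A" "finite B"
  shows "odd (card (sdiff A B)) \<longleftrightarrow> odd (card A) \<noteq> odd (card B)"
proof -
  have "card A = card (A - B) + card (A \<inter> B)" "card B = card (B - A) + card (A \<inter> B)"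
    using assms by (metis card_Diff_subset_Int card_mono finite_Int inf_le1 le_add_diff_inverse2,
      metis card_Diff_subset_Int card_mono finite_Int inf_le2 inf_commute le_add_diff_inverse2)
  moreover have "card (sdiff A B) = card (A - B) + card (B - A)"
    unfolding sdiff_def using assms by (intro card_Un_disjoint) auto
  ultimately show ?thesis by presburger
qed

text \<open>For loop-free arcs this is the boundary map modulo two; its kernel, the even arc sets,
  is the cycle space.\<close>

definition odd_verts :: "('a \<times> 'a) set \<Rightarrow> 'a set" where
  "odd_verts C = {v. odd (card {e \<in> C. fst e = v \<or> snd e = v})}"

lemma odd_verts_sdiff:
  assumes "finite A" "finite B"
  shows "odd_verts (sdiff A B) = sdiff (odd_verts A) (odd_verts B)"
proof -
  have "{e \<in> sdiff A B. fst e = v \<or> snd e = v} = sdiff {e \<in> A. fst e = v \<or> snd e = v} {e \<in> B. fst e = v \<or> snd e = v}" for v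
    by (auto simp: in_sdiff)
  moreover have "odd (card (sdiff {e \<in> A. fst e = v \<or> snd e = v} {e \<in> B. fst e = v \<or> snd e = v})) \<longleftrightarrow>
    odd (card {e \<in> A. fst e = v \<or> snd e = v}) \<noteq> odd (card {e \<in> B. fst e = v \<or> snd e = v})" for v
    using assms by (intro odd_card_sdiff) simp_all
  ultimately have "v \<in> odd_verts (sdiff A B) \<longleftrightarrow> v \<in> sdiff (odd_verts A) (odd_verts B)" for v
    unfolding in_sdiff odd_verts_def mem_Collect_eq by presburger
  then show ?thesis by blast
qed

lemma odd_verts_single: "u \<noteq> v \<Longrightarrow> odd_verts {(u, v)} = {u, v}"
proof -
  have "{e \<in> {(u, v)}. fst e = w \<or> snd e = w} = (if w = u \<or> w = v then {(u, v)} else {})" for w by auto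
  then show ?thesis by (auto simp: odd_verts_def)
qed

lemma odd_verts_empty: "odd_verts {} = {}"
  by (simp add: odd_verts_def)

lemma odd_verts_path: "distinct (u # xs @ [v]) \<Longrightarrow> odd_verts (set (path_arcs u xs v)) = {u, v}"
proof (induction xs arbitrary: u)
  case (Cons x xs)
  have "(u, x) \<notin> set (path_arcs x xs v)" using Cons(2) by (auto dest: path_arcs_verts)
  then have "set (path_arcs u (x # xs) v) = sdiff {(u, x)} (set (path_arcs x xs v))"
    by (auto simp: sdiff_def)
  then have "odd_verts (set (path_arcs u (x # xs) v)) = sdiff {u, x} {x, v}"
    using Cons odd_verts_sdiff[of "{(u, x)}" "set (path_arcs x xs v)"] odd_verts_single[of u x] by simp
  then show ?case using Cons(2) by (auto simp: sdiff_def)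
qed (simp add: odd_verts_single)

text \<open>The two paths have no arc in common and the same ends, which cancel modulo two.\<close>

lemma odd_verts_diamond:
  assumes "diamond E t r as bs"
  shows "odd_verts (diamond_arcs t r as bs) = {}"
proof -
  have "set (path_arcs r as t) \<inter> set (path_arcs r bs t) = {}"
  proof (rule ccontr)
    assume "\<not> ?thesis"
    then obtain x y where xy: "(x, y) \<in> set (path_arcs r as t)" "(x, y) \<in> set (path_arcs r bs t)" by auto
    have "x \<in> set (r # as) \<inter> set (r # bs)" "y \<in> set (as @ [t]) \<inter> set (bs @ [t])"
      using path_arcs_verts[OF xy(1)] path_arcs_verts[OF xy(2)] by auto
    then have "x = r" "y = t" using assms by (auto simp: diamond_def)
    then have "hd (as @ [t]) = t" "hd (bs @ [t]) = t"
      using xy path_arcs_succ[OF _ path_arcs_first, of r as t t] path_arcs_succ[OF _ path_arcs_first, of r bs t t] assms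
      by (auto simp: diamond_def)
    then have "as = []" "bs = []" using assms by (cases as; cases bs; auto simp: diamond_def)+
    then show False using assms by (simp add: diamond_def)
  qed
  then have "diamond_arcs t r as bs = sdiff (set (path_arcs r as t)) (set (path_arcs r bs t))"
    by (auto simp: diamond_arcs_def sdiff_def)
  then show ?thesis using assms odd_verts_path[of r as t] odd_verts_path[of r bs t]
    by (simp add: odd_verts_sdiff diamond_def) (simp add: sdiff_def)
qed

lemma connected_darts:
  assumes "pair_digraph G" "Digraph_Component.connected (with_proj G)" "u \<in> pverts G" "v \<in> pverts G"
  shows "(u, v) \<in> (darts G)\<^sup>*"
proof -
  have "reachable (with_proj (mk_symmetric (with_proj G))) u v"
    using assms by (simp add: connected_def strongly_connected_def)
  then have "(u, v) \<in> rtrancl_on (pverts G) (darts G)"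
    by (simp add: reachable_def darts_def)
  then show ?thesis by (rule rtrancl_on_rtranclI)
qed

text \<open>The odd vertices of an arc set can be prescribed on all vertices but one.\<close>

lemma card_even_le:
  assumes G: "pair_digraph G" and con: "Digraph_Component.connected (with_proj G)"
  shows "card {C. C \<subseteq> parcs G \<and> odd_verts C = {}} * 2 ^ (card (pverts G) - 1) \<le> 2 ^ card (parcs G)"
proof -
  interpret pair_digraph G by fact
  let ?K = "{C. C \<subseteq> parcs G \<and> odd_verts C = {}}"
  obtain s where s: "s \<in> pverts G" using con by (auto simp: connected_def strongly_connected_def)
  have fin: "finite C" if "C \<subseteq> parcs G" for C using that pair_finite_arcs finite_subset by blast
  \<comment> \<open>The arc set is the sum modulo two of the edges of a walk from \<open>s\<close>
    to \<open>v\<close>.\<close>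
  have single: "\<exists>C \<subseteq> parcs G. odd_verts C - {s} = {v} - {s}" if "v \<in> pverts G" for v
  proof -
    have "(s, v) \<in> (darts G)\<^sup>*" using connected_darts[OF G con s that] .
    then show ?thesis
    proof (induction rule: rtrancl_induct)
      case base
      then show ?case by (intro exI[of _ "{}"]) (simp add: odd_verts_empty)
    next
      case (step u v)
      then obtain C where C: "C \<subseteq> parcs G" "odd_verts C - {s} = {u} - {s}" by blast
      obtain e where e: "e \<in> parcs G" "e = (u, v) \<or> e = (v, u)" using step(2) darts_iff by metis
      then have "u \<noteq> v" using no_loops' by auto
      then have "odd_verts {e} = {u, v}" using e(2) odd_verts_single[of u v] odd_verts_single[of v u] by auto
      then have "odd_verts (sdiff C {e}) = sdiff (odd_verts C) {u, v}"
        using odd_verts_sdiff[of C "{e}"] fin[OF C(1)] by simp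
      moreover have "sdiff (odd_verts C) {u, v} - {s} = {v} - {s}"
        unfolding sdiff_Diff C(2) using \<open>u \<noteq> v\<close> by (auto simp: sdiff_def)
      moreover have "sdiff C {e} \<subseteq> parcs G" using C(1) e(1) by (auto simp: sdiff_def)
      ultimately show ?case by (intro exI[of _ "sdiff C {e}"]) simp
    qed
  qed
  have "\<exists>C \<subseteq> parcs G. odd_verts C - {s} = W" if "W \<subseteq> pverts G - {s}" for W
  proof -
    have "finite W" using that pair_finite_verts finite_subset by blast
    then show ?thesis using that
    proof (induction W rule: finite_induct)
      case empty
      then show ?case by (intro exI[of _ "{}"]) (simp add: odd_verts_empty)
    next
      case (insert v W)
      then obtain A where A: "A \<subseteq> parcs G" "odd_verts A - {s} = W" by blast
      obtain B where B: "B \<subseteq> parcs G" "odd_verts B - {s} = {v} - {s}" using single[of v] insert.prems by auto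
      have "odd_verts (sdiff A B) = sdiff (odd_verts A) (odd_verts B)"
        by (rule odd_verts_sdiff[OF fin[OF A(1)] fin[OF B(1)]])
      moreover have "sdiff (odd_verts A) (odd_verts B) - {s} = sdiff (odd_verts A - {s}) (odd_verts B - {s})"
        by (rule sdiff_Diff)
      moreover have "sdiff W ({v} - {s}) = insert v W" using insert.prems insert.hyps by (auto simp: sdiff_def)
      moreover have "sdiff A B \<subseteq> parcs G" using A B by (auto simp: sdiff_def)
      ultimately show ?case using A B by (intro exI[of _ "sdiff A B"]) simp
    qed
  qed
  then have "\<forall>W. \<exists>C. W \<subseteq> pverts G - {s} \<longrightarrow> C \<subseteq> parcs G \<and> odd_verts C - {s} = W" by blast
  from choice[OF this] obtain c where c: "\<And>W. W \<subseteq> pverts G - {s} \<Longrightarrow> c W \<subseteq> parcs G \<and> odd_verts (c W) - {s} = W"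
    by blast
  let ?f = "\<lambda>(K, W). sdiff K (c W)"
  have odd_f: "odd_verts (sdiff K (c W)) - {s} = W" if "K \<in> ?K" "W \<subseteq> pverts G - {s}" for K W
  proof -
    have "odd_verts (sdiff K (c W)) = sdiff {} (odd_verts (c W))"
      using odd_verts_sdiff[of K "c W"] fin that c[OF that(2)] by simp
    then show ?thesis using c[OF that(2)] by (simp add: sdiff_def)
  qed
  \<comment> \<open>The odd vertices of the image give back \<open>W\<close>, and then cancelling
    \<open>c W\<close> gives back \<open>K\<close>.\<close>
  have "inj_on ?f (?K \<times> Pow (pverts G - {s}))"
  proof (rule inj_onI, clarify)
    fix K W K' W'
    assume *: "K \<subseteq> parcs G" "odd_verts K = {}" "W \<subseteq> pverts G - {s}" "K' \<subseteq> parcs G" "odd_verts K' = {}"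
      "W' \<subseteq> pverts G - {s}" "sdiff K (c W) = sdiff K' (c W')"
    then have "W = W'" using odd_f[of K W] odd_f[of K' W'] by simp
    have "sdiff (sdiff K (c W)) (c W) = sdiff (sdiff K' (c W')) (c W')"
      by (simp only: *(7)) (simp only: \<open>W = W'\<close>)
    then show "K = K' \<and> W = W'" using \<open>W = W'\<close> unfolding sdiff_cancel by blast
  qed
  moreover have "?f ` (?K \<times> Pow (pverts G - {s})) \<subseteq> Pow (parcs G)"
    using c unfolding sdiff_def by blast
  ultimately have "card (?K \<times> Pow (pverts G - {s})) \<le> card (Pow (parcs G))"
    using card_inj_on_le pair_finite_arcs by blast
  then show ?thesis using s pair_finite_verts pair_finite_arcs
    by (simp add: card_cartesian_product card_Pow)
qed

section \<open>Faces of a planar rotation system and their boundaries\<close>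

locale planar_rotation =
  fixes G :: "'a pair_pre_digraph" and \<sigma> :: "'a \<times> 'a \<Rightarrow> 'a \<times> 'a"
  assumes digraph: "pair_digraph G" and acyclic: "acyclic (parcs G)"
    and connected: "Digraph_Component.connected (with_proj G)"
    and planar: "planar_rotation_system G \<sigma>" and nonempty: "parcs G \<noteq> {}"
begin

sublocale pair_digraph G by (rule digraph)

lemma darts_eq: "darts G = parcs G \<union> prod.swap ` parcs G"
proof (intro set_eqI)
  fix d show "d \<in> darts G \<longleftrightarrow> d \<in> parcs G \<union> prod.swap ` parcs G"
    by (cases d) (auto simp: darts_iff intro: rev_image_eqI)
qed

lemma finite_darts: "finite (darts G)"
  unfolding darts_eq using pair_finite_arcs by simp

lemma card_darts: "card (darts G) = 2 * card (parcs G)"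
proof -
  have "parcs G \<inter> prod.swap ` parcs G = {}"
    using acyclic_antisym[OF acyclic] by auto
  moreover have "card (prod.swap ` parcs G) = card (parcs G)"
    by (intro card_image inj_onI) (simp add: prod_eq_iff)
  ultimately show ?thesis unfolding darts_eq using pair_finite_arcs by (simp add: card_Un_disjoint)
qed

lemma swap_dart: "d \<in> darts G \<Longrightarrow> prod.swap d \<in> darts G"
  by (cases d) (auto simp: darts_iff)

lemma dart_vertex: "d \<in> darts G \<Longrightarrow> fst d \<in> pverts G"
  using wellformed' by (cases d) (auto simp: darts_iff)

lemma rotation: "\<sigma> permutes darts G" "darts_at G v \<noteq> {} \<Longrightarrow> cyclic_on \<sigma> (darts_at G v)"
proof -
  have "rotation_system G \<sigma>" using planar by (simp add: planar_rotation_system_def)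
  moreover have "v \<in> pverts G" if "darts_at G v \<noteq> {}"
    using that dart_vertex by (auto simp: darts_at_def)
  ultimately show "\<sigma> permutes darts G" "darts_at G v \<noteq> {} \<Longrightarrow> cyclic_on \<sigma> (darts_at G v)"
    by (auto simp: rotation_system_def)
qed

abbreviation next_dart :: "'a \<times> 'a \<Rightarrow> 'a \<times> 'a" where
  "next_dart \<equiv> \<sigma> \<circ> prod.swap"

lemma next_dart_in: "d \<in> darts G \<Longrightarrow> next_dart d \<in> darts G"
  using rotation(1) swap_dart by (simp add: permutes_in_image)

text \<open>Outside the darts, \<open>next_dart\<close> still reverses pairs; only its restriction
  fixes them and is a permutation of the darts.\<close>

lemma next_dart_permutes: "perm_restrict next_dart (darts G) permutes darts G"
proof -
  let ?f = "perm_restrict next_dart (darts G)"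
  have "inj next_dart"
    using rotation(1) by (intro inj_compose) (auto simp: permutes_inj)
  then have inj: "inj_on next_dart (darts G)" by (rule inj_on_subset) simp
  moreover have "next_dart ` darts G \<subseteq> darts G" using next_dart_in by blast
  ultimately have "bij_betw next_dart (darts G) (darts G)"
    using endo_inj_surj[OF finite_darts] unfolding bij_betw_def by blast
  then have "bij_betw ?f (darts G) (darts G)"
    using bij_betw_cong[of "darts G" next_dart ?f "darts G"] by (simp add: perm_restrict_def)
  then show ?thesis
    by (rule bij_imp_permutes) (simp add: perm_restrict_def)
qed

lemma face_cyclic:
  assumes "d \<in> darts G"
  shows "cyclic_on next_dart (orbit next_dart d)" "orbit next_dart d \<subseteq> darts G" "d \<in> orbit next_dart d"
proof -
  let ?f = "perm_restrict next_dart (darts G)"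
  note perm = next_dart_permutes
  have eq: "orbit next_dart d = orbit ?f d"
    by (rule orbit_cong0[of d "darts G"]) (use assms next_dart_in in \<open>auto simp: perm_restrict_def\<close>)
  have sub: "orbit ?f d \<subseteq> darts G" by (rule permutes_orbit_subset[OF perm assms])
  then show "orbit next_dart d \<subseteq> darts G" unfolding eq .
  have "cyclic_on next_dart (orbit ?f d) \<longleftrightarrow> cyclic_on ?f (orbit ?f d)"
  proof (rule cyclic_cong)
    fix x assume "x \<in> orbit ?f d"
    then have "x \<in> darts G" using sub by blast
    then show "next_dart x = ?f x" by (simp only: perm_restrict_def if_True)
  qed
  then show "cyclic_on next_dart (orbit next_dart d)"
    unfolding eq using cyclic_on_orbit[OF perm finite_darts] by blast
  have "permutation ?f" using perm finite_darts permutation_permutes by blast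
  then show "d \<in> orbit next_dart d" unfolding eq by (rule permutation_self_in_orbit)
qed

text \<open>Sets of darts invariant under the face traversal, that is, unions of face boundaries.
  They stand for regions composed of faces; \<open>boundary\<close> gives the arcs with the region
  on exactly one side.\<close>

definition closed_darts :: "('a \<times> 'a) set \<Rightarrow> bool" where
  "closed_darts M \<longleftrightarrow> M \<subseteq> darts G \<and> (\<forall>d \<in> darts G. \<sigma> (prod.swap d) \<in> M \<longleftrightarrow> d \<in> M)"

definition boundary :: "('a \<times> 'a) set \<Rightarrow> ('a \<times> 'a) set" where
  "boundary M = {e \<in> parcs G. (e \<in> M) \<noteq> (prod.swap e \<in> M)}"

lemma closed_rotate: "closed_darts M \<Longrightarrow> d \<in> darts G \<Longrightarrow> \<sigma> d \<in> M \<longleftrightarrow> prod.swap d \<in> M"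
  using swap_dart[of d] unfolding closed_darts_def by force

text \<open>At \<open>v\<close>, the darts in \<open>M\<close> are as many as the darts whose
  rotation successor is in \<open>M\<close>, because \<sigma> permutes the darts at
  \<open>v\<close>. So the symmetric difference of these two sets is even, and its darts correspond
  to the boundary arcs at \<open>v\<close>.\<close>

lemma odd_verts_boundary: assumes M: "closed_darts M" shows "odd_verts (boundary M) = {}"
proof -
  have "even (card {e \<in> boundary M. fst e = v \<or> snd e = v})" for v
  proof -
    let ?S = "darts_at G v"
    have bij: "bij_betw \<sigma> ?S ?S"
    proof (cases "?S = {}")
      case False
      then have sub: "\<sigma> ` ?S \<subseteq> ?S" using cyclic_on_inI[OF rotation(2)[OF False]] by auto
      have "finite ?S" using finite_darts by (simp add: darts_at_def)
      moreover have inj: "inj_on \<sigma> ?S"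
        by (rule inj_on_subset[OF permutes_inj[OF rotation(1)]]) simp
      ultimately show ?thesis using endo_inj_surj[OF _ sub inj] inj by (simp add: bij_betw_def)
    qed (simp add: bij_betw_def)
    define A where "A = {d \<in> ?S. d \<in> M}"
    define B where "B = {d \<in> ?S. \<sigma> d \<in> M}"
    have fin: "finite A" "finite B" using finite_darts by (auto simp: A_def B_def darts_at_def)
    have "\<sigma> ` B = A"
    proof
      show "\<sigma> ` B \<subseteq> A" using bij_betw_apply[OF bij] by (auto simp: A_def B_def)
      show "A \<subseteq> \<sigma> ` B"
      proof
        fix y assume y: "y \<in> A"
        then have "y \<in> \<sigma> ` ?S" using bij_betw_imp_surj_on[OF bij] by (simp add: A_def)
        then obtain x where "x \<in> ?S" "y = \<sigma> x" by (rule imageE) blast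
        then show "y \<in> \<sigma> ` B" using y by (auto simp: A_def B_def)
      qed
    qed
    moreover have "inj_on \<sigma> B" by (rule inj_on_subset[OF bij_betw_imp_inj_on[OF bij]]) (auto simp: B_def)
    ultimately have "card A = card B" using card_image[of \<sigma> B] by simp
    then have even: "even (card (sdiff A B))" using odd_card_sdiff[OF fin] by simp
    have rot: "\<sigma> d \<in> M \<longleftrightarrow> prod.swap d \<in> M" if "d \<in> ?S" for d
      using closed_rotate[OF M] that by (simp add: darts_at_def)
    \<comment> \<open>Turns each arc incident to \<open>v\<close> into its dart at
      \<open>v\<close>.\<close>
    let ?g = "\<lambda>e. if fst e = v then e else prod.swap e"
    have "bij_betw ?g {e \<in> boundary M. fst e = v \<or> snd e = v} (sdiff A B)"
      unfolding bij_betw_def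
    proof
      show "inj_on ?g {e \<in> boundary M. fst e = v \<or> snd e = v}"
        using acyclic_antisym[OF acyclic] no_loops' by (auto simp: inj_on_def boundary_def)
      show "?g ` {e \<in> boundary M. fst e = v \<or> snd e = v} = sdiff A B"
      proof (intro set_eqI iffI)
        fix d assume "d \<in> ?g ` {e \<in> boundary M. fst e = v \<or> snd e = v}"
        then obtain e where e: "e \<in> boundary M" "fst e = v \<or> snd e = v" "d = ?g e" by blast
        then have "d \<in> ?S" by (cases e) (auto simp: darts_at_def boundary_def darts_iff)
        moreover have "(d \<in> M) \<noteq> (prod.swap d \<in> M)" using e by (auto simp: boundary_def)
        ultimately show "d \<in> sdiff A B" using rot[of d] by (simp add: in_sdiff A_def B_def)
      next
        fix d assume "d \<in> sdiff A B"
        then have d: "d \<in> ?S" "(d \<in> M) \<noteq> (prod.swap d \<in> M)"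
          using rot by (auto simp: in_sdiff A_def B_def)
        show "d \<in> ?g ` {e \<in> boundary M. fst e = v \<or> snd e = v}"
        proof (cases "d \<in> parcs G")
          case True
          then show ?thesis using d by (intro image_eqI[of _ _ d]) (auto simp: boundary_def darts_at_def)
        next
          case False
          then have "prod.swap d \<in> parcs G" using d(1) by (cases d) (auto simp: darts_at_def darts_iff)
          moreover have "fst (prod.swap d) \<noteq> v"
            using calculation no_loops' d(1) by (cases d) (auto simp: darts_at_def)
          ultimately show ?thesis using d
            by (intro image_eqI[of _ _ "prod.swap d"]) (auto simp: boundary_def darts_at_def)
        qed
      qed
    qed
    then have "card {e \<in> boundary M. fst e = v \<or> snd e = v} = card (sdiff A B)"
      by (rule bij_betw_same_card)
    then show ?thesis using even by simp
  qed
  then show ?thesis by (simp add: odd_verts_def)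
qed

text \<open>Without a boundary, \<open>M\<close> is invariant under reversal and rotation; by
  connectedness it contains all darts as soon as it contains one.\<close>

lemma no_boundary:
  assumes M: "closed_darts M" and "boundary M = {}"
  shows "M = {} \<or> M = darts G"
proof -
  have swap: "prod.swap d \<in> M \<longleftrightarrow> d \<in> M" if "d \<in> darts G" for d
  proof -
    have "d \<in> parcs G \<or> prod.swap d \<in> parcs G" using that by (cases d) (simp add: darts_iff)
    then show ?thesis using assms(2) unfolding boundary_def by (cases d) auto
  qed
  have sub: "M \<subseteq> darts G" using M by (simp add: closed_darts_def)
  have rot: "\<sigma> d \<in> M" if "d \<in> M" for d
    using closed_rotate[OF M, of d] swap[of d] that sub by blast
  have at: "darts_at G (fst d) \<subseteq> M" if "d \<in> M" for d
  proof -
    have d: "d \<in> darts_at G (fst d)" using that M by (auto simp: closed_darts_def darts_at_def)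
    then have cyc: "cyclic_on \<sigma> (darts_at G (fst d))" using rotation(2) by blast
    then have orb: "darts_at G (fst d) = orbit \<sigma> d" using d by (simp add: orbit_cyclic_eq3)
    show ?thesis
    proof
      fix x assume "x \<in> darts_at G (fst d)"
      then have "x \<in> orbit \<sigma> d" using orb by simp
      then show "x \<in> M"
      proof (induction rule: orbit.induct)
        case base
        then show ?case using rot[OF that] by simp
      next
        case (step y)
        then show ?case using rot by simp
      qed
    qed
  qed
  have "darts G \<subseteq> M" if "d \<in> M" for d
  proof
    fix x assume x: "x \<in> darts G"
    have "fst d \<in> pverts G" "fst x \<in> pverts G"
      using that sub dart_vertex[of d] dart_vertex[OF x] by auto
    then have "(fst d, fst x) \<in> (darts G)\<^sup>*" by (rule connected_darts[OF digraph connected])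
    then have "darts_at G (fst x) \<subseteq> M"
    proof (induction rule: rtrancl_induct)
      case base
      then show ?case by (rule at[OF that])
    next
      case (step u v)
      then have "(u, v) \<in> M" by (auto simp: darts_at_def)
      then have "(v, u) \<in> M" using swap[OF step(2)] by simp
      then show ?case using at[of "(v, u)"] by simp
    qed
    then show "x \<in> M" using x by (auto simp: darts_at_def)
  qed
  then show ?thesis using sub by blast
qed

lemma faces_eq: "faces G \<sigma> = orbit next_dart ` darts G"
proof -
  obtain u v where "(u, v) \<in> parcs G" using nonempty by fastforce
  then have "(u, v) \<in> darts G" by (simp add: darts_iff)
  then show ?thesis by (auto simp: faces_def)
qed

lemma face_of: "g \<in> faces G \<sigma> \<Longrightarrow> d \<in> g \<Longrightarrow> d \<in> darts G \<and> g = orbit next_dart d"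
  using face_cyclic unfolding faces_eq cyclic_on_alldef by blast

lemma face_nonempty: "g \<in> faces G \<sigma> \<Longrightarrow> \<exists>d. d \<in> g"
  using face_cyclic(3) unfolding faces_eq by blast

lemma closed_Union_faces: assumes "S \<subseteq> faces G \<sigma>" shows "closed_darts (\<Union> S)"
  unfolding closed_darts_def
proof (intro conjI ballI)
  show "\<Union> S \<subseteq> darts G" using face_of assms by blast
  fix d assume d: "d \<in> darts G"
  show "\<sigma> (prod.swap d) \<in> \<Union> S \<longleftrightarrow> d \<in> \<Union> S"
  proof
    assume "d \<in> \<Union> S"
    then obtain g where "g \<in> S" "d \<in> g" by blast
    then have "g = orbit next_dart d" using face_of assms by blast
    then have "next_dart d \<in> g" using orbit.base[of next_dart d] by metis
    then show "\<sigma> (prod.swap d) \<in> \<Union> S" using \<open>g \<in> S\<close> by auto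
  next
    assume "\<sigma> (prod.swap d) \<in> \<Union> S"
    then obtain g where g: "g \<in> S" "next_dart d \<in> g" by auto
    then have "g = orbit next_dart (next_dart d)" using face_of assms by blast
    moreover have "orbit next_dart (next_dart d) = orbit next_dart d"
      by (rule self_in_orbit_step[OF face_cyclic(3)[OF d]])
    ultimately show "d \<in> \<Union> S" using face_cyclic(3)[OF d] g by auto
  qed
qed

text \<open>The boundaries of sets of faces that avoid \<open>f\<close> are distinct even arc sets, and by
  Euler's formula there are no other even arc sets.\<close>

lemma separating_darts:
  assumes f: "f \<in> faces G \<sigma>" and C: "C \<subseteq> parcs G" "odd_verts C = {}"
  obtains M where "closed_darts M" "M \<inter> f = {}" "boundary M = C"
proof -
  let ?K = "{C. C \<subseteq> parcs G \<and> odd_verts C = {}}" and ?P = "Pow (faces G \<sigma> - {f})"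
  obtain d where d: "d \<in> f" using face_nonempty[OF f] by blast
  have fin: "finite (faces G \<sigma>)" using finite_darts by (simp add: faces_eq)
  have avoid: "\<Union> S \<inter> f = {}" if "S \<in> ?P" for S
    using that face_of f by blast
  have inj: "inj_on (\<lambda>S. boundary (\<Union> S)) ?P"
  proof (rule inj_onI)
    fix S T assume S: "S \<in> ?P" and T: "T \<in> ?P" and eq: "boundary (\<Union> S) = boundary (\<Union> T)"
    have closed: "closed_darts (\<Union> S)" "closed_darts (\<Union> T)"
      using S T by (auto intro!: closed_Union_faces)
    \<comment> \<open>The difference of two regions with the same boundary has no boundary and does
      not contain the dart \<open>d\<close> of \<open>f\<close>, so it is empty.\<close>
    then have "closed_darts (sdiff (\<Union> S) (\<Union> T))"
      unfolding closed_darts_def by (auto simp: sdiff_def)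
    moreover have "boundary (sdiff (\<Union> S) (\<Union> T)) = {}"
    proof (rule ccontr)
      assume "boundary (sdiff (\<Union> S) (\<Union> T)) \<noteq> {}"
      then obtain e where "e \<in> parcs G" "(e \<in> sdiff (\<Union> S) (\<Union> T)) \<noteq> (prod.swap e \<in> sdiff (\<Union> S) (\<Union> T))"
        unfolding boundary_def by blast
      moreover have "e \<in> boundary (\<Union> S) \<longleftrightarrow> e \<in> boundary (\<Union> T)" by (simp only: eq)
      ultimately show False unfolding in_sdiff boundary_def mem_Collect_eq by argo
    qed
    moreover have "d \<notin> sdiff (\<Union> S) (\<Union> T)" "d \<in> darts G"
      using avoid[OF S] avoid[OF T] d face_of[OF f] by (auto simp: sdiff_def)
    ultimately have "sdiff (\<Union> S) (\<Union> T) = {}" using no_boundary by blast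
    then have U: "\<Union> S = \<Union> T" unfolding sdiff_def by blast
    have le: "A \<subseteq> B" if "A \<in> ?P" "B \<in> ?P" "\<Union> A = \<Union> B" for A B
    proof
      fix g assume g: "g \<in> A"
      then have gf: "g \<in> faces G \<sigma>" using that(1) by blast
      then obtain x where x: "x \<in> g" using face_nonempty by blast
      have "x \<in> \<Union> B" using x g that(3) by blast
      then obtain h where h: "h \<in> B" "x \<in> h" by blast
      then have "h \<in> faces G \<sigma>" using that(2) by blast
      then have "g = h" using face_of[OF gf x] face_of[OF _ h(2)] by simp
      then show "g \<in> B" using h by simp
    qed
    show "S = T" by (rule subset_antisym[OF le[OF S T U] le[OF T S U[symmetric]]])
  qed
  have fin_arcs: "finite (parcs G)" "finite (pverts G)" by (rule pair_finite_arcs pair_finite_verts)+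
  have sub: "(\<lambda>S. boundary (\<Union> S)) ` ?P \<subseteq> ?K"
  proof (intro image_subsetI CollectI conjI)
    fix S assume "S \<in> ?P"
    then have "closed_darts (\<Union> S)" by (intro closed_Union_faces) blast
    then show "odd_verts (boundary (\<Union> S)) = {}" by (rule odd_verts_boundary)
  qed (simp add: boundary_def)
  have card_P: "card ((\<lambda>S. boundary (\<Union> S)) ` ?P) = 2 ^ (card (faces G \<sigma>) - 1)"
    using card_image[OF inj] f fin by (simp add: card_Pow)
  \<comment> \<open>In this form, Euler's formula turns the bound of \<open>card_even_le\<close>
    into the number of sets of faces without \<open>f\<close>.\<close>
  have euler: "card (parcs G) = (card (faces G \<sigma>) - 1) + (card (pverts G) - 1)"
  proof -
    have "card (pverts G) + card (faces G \<sigma>) = card (parcs G) + 2"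
      using planar card_darts by (simp add: planar_rotation_system_def)
    moreover have "card (faces G \<sigma>) > 0" using f fin by (auto simp: card_gt_0_iff)
    moreover have "card (pverts G) > 0"
      using connected fin_arcs by (auto simp: card_gt_0_iff connected_def strongly_connected_def)
    ultimately show ?thesis by linarith
  qed
  have "card ?K \<le> 2 ^ (card (faces G \<sigma>) - 1)"
    using card_even_le[OF digraph connected] unfolding euler power_add by simp
  then have "(\<lambda>S. boundary (\<Union> S)) ` ?P = ?K"
    using fin_arcs sub card_P by (intro card_seteq) auto
  then have "C \<in> (\<lambda>S. boundary (\<Union> S)) ` ?P" using C by simp
  then obtain S where S: "S \<in> ?P" "boundary (\<Union> S) = C" by (metis (no_types, lifting) imageE)
  show thesis
  proof (rule that[of "\<Union> S"])
    show "closed_darts (\<Union> S)" using S(1) by (intro closed_Union_faces) blast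
  qed (use S avoid[OF S(1)] in auto)
qed

end

lemma path_arcs_all:
  assumes "\<And>x y z. (x, y) \<in> set (path_arcs u xs v) \<Longrightarrow> (y, z) \<in> set (path_arcs u xs v) \<Longrightarrow> Q (x, y) \<Longrightarrow> Q (y, z)"
    and "Q (u, hd (xs @ [v]))" and "e \<in> set (path_arcs u xs v)"
  shows "Q e"
  using assms
proof (induction xs arbitrary: u)
  case (Cons x xs)
  have "(x, hd (xs @ [v])) \<in> set (path_arcs x xs v)" by (rule path_arcs_first)
  then have "Q (x, hd (xs @ [v]))" using Cons.prems(1)[of u x "hd (xs @ [v])"] Cons.prems(2) by simp
  then have "Q e" if "e \<in> set (path_arcs x xs v)"
    using Cons.IH[of x] Cons.prems(1) that by (metis UnCI list.set_intros(2) path_arcs.simps(2))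
  then show ?case using Cons.prems(2,3) by auto
qed simp

section \<open>The inner face of a cycle in an outerplanar embedding\<close>

locale outerplanar_dag = planar_rotation G \<sigma> + merging_dag "pverts G" "parcs G" s
  for G :: "'a pair_pre_digraph" and \<sigma> s +
  fixes f :: "('a \<times> 'a) set"
  assumes face: "f \<in> faces G \<sigma>" and all_on_face: "v \<in> pverts G \<Longrightarrow> on_face G v f"
begin

lemma face_at: "d \<in> darts G \<Longrightarrow> \<exists>d' \<in> f. d' \<in> darts_at G (fst d)"
proof -
  assume d: "d \<in> darts G"
  then have "d \<in> darts_at G (fst d)" by (simp add: darts_at_def)
  then show ?thesis using all_on_face[OF dart_vertex[OF d]] unfolding on_face_def by blast
qed

text \<open>The region that the cycle separates from \<open>f\<close> contains no dart of another
  edge. At a vertex off the cycle, one dart in the region would pull in all others by rotation,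
  although one of them is in \<open>f\<close>. An edge joining two vertices of the cycle would be a
  chord, which the uniqueness of diamonds and acyclicity exclude.\<close>

lemma tight_darts:
  assumes d: "diamond (parcs G) t r as bs"
  obtains M where "closed_darts M" "M \<inter> f = {}" "boundary M = diamond_arcs t r as bs"
    "\<And>x y. (x, y) \<in> M \<Longrightarrow> (x, y) \<in> diamond_arcs t r as bs \<or> (y, x) \<in> diamond_arcs t r as bs"
proof -
  let ?C = "diamond_arcs t r as bs"
  obtain M where M: "closed_darts M" "M \<inter> f = {}" "boundary M = ?C"
    by (rule separating_darts[OF face diamond_arcs_subset[OF d] odd_verts_diamond[OF d]])
  have sub: "M \<subseteq> darts G" using M(1) by (simp add: closed_darts_def)
  have swap: "(y, x) \<in> M \<longleftrightarrow> (x, y) \<in> M" if "(x, y) \<in> darts G" "(x, y) \<notin> ?C" "(y, x) \<notin> ?C" for x y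
  proof -
    have "(x, y) \<notin> boundary M" "(y, x) \<notin> boundary M" using that(2,3) M(3) by simp_all
    then show ?thesis using that(1) unfolding boundary_def darts_iff by auto
  qed
  have touches: "\<exists>w. (x, w) \<in> ?C \<or> (w, x) \<in> ?C" if xy: "(x, y) \<in> M" for x y
  proof (rule ccontr)
    assume off: "\<not> ?thesis"
    have xd: "(x, y) \<in> darts_at G x" using xy sub by (auto simp: darts_at_def)
    then have "cyclic_on \<sigma> (darts_at G x)" using rotation(2) by blast
    then have orb: "darts_at G x = orbit \<sigma> (x, y)" using xd by (simp add: orbit_cyclic_eq3)
    have rot: "\<sigma> d \<in> M" if dM: "d \<in> M" and dx: "d \<in> darts_at G x" for d
    proof -
      obtain w where d: "d = (x, w)" using dx by (cases d) (auto simp: darts_at_def)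
      have xw: "(x, w) \<in> darts G" using dx d by (simp add: darts_at_def)
      then have "(w, x) \<in> M" using swap[of x w] off dM d by blast
      then show ?thesis using closed_rotate[OF M(1) xw] d by simp
    qed
    have "d \<in> M" if "d \<in> orbit \<sigma> (x, y)" for d
      using that
    proof (induction rule: orbit.induct)
      case base
      then show ?case using rot xy xd by simp
    next
      case (step d)
      then show ?case using rot orb by blast
    qed
    then have "darts_at G x \<subseteq> M" using orb by blast
    moreover obtain d' where "d' \<in> f" "d' \<in> darts_at G x"
      using face_at[of "(x, y)"] xd by (auto simp: darts_at_def)
    ultimately show False using M(2) by blast
  qed
  have "(x, y) \<in> ?C \<or> (y, x) \<in> ?C" if xy: "(x, y) \<in> M" for x y
  proof (rule ccontr)
    assume off: "\<not> ?thesis"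
    then have yx: "(y, x) \<in> M" using swap[of x y] xy sub by blast
    \<comment> \<open>A chord into the sink would be a third arc there, a chord into the root would
      close a directed cycle, and a chord into an inner vertex would give it a second
      parent.\<close>
    have no_arc: False if "(p, q) \<in> parcs G" "(p, q) \<notin> ?C" "(p, w) \<in> ?C \<or> (w, p) \<in> ?C"
      "(q, w') \<in> ?C \<or> (w', q) \<in> ?C" for p q w w'
    proof -
      have p: "p \<in> {r, t} \<union> set as \<union> set bs" and q: "q \<in> {r, t} \<union> set as \<union> set bs"
        using that(3,4) by (auto simp: diamond_arcs_def dest!: path_arcs_verts)
      have paths: "set (path_arcs r as t) \<subseteq> parcs G" "set (path_arcs r bs t) \<subseteq> parcs G"
        using d by (auto simp: diamond_def)
      consider "q = t" | "q = r" | "q \<in> set as \<union> set bs" using q by blast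
      then show False
      proof cases
        case 1
        then show ?thesis using in_neighbours_sink[OF d] diamond_into_sink[OF d] that(1,2) by blast
      next
        case 2
        have "p \<noteq> r" using that(1) 2 no_loops' by blast
        then have "(r, p) \<in> (parcs G)\<^sup>+"
          using p path_arcs_trancl[OF paths(1)] path_arcs_trancl[OF paths(2)] by blast
        then have "(r, r) \<in> (parcs G)\<^sup>+" using that(1) 2 by (meson trancl.trancl_into_trancl)
        then show ?thesis using acyclic by (simp add: acyclic_def)
      next
        case 3
        obtain z where z: "(z, q) \<in> ?C" using diamond_inner_in_out(1)[OF d 3] by blast
        then have "(z, q) \<in> parcs G" using diamond_arcs_subset[OF d] by blast
        then have "z = p" using in_neighbour_inner[OF d 3 that(1)] by simp
        then show ?thesis using z that(2) by simp
      qed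
    qed
    have "(x, y) \<in> darts G" using xy sub by blast
    then have "(x, y) \<in> parcs G \<or> (y, x) \<in> parcs G" by (simp add: darts_iff)
    moreover obtain w where "(x, w) \<in> ?C \<or> (w, x) \<in> ?C" using touches[OF xy] by blast
    moreover obtain w' where "(y, w') \<in> ?C \<or> (w', y) \<in> ?C" using touches[OF yx] by blast
    ultimately show False using no_arc[of x y w w'] no_arc[of y x w' w] off by argo
  qed
  then show thesis using that M by blast
qed

text \<open>
  The inner face of the cycle is to the left of the arcs of the right path and to the right of the
  arcs of the left path; no other edge leaves a vertex of the cycle into it.
\<close>

definition oriented :: "'a \<Rightarrow> 'a \<Rightarrow> 'a list \<Rightarrow> 'a list \<Rightarrow> bool" where
  "oriented t r as bs \<longleftrightarrow> diamond (parcs G) t r as bs \<and>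
     (\<forall>e \<in> set (path_arcs r bs t). e \<notin> f) \<and>
     (\<forall>x y z. (x, y) \<in> set (path_arcs r bs t) \<longrightarrow> (y, z) \<in> set (path_arcs r bs t) \<longrightarrow> \<sigma> (y, x) = (y, z)) \<and>
     (\<forall>x y z. (x, y) \<in> set (path_arcs r as t) \<longrightarrow> (y, z) \<in> set (path_arcs r as t) \<longrightarrow> \<sigma> (y, z) = (y, x)) \<and>
     \<sigma> (t, last (r # bs)) = (t, last (r # as)) \<and> \<sigma> (r, hd (as @ [t])) = (r, hd (bs @ [t]))"

text \<open>As \<open>M\<close> contains only darts of the cycle, the face traversal that starts
  along \<open>bs\<close> has to run down this path and back up along \<open>as\<close>. Every turn
  on the way gives one of the equations for \<sigma>.\<close>

lemma oriented_if:
  assumes d: "diamond (parcs G) t r as bs" and M: "closed_darts M" "M \<inter> f = {}"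
    "boundary M = diamond_arcs t r as bs"
    and tight: "\<And>x y. (x, y) \<in> M \<Longrightarrow> (x, y) \<in> diamond_arcs t r as bs \<or> (y, x) \<in> diamond_arcs t r as bs"
    and first: "(r, hd (bs @ [t])) \<in> M"
  shows "oriented t r as bs"
proof -
  let ?C = "diamond_arcs t r as bs"
  \<comment> \<open>The traversal leaves \<open>y\<close> along an edge of the cycle again. It
    cannot turn back, since then both darts of a boundary arc would be in \<open>M\<close>.\<close>
  have turn: "\<sigma> (y, x) = (y, z) \<and> (y, z) \<in> M" if "(x, y) \<in> M"
    "\<And>w. (w, y) \<in> ?C \<or> (y, w) \<in> ?C \<Longrightarrow> w = x \<or> w = z" for x y z
  proof -
    have xy: "(x, y) \<in> darts G" using that(1) M(1) by (auto simp: closed_darts_def)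
    then have yx: "(y, x) \<in> darts_at G y" by (auto simp: darts_at_def darts_iff)
    then have "\<sigma> (y, x) \<in> darts_at G y" using cyclic_on_inI[OF rotation(2)] by blast
    then obtain w where w: "\<sigma> (y, x) = (y, w)" by (cases "\<sigma> (y, x)") (auto simp: darts_at_def)
    have "\<sigma> (prod.swap (x, y)) \<in> M" using M(1) xy that(1) unfolding closed_darts_def by blast
    then have yw: "(y, w) \<in> M" using w by simp
    have "w \<noteq> x"
    proof
      assume "w = x"
      then have "(x, y) \<notin> boundary M" "(y, x) \<notin> boundary M" using yw that(1) by (auto simp: boundary_def)
      then show False using tight[OF that(1)] M(3) by simp
    qed
    then have "w = z" using that(2)[of w] tight[OF yw] by blast
    then show ?thesis using w yw by simp
  qed
  have dist: "distinct (r # as @ [t])" "distinct (r # bs @ [t])" "set as \<inter> set bs = {}" "t \<notin> set as" "t \<notin> set bs"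
    using d by (auto simp: diamond_def)
  have inner: "w = x \<or> w = z" if C: "(w, y) \<in> ?C \<or> (y, w) \<in> ?C" and
    path: "(x, y) \<in> set (path_arcs r cs t)" "(y, z) \<in> set (path_arcs r cs t)" and
    cs: "cs = as \<and> cs' = bs \<or> cs = bs \<and> cs' = as" for w x y z cs cs'
  proof -
    have d': "diamond (parcs G) t r cs cs'" "?C = diamond_arcs t r cs cs'"
      using cs d diamond_swap diamond_arcs_swap by metis+
    have dcs: "distinct (r # cs @ t # cs')" using d'(1) by (simp add: diamond_def)
    then have y: "y \<in> set cs" using path_arcs_verts[OF path(1)] path_arcs_verts[OF path(2)] by auto
    show ?thesis
    proof (cases "(w, y) \<in> ?C")
      case True
      have "(x, y) \<in> parcs G" "(w, y) \<in> parcs G"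
        using path(1) True d'(2) diamond_arcs_subset[OF d'(1)] by (auto simp: diamond_arcs_def)
      then show ?thesis using in_neighbour_inner[OF d'(1), of y x w] y by simp
    next
      case False
      then have "(y, w) \<in> set (path_arcs r cs t) \<or> (y, w) \<in> set (path_arcs r cs' t)"
        using C unfolding d'(2) by (simp add: diamond_arcs_def)
      moreover have "(y, w) \<notin> set (path_arcs r cs' t)"
        using path_arcs_verts[of y w r cs' t] y dcs by auto
      ultimately show ?thesis using path_arcs_succ[of r cs t y w z] path(2) dcs by auto
    qed
  qed
  have right: "(y, z) \<in> M \<and> \<sigma> (y, x) = (y, z)"
    if "(x, y) \<in> set (path_arcs r bs t)" "(y, z) \<in> set (path_arcs r bs t)" "(x, y) \<in> M" for x y z
    using turn[OF that(3), of z] inner[of _ y x bs z as] that(1,2) by blast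
  have right_M: "e \<in> M" if "e \<in> set (path_arcs r bs t)" for e
    by (rule path_arcs_all[of r bs t "\<lambda>e. e \<in> M"]) (use right first that in blast)+
  have at_t: "w = last (r # bs) \<or> w = last (r # as)" if "(w, t) \<in> ?C \<or> (t, w) \<in> ?C" for w
    using that diamond_into_sink[OF d] diamond_sink_out[OF d] by blast
  have sink: "\<sigma> (t, last (r # bs)) = (t, last (r # as)) \<and> (t, last (r # as)) \<in> M"
    by (rule turn[OF right_M[OF path_arcs_last]]) (rule at_t)
  have rev: "(x, y) \<in> set (path_arcs t (rev as) r) \<longleftrightarrow> (y, x) \<in> set (path_arcs r as t)" for x y
    unfolding path_arcs_rev by force
  have left: "(y, z) \<in> M \<and> \<sigma> (y, x) = (y, z)"
    if "(x, y) \<in> set (path_arcs t (rev as) r)" "(y, z) \<in> set (path_arcs t (rev as) r)" "(x, y) \<in> M" for x y z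
    using turn[OF that(3), of z] inner[of _ y z as x bs] that(1,2) unfolding rev by blast
  have hd_rev: "hd (rev as @ [r]) = last (r # as)" by (cases as rule: rev_cases) auto
  have left_M: "e \<in> M" if "e \<in> set (path_arcs t (rev as) r)" for e
  proof (rule path_arcs_all[of t "rev as" r "\<lambda>e. e \<in> M"])
    show "(t, hd (rev as @ [r])) \<in> M" using sink hd_rev by simp
  qed (use left that in blast)+
  have at_r: "w = hd (as @ [t]) \<or> w = hd (bs @ [t])" if "(w, r) \<in> ?C \<or> (r, w) \<in> ?C" for w
  proof -
    have "(w, r) \<notin> ?C" using dist by (auto simp: diamond_arcs_def dest!: path_arcs_verts)
    then have "(r, w) \<in> set (path_arcs r as t) \<or> (r, w) \<in> set (path_arcs r bs t)"
      using that by (simp add: diamond_arcs_def)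
    then show ?thesis
      using path_arcs_succ[OF dist(1) _ path_arcs_first] path_arcs_succ[OF dist(2) _ path_arcs_first] by blast
  qed
  have "(hd (as @ [t]), r) \<in> M" using left_M rev path_arcs_first[of r as t] by blast
  then have root: "\<sigma> (r, hd (as @ [t])) = (r, hd (bs @ [t]))" using turn[of "hd (as @ [t])" r] at_r by blast
  show ?thesis
    unfolding oriented_def
  proof (intro conjI ballI allI impI)
    show "e \<notin> f" if "e \<in> set (path_arcs r bs t)" for e using right_M[OF that] M(2) by blast
    show "\<sigma> (y, x) = (y, z)" if "(x, y) \<in> set (path_arcs r bs t)" "(y, z) \<in> set (path_arcs r bs t)" for x y z
      using right[OF that right_M[OF that(1)]] by simp
    show "\<sigma> (y, z) = (y, x)" if "(x, y) \<in> set (path_arcs r as t)" "(y, z) \<in> set (path_arcs r as t)" for x y z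
      using left[of z y x] left_M[of "(z, y)"] that unfolding rev by simp
  qed (use d sink root in auto)
qed

text \<open>If the first dart along \<open>bs\<close> is not in \<open>M\<close>, its reverse is, as
  the arc is on the boundary. The traversal then arrives at \<open>r\<close> and has to go on along
  \<open>as\<close>, so the paths exchange roles.\<close>

lemma oriented_exists:
  assumes d: "diamond (parcs G) t r as bs"
  shows "oriented t r as bs \<or> oriented t r bs as"
proof -
  obtain M where M: "closed_darts M" "M \<inter> f = {}" "boundary M = diamond_arcs t r as bs"
    and tight: "\<And>x y. (x, y) \<in> M \<Longrightarrow> (x, y) \<in> diamond_arcs t r as bs \<or> (y, x) \<in> diamond_arcs t r as bs"
    by (rule tight_darts[OF d]) blast
  let ?a = "hd (as @ [t])" and ?b = "hd (bs @ [t])"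
  show ?thesis
  proof (cases "(r, ?b) \<in> M")
    case True
    then show ?thesis using oriented_if[OF d M tight] by blast
  next
    case False
    have "(r, ?b) \<in> boundary M" using M(3) path_arcs_first[of r bs t] by (simp add: diamond_arcs_def)
    then have br: "(?b, r) \<in> M" using False by (simp add: boundary_def)
    have dist: "distinct (r # as @ [t])" "distinct (r # bs @ [t])" using d by (auto simp: diamond_def)
    have rb: "(?b, r) \<in> darts G" using br M(1) by (auto simp: closed_darts_def)
    then have "(r, ?b) \<in> darts_at G r" by (auto simp: darts_at_def darts_iff)
    then have "\<sigma> (r, ?b) \<in> darts_at G r" using cyclic_on_inI[OF rotation(2)] by blast
    then obtain w where w: "\<sigma> (r, ?b) = (r, w)" by (cases "\<sigma> (r, ?b)") (auto simp: darts_at_def)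
    have "\<sigma> (prod.swap (?b, r)) \<in> M" using M(1) rb br unfolding closed_darts_def by blast
    then have rw: "(r, w) \<in> M" using w by simp
    have "(w, r) \<notin> diamond_arcs t r as bs" using dist by (auto simp: diamond_arcs_def dest!: path_arcs_verts)
    then have "(r, w) \<in> set (path_arcs r as t) \<or> (r, w) \<in> set (path_arcs r bs t)"
      using tight[OF rw] by (simp add: diamond_arcs_def)
    then have "w = ?a \<or> w = ?b"
      using path_arcs_succ[OF dist(1) _ path_arcs_first] path_arcs_succ[OF dist(2) _ path_arcs_first] by blast
    then have "(r, ?a) \<in> M" using rw False by blast
    moreover have "diamond (parcs G) t r bs as" using d by (simp add: diamond_swap[of _ t r bs as])
    ultimately have "oriented t r bs as"
      using oriented_if[of t r bs as M] M tight diamond_arcs_swap[of t r as bs] by simp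
    then show ?thesis by blast
  qed
qed

end

subsection \<open>Drawings with a given embedding\<close>

lemma cyclic_on_enumeration:
  assumes "cyclic_on g S" "x \<in> S"
  obtains N where "0 < N" "(g ^^ N) x = x" "S = (\<lambda>i. (g ^^ i) x) ` {..<N}"
    "\<And>i. i < N \<Longrightarrow> funpow_dist g x ((g ^^ i) x) = i"
proof -
  have orb: "S = orbit g x" using assms by (simp add: orbit_cyclic_eq3)
  then have x: "x \<in> orbit g x" using assms(2) by simp
  let ?N = "funpow_dist1 g x x"
  have inj: "inj_on (\<lambda>i. (g ^^ i) x) {0..<?N}" by (rule inj_on_funpow_dist1[OF x])
  have dist: "funpow_dist g x ((g ^^ i) x) = i" if "i < ?N" for i
    unfolding funpow_dist_def
  proof (rule Least_equality)
    fix j assume j: "(g ^^ j) x = (g ^^ i) x"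
    show "i \<le> j"
    proof (rule ccontr)
      assume "\<not> i \<le> j"
      then have "j = i" using inj_onD[OF inj j] that by simp
      then show False using \<open>\<not> i \<le> j\<close> by simp
    qed
  qed simp
  show thesis
  proof (rule that[of ?N])
    show "(g ^^ ?N) x = x" by (rule funpow_dist1_prop[OF x])
    show "S = (\<lambda>i. (g ^^ i) x) ` {..<?N}"
      unfolding orb using orbit_conv_funpow_dist1[OF x] by (simp add: lessThan_atLeast0)
  qed (use dist in auto)
qed

lemma (in linorder) sorted_key_list_of_set_eqI:
  fixes h :: "'b \<Rightarrow> 'a"
  assumes "sorted_wrt (<) (map h xs)" "set xs = A"
  shows "sorted_key_list_of_set h A = xs"
proof -
  have "distinct (map h xs)" using assms(1) strict_sorted_iff by blast
  then have "distinct xs" "inj_on h A" using assms(2) by (auto simp: distinct_map)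
  interpret folding_insort_key "(\<le>)" "(<)" A h
    by standard (fact \<open>inj_on h A\<close>)
  show ?thesis
    using sorted_key_list_of_set_unique[of A xs] assms \<open>distinct xs\<close> distinct_card[of xs] by auto
qed

lemma (in linorder) sorted_key_list_of_empty_set: "sorted_key_list_of_set h {} = []"
  by (rule sorted_key_list_of_set_eqI) simp_all

locale oriented_outerplanar =
  outerplanar_dag G \<sigma> s f + oriented_dag "pverts G" "parcs G" s R As Bs
  for G :: "'a pair_pre_digraph" and \<sigma> s f R As Bs +
  assumes merge_oriented: "merge t \<Longrightarrow> oriented t (R t) (As t) (Bs t)"
begin

text \<open>
  The clockwise order of the arcs leaving \<open>v\<close> is cut at the left parent of \<open>v\<close>, or at an angle
  of the outer face if \<open>v\<close> is the source.
\<close>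

definition start :: "'a \<Rightarrow> 'a \<times> 'a" where
  "start v = (if v = s then SOME d. d \<in> f \<and> d \<in> darts_at G s else (v, pX v))"

definition order :: "'a \<times> 'a \<Rightarrow> int" where
  "order e = int (funpow_dist \<sigma> (start (fst e)) e)"

lemma start_in: assumes "d \<in> darts_at G v" shows "start v \<in> darts_at G v" "v = s \<Longrightarrow> start v \<in> f"
proof -
  have d: "d \<in> darts G" "fst d = v" using assms by (auto simp: darts_at_def)
  have s: "start v \<in> f \<and> start v \<in> darts_at G v" if "v = s"
    using face_at[OF d(1)] someI_ex[of "\<lambda>d. d \<in> f \<and> d \<in> darts_at G s"] that d(2)
    by (auto simp: start_def)
  show "start v \<in> darts_at G v"
  proof (cases "v = s")
    case False
    then have "(pX v, v) \<in> parcs G" using parents_arcs[of v] dart_vertex[OF d(1)] d(2) by simp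
    then show ?thesis using False by (simp add: start_def darts_at_def darts_iff)
  qed (use s in simp)
  show "v = s \<Longrightarrow> start v \<in> f" using s by simp
qed

lemma enumeration:
  assumes "d \<in> darts_at G v"
  obtains N where "0 < N" "(\<sigma> ^^ N) (start v) = start v"
    "darts_at G v = (\<lambda>i. (\<sigma> ^^ i) (start v)) ` {..<N}"
    "\<And>i. i < N \<Longrightarrow> order ((\<sigma> ^^ i) (start v)) = int i"
proof -
  have cyc: "cyclic_on \<sigma> (darts_at G v)" using rotation(2) assms by blast
  obtain N where N: "0 < N" "(\<sigma> ^^ N) (start v) = start v"
    "darts_at G v = (\<lambda>i. (\<sigma> ^^ i) (start v)) ` {..<N}"
    "\<And>i. i < N \<Longrightarrow> funpow_dist \<sigma> (start v) ((\<sigma> ^^ i) (start v)) = i"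
    by (rule cyclic_on_enumeration[OF cyc start_in(1)[OF assms]]) blast
  have "order ((\<sigma> ^^ i) (start v)) = int i" if "i < N" for i
  proof -
    have "(\<sigma> ^^ i) (start v) \<in> darts_at G v" unfolding N(3) using that by blast
    then have "fst ((\<sigma> ^^ i) (start v)) = v" by (simp add: darts_at_def)
    then show ?thesis using N(4)[OF that] by (simp add: order_def)
  qed
  then show thesis using that N(1-3) by blast
qed

lemma order_inj: "d \<in> darts_at G v \<Longrightarrow> d' \<in> darts_at G v \<Longrightarrow> order d = order d' \<Longrightarrow> d = d'"
  by (rule enumeration[of d v]) auto

text \<open>\<open>order\<close> grows by one with each clockwise step, except across the cut, where
  it falls from its maximum to zero.\<close>

lemma order_step:
  assumes d: "d \<in> darts_at G v"
  shows "\<sigma> d \<noteq> start v \<Longrightarrow> order (\<sigma> d) = order d + 1"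
    "\<sigma> d = start v \<Longrightarrow> d' \<in> darts_at G v \<Longrightarrow> order d' \<le> order d"
    "d \<noteq> start v \<Longrightarrow> 1 \<le> order d"
proof -
  obtain N where N: "0 < N" "(\<sigma> ^^ N) (start v) = start v"
    "darts_at G v = (\<lambda>i. (\<sigma> ^^ i) (start v)) ` {..<N}"
    "\<And>i. i < N \<Longrightarrow> order ((\<sigma> ^^ i) (start v)) = int i"
    by (rule enumeration[OF d]) blast
  obtain i where i: "i < N" "d = (\<sigma> ^^ i) (start v)" using d unfolding N(3) by blast
  have step: "\<sigma> d = (\<sigma> ^^ Suc i) (start v)" using i by simp
  show "order (\<sigma> d) = order d + 1" if "\<sigma> d \<noteq> start v"
  proof -
    have "Suc i \<noteq> N" using that step N(2) by metis
    then have "Suc i < N" using i by simp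
    then show ?thesis using N(4)[of i] N(4)[of "Suc i"] i step by simp
  qed
  show "order d' \<le> order d" if st: "\<sigma> d = start v" and d': "d' \<in> darts_at G v"
  proof -
    have "Suc i = N"
    proof (rule ccontr)
      assume "Suc i \<noteq> N"
      then have "order (\<sigma> d) = int (Suc i)" using N(4)[of "Suc i"] i step by simp
      moreover have "order (start v) = 0" using N(4)[of 0] N(1) by simp
      ultimately show False using st by simp
    qed
    moreover obtain j where "j < N" "d' = (\<sigma> ^^ j) (start v)" using d' unfolding N(3) by blast
    ultimately show ?thesis using N(4)[of j] N(4)[of i] i by simp
  qed
  show "1 \<le> order d" if "d \<noteq> start v"
  proof -
    have "i \<noteq> 0"
    proof
      assume "i = 0"
      then show False using i(2) that by simp
    qed
    then show ?thesis using N(4)[OF i(1)] i(2) by simp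
  qed
qed

lemma out_dart: "(v, w) \<in> parcs G \<Longrightarrow> (v, w) \<in> darts_at G v"
  and in_dart: "(w, v) \<in> parcs G \<Longrightarrow> (v, w) \<in> darts_at G v"
  by (auto simp: darts_at_def darts_iff)

lemma start_not_out: "v \<noteq> s \<Longrightarrow> (v, w) \<in> parcs G \<Longrightarrow> (v, w) \<noteq> start v"
  using parents_arcs[of v] acyclic_antisym[OF acyclic] wellformed'(1)[of v w] by (auto simp: start_def)

lemma inner_start:
  assumes t: "merge t" and xz: "(x, z) \<in> diamond_arcs t (R t) (As t) (Bs t)" and z: "z \<in> set (As t) \<union> set (Bs t)"
  shows "start z = (z, x)"
  using inner_parent[OF t xz z] by (simp add: start_def)

text \<open>Inside the left path, the next arc comes directly before the cut at the parent, hence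
  last; inside the right path it comes directly after the parent, hence first. At the root, the two
  paths are consecutive in the rotation.\<close>

lemma layout_order: "layout (pverts G) (parcs G) s pX pY order R As Bs"
proof (rule layoutI)
  show "v = w" if "(u, v) \<in> parcs G" "(u, w) \<in> parcs G" "order (u, v) = order (u, w)" for u v w
    using order_inj[OF out_dart[OF that(1)] out_dart[OF that(2)] that(3)] by simp
  fix t assume t: "merge t"
  have or: "\<And>e. e \<in> set (path_arcs (R t) (Bs t) t) \<Longrightarrow> e \<notin> f"
    "\<And>x y z. (x, y) \<in> set (path_arcs (R t) (Bs t) t) \<Longrightarrow> (y, z) \<in> set (path_arcs (R t) (Bs t) t) \<Longrightarrow> \<sigma> (y, x) = (y, z)"
    "\<And>x y z. (x, y) \<in> set (path_arcs (R t) (As t) t) \<Longrightarrow> (y, z) \<in> set (path_arcs (R t) (As t) t) \<Longrightarrow> \<sigma> (y, z) = (y, x)"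
    "\<sigma> (R t, hd (As t @ [t])) = (R t, hd (Bs t @ [t]))"
    using merge_oriented[OF t] unfolding oriented_def by blast+
  have arcs: "set (path_arcs (R t) (As t) t) \<subseteq> parcs G" "set (path_arcs (R t) (Bs t) t) \<subseteq> parcs G"
    using merge_dia[OF t] by (auto simp: diamond_def)
  show "order (x, w) \<le> order (x, y)"
    if "(x, y) \<in> set (path_arcs (R t) (As t) t)" "x \<in> set (As t)" "(x, w) \<in> parcs G" for x y w
  proof -
    from path_arcs_pred_ex[OF that(2), of "R t" t]
    obtain p where p: "(p, x) \<in> set (path_arcs (R t) (As t) t)" by blast
    have "start x = (x, p)" using inner_start[OF t, of p x] p that(2) by (simp add: diamond_arcs_def)
    then have "\<sigma> (x, y) = start x" using or(3)[OF p that(1)] by simp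
    then show ?thesis
      using order_step(2)[OF out_dart[of x y] _ out_dart[OF that(3)]] that(1) arcs by blast
  qed
  show "order (x, y) \<le> order (x, w)"
    if "(x, y) \<in> set (path_arcs (R t) (Bs t) t)" "x \<in> set (Bs t)" "(x, w) \<in> parcs G" for x y w
  proof -
    from path_arcs_pred_ex[OF that(2), of "R t" t]
    obtain p where p: "(p, x) \<in> set (path_arcs (R t) (Bs t) t)" by blast
    have st: "start x = (x, p)" using inner_start[OF t, of p x] p that(2) by (simp add: diamond_arcs_def)
    have px: "(p, x) \<in> parcs G" using p arcs by blast
    then have "x \<noteq> s" using source[OF s_in] by auto
    have xy: "(x, y) \<in> parcs G" using that(1) arcs by blast
    have "\<sigma> (x, p) = (x, y)" using or(2)[OF p that(1)] .
    then have "order (x, y) = order (x, p) + 1"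
      using order_step(1)[OF in_dart[OF px]] start_not_out[OF \<open>x \<noteq> s\<close> xy] by simp
    moreover have "order (x, p) = 0"
      using st by (simp add: order_def funpow_dist_0)
    moreover have "1 \<le> order (x, w)"
      using order_step(3)[OF out_dart[OF that(3)]] start_not_out[OF \<open>x \<noteq> s\<close> that(3)] by simp
    ultimately show ?thesis by simp
  qed
  have ra: "(R t, hd (As t @ [t])) \<in> parcs G" and rb: "(R t, hd (Bs t @ [t])) \<in> parcs G"
    using arcs path_arcs_first[of "R t" "As t" t] path_arcs_first[of "R t" "Bs t" t] by auto
  \<comment> \<open>The cut must not fall between the two paths. At the source it is in an angle of
    \<open>f\<close>, whereas the angle between the paths belongs to the inner face.\<close>
  have "(R t, hd (Bs t @ [t])) \<noteq> start (R t)"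
  proof (cases "R t = s")
    case True
    then have "start (R t) \<in> f" using start_in(2)[OF out_dart[OF rb]] by simp
    moreover have "(R t, hd (Bs t @ [t])) \<notin> f" by (rule or(1)[OF path_arcs_first])
    ultimately show ?thesis by auto
  qed (rule start_not_out[OF _ rb])
  then have next_order: "order (R t, hd (Bs t @ [t])) = order (R t, hd (As t @ [t])) + 1"
    using order_step(1)[OF out_dart[OF ra]] or(4) by simp
  then show "order (R t, hd (As t @ [t])) < order (R t, hd (Bs t @ [t]))" by simp
  show "order (R t, w) \<le> order (R t, hd (As t @ [t])) \<or> order (R t, hd (Bs t @ [t])) \<le> order (R t, w)"
    if "(R t, w) \<in> parcs G" for w using next_order by linarith
qed

interpretation L: layout "pverts G" "parcs G" s pX pY order R As Bs
  by (rule layout_order)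

text \<open>The face to the left of a right path is the inner face of its cycle, so no arc of
  \<open>f\<close> lies on a right path.\<close>

lemma place_outer: "maintains_outer_face G L.place f"
proof (rule L.place_outer_face[OF refl refl])
  fix e assume e: "e \<in> parcs G \<inter> f"
  show "\<not> L.right_arc e"
  proof
    assume "L.right_arc e"
    then obtain t where "pX t \<noteq> pY t" and *: "snd e = t \<and> fst e = pY t \<or> snd e \<in> set (Bs t)"
      unfolding L.right_arc_def by blast
    then have t: "merge t" by (simp add: merge_iff)
    from * have "e \<in> set (path_arcs (R t) (Bs t) t)"
    proof
      assume "snd e = t \<and> fst e = pY t"
      then have "e = (last (R t # Bs t), t)" using t by (auto simp: pY_def prod_eq_iff)
      then show ?thesis using path_arcs_last[of "R t" "Bs t" t] by simp
    next
      assume inner: "snd e \<in> set (Bs t)"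
      obtain p where p: "(p, snd e) \<in> set (path_arcs (R t) (Bs t) t)"
        using path_arcs_pred_ex[OF inner, of "R t" t] by blast
      then have "(p, snd e) \<in> parcs G" using merge_dia[OF t] by (auto simp: diamond_def)
      then have "fst e = p"
        using in_neighbour_inner[OF merge_dia[OF t], of "snd e" p "fst e"] inner e by simp
      then show ?thesis using p by (cases e) simp
    qed
    then show False using merge_oriented[OF t] e unfolding oriented_def by blast
  qed
qed

text \<open>Clockwise from the lower left of a vertex other than the source, the drawing has the
  outgoing arcs by \<open>order\<close>, then the right parent if it is a different one, and last
  the left parent, where the rotation was cut. So the drawn list is the rotation from
  \<open>start v\<close>, shifted by one. The source has no parents and no shift.\<close>

lemma place_rotation: "maintains_rotation G L.place \<sigma>"
  unfolding maintains_rotation_def Let_def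
proof (intro ballI allI impI)
  fix v i assume v: "v \<in> pverts G" and i: "i < length (clockwise_neighbours G L.place v)"
  let ?Out = "{w. (v, w) \<in> parcs G}" and ?In = "{u. (u, v) \<in> parcs G}"
  have fin: "finite ?Out" "finite ?In"
    using finite_subset[of ?Out "pverts G"] finite_subset[of ?In "pverts G"] wellformed' pair_finite_verts by auto
  show "\<sigma> (v, clockwise_neighbours G L.place v ! i) =
    (v, clockwise_neighbours G L.place v ! (Suc i mod length (clockwise_neighbours G L.place v)))"
  proof (cases "darts_at G v = {}")
    case True
    then have "?Out = {}" "?In = {}" using out_dart[of v] in_dart[of _ v] by blast+
    then show ?thesis using i by (simp add: clockwise_neighbours_def sorted_key_list_of_empty_set)
  next
    case False
    then obtain d where d: "d \<in> darts_at G v" by blast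
    obtain N where N: "0 < N" "(\<sigma> ^^ N) (start v) = start v"
      "darts_at G v = (\<lambda>i. (\<sigma> ^^ i) (start v)) ` {..<N}"
      "\<And>i. i < N \<Longrightarrow> order ((\<sigma> ^^ i) (start v)) = int i"
      by (rule enumeration[OF d]) blast
    define nb where "nb j = snd ((\<sigma> ^^ j) (start v))" for j
    have nb: "(v, nb j) = (\<sigma> ^^ j) (start v)" "(v, nb j) \<in> darts_at G v" if "j < N" for j
    proof -
      show *: "(v, nb j) = (\<sigma> ^^ j) (start v)"
      proof -
        have "(\<sigma> ^^ j) (start v) \<in> darts_at G v" unfolding N(3) using that by blast
        then show ?thesis by (simp add: nb_def darts_at_def prod_eq_iff)
      qed
      show "(v, nb j) \<in> darts_at G v" unfolding * N(3) using that by blast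
    qed
    have ord: "order (v, nb j) = int j" if "j < N" for j
      using N(4)[OF that] nb(1)[OF that] by simp
    have index: "\<exists>j < N. w = nb j" if vw: "(v, w) \<in> darts_at G v" for w
    proof -
      obtain j where "j < N" "(v, w) = (\<sigma> ^^ j) (start v)" using vw unfolding N(3) by blast
      then have "j < N" "w = nb j" by (simp, metis nb_def snd_conv)
      then show ?thesis by blast
    qed
    have next_nb: "\<sigma> (v, nb j) = (v, nb (Suc j mod N))" if "j < N" for j
    proof (cases "Suc j = N")
      case True
      have "\<sigma> (v, nb j) = (\<sigma> ^^ Suc j) (start v)" using nb(1)[OF that] by simp
      then show ?thesis using True N(1,2) nb(1)[of 0] by simp
    next
      case False
      then show ?thesis using nb(1)[OF that] nb(1)[of "Suc j"] that by simp
    qed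
    have sorted: "sorted_wrt (<) (map (snd \<circ> L.place) (map nb [l..<h]))"
      if "h \<le> N" "\<And>j. l \<le> j \<Longrightarrow> j < h \<Longrightarrow> (v, nb j) \<in> parcs G" for l h
    proof -
      have "snd (L.place (nb j)) < snd (L.place (nb k))" if jk: "l \<le> j" "j < k" "k < h" for j k
        using L.place_out_order[of v "nb j" "nb k"] that \<open>h \<le> N\<close> ord[of j] ord[of k]
          \<open>\<And>j. l \<le> j \<Longrightarrow> j < h \<Longrightarrow> (v, nb j) \<in> parcs G\<close>[of j]
          \<open>\<And>j. l \<le> j \<Longrightarrow> j < h \<Longrightarrow> (v, nb j) \<in> parcs G\<close>[of k] by simp
      then show ?thesis by (simp add: sorted_wrt_iff_nth_less)
    qed
    \<comment> \<open>The shift between the rotation, which starts at \<open>nb 0\<close>, and the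
      drawn list, which ends with \<open>nb 0\<close> unless \<open>v\<close> is the source.\<close>
    define l where "l = (if v = s then 0 else 1 :: nat)"
    have "clockwise_neighbours G L.place v = map (\<lambda>j. nb ((l + j) mod N)) [0..<N]"
    proof (cases "v = s")
      case True
      have In: "?In = {}" using source[OF s_in] True by blast
      have out: "(v, nb j) \<in> parcs G" if "j < N" for j
        using nb(2)[OF that] In by (auto simp: darts_at_def darts_iff)
      have "set (map nb [0..<N]) = ?Out"
      proof (intro set_eqI iffI)
        fix w assume "w \<in> ?Out"
        then show "w \<in> set (map nb [0..<N])" using index[of w] out_dart[of v w] by auto
      qed (use out in auto)
      then have "sorted_key_list_of_set (snd \<circ> L.place) ?Out = map nb [0..<N]"
        using sorted[of N 0] out by (intro sorted_key_list_of_set_eqI) auto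
      then show ?thesis using In True by (simp add: clockwise_neighbours_def l_def sorted_key_list_of_empty_set)
    next
      case False
      have pX: "(pX v, v) \<in> parcs G" "(pY v, v) \<in> parcs G" using parents_arcs[of v] v False by auto
      have nb0: "nb 0 = pX v" using False by (simp add: nb_def start_def)
      \<comment> \<open>The index of the right parent if there are two parents; otherwise
        \<open>N\<close>, so that \<open>[h..<N]\<close> is empty.\<close>
      define h where "h = (if merge v then N - 1 else N)"
      have last: "h < N \<and> pY v = nb h \<and> 0 < h" if "merge v"
      proof -
        \<comment> \<open>At a sink, the angle between the two parents belongs to the inner face, so
          the right parent is the last dart before the cut.\<close>
        have "\<sigma> (v, pY v) = (v, pX v)"
          using merge_oriented[OF that] that unfolding oriented_def by (simp add: pX_def pY_def)
        then have "order (v, nb (N - 1)) \<le> order (v, pY v)"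
          using order_step(2)[OF in_dart[OF pX(2)]] nb(2)[of "N - 1"] N(1) False by (simp add: start_def)
        moreover obtain k where k: "k < N" "pY v = nb k" using index in_dart[OF pX(2)] by blast
        ultimately have "k = N - 1" using ord[of k] ord[of "N - 1"] N(1) by simp
        moreover have "k \<noteq> 0" using k nb0 that merge_iff by metis
        ultimately show ?thesis using k that by (simp add: h_def)
      qed
      have In: "?In = {pX v, pY v}" using pX arc_from_parent by auto
      have hN: "h \<le> N" by (simp add: h_def)
      have out: "(v, nb j) \<in> parcs G" if j: "1 \<le> j" "j < h" for j
      proof -
        have jN: "j < N" using j hN by simp
        have "nb j \<noteq> pX v"
        proof
          assume "nb j = pX v"
          then have "int j = 0" using ord[OF jN] ord[of 0] N(1) nb0 by simp
          then show False using j by simp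
        qed
        moreover have "nb j \<noteq> pY v"
        proof
          assume *: "nb j = pY v"
          then have m: "merge v" using \<open>nb j \<noteq> pX v\<close> merge_iff by metis
          then have "nb j = nb h" "h < N" using * last by simp_all
          then have "int j = int h" using ord[OF jN] ord[of h] by metis
          then show False using j by simp
        qed
        ultimately have "(nb j, v) \<notin> parcs G" using arc_from_parent by blast
        then show ?thesis using nb(2)[OF jN] by (simp add: darts_at_def darts_iff)
      qed
      have "set (map nb [1..<h]) = ?Out"
      proof (intro set_eqI iffI)
        fix w assume "w \<in> ?Out"
        then have vw: "(v, w) \<in> parcs G" by simp
        then obtain j where j: "j < N" "w = nb j" using index[OF out_dart] by blast
        have "(w, v) \<notin> parcs G" by (rule acyclic_antisym[OF acyclic vw])
        then have "w \<noteq> pX v" "w \<noteq> pY v" using pX by auto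
        then have "j \<noteq> 0" "merge v \<Longrightarrow> j \<noteq> h" using j(2) nb0 last by metis+
        then have "1 \<le> j" "j < h" using j by (auto simp: h_def)
        then show "w \<in> set (map nb [1..<h])" using j by auto
      qed (use out in auto)
      then have O: "sorted_key_list_of_set (snd \<circ> L.place) ?Out = map nb [1..<h]"
        using sorted[of h 1] out hN by (intro sorted_key_list_of_set_eqI) auto
      have I: "rev (sorted_key_list_of_set (fst \<circ> L.place) ?In) = map nb [h..<N] @ [nb 0]"
      proof (cases "merge v")
        case True
        have "fst (L.place (pX v)) < fst (L.place (pY v))"
          using L.place_in_order[of v] v False True merge_iff by simp
        then have "sorted_key_list_of_set (fst \<circ> L.place) ?In = [pX v, pY v]"
          unfolding In by (intro sorted_key_list_of_set_eqI) auto
        moreover have "[h..<N] = [h]" using True N(1) by (simp add: h_def upt_rec)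
        ultimately show ?thesis using last[OF True] nb0 by simp
      next
        case m: False
        have "pY v = pX v" using m merge_iff by simp
        then have "sorted_key_list_of_set (fst \<circ> L.place) ?In = [pX v]"
          unfolding In by (intro sorted_key_list_of_set_eqI) auto
        then show ?thesis using m nb0 by (simp add: h_def)
      qed
      have "1 \<le> h" using last N(1) by (cases "merge v") (auto simp: h_def)
      then have "map nb [1..<h] @ map nb [h..<N] = map nb [1..<N]"
        using hN upt_add_eq_append[of 1 h "N - h"] by (simp flip: map_append)
      then have "clockwise_neighbours G L.place v = map nb [1..<N] @ [nb 0]"
        using O I by (simp add: clockwise_neighbours_def)
      also have "\<dots> = map (\<lambda>j. nb ((l + j) mod N)) [0..<N]"
      proof (rule nth_equalityI)
        show "length (map nb [1..<N] @ [nb 0]) = length (map (\<lambda>j. nb ((l + j) mod N)) [0..<N])"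
          using N(1) by simp
        fix k assume "k < length (map nb [1..<N] @ [nb 0])"
        then have k: "k < N" using N(1) by simp
        show "(map nb [1..<N] @ [nb 0]) ! k = map (\<lambda>j. nb ((l + j) mod N)) [0..<N] ! k"
        proof (cases "Suc k = N")
          case True
          then show ?thesis using False by (auto simp: nth_append l_def)
        next
          case Sk: False
          then show ?thesis using k False by (auto simp: nth_append l_def)
        qed
      qed
      finally show ?thesis .
    qed
    moreover from this have "i < N" using i by simp
    moreover have "\<sigma> (v, nb ((l + i) mod N)) = (v, nb ((l + Suc i mod N) mod N))"
      using next_nb[of "(l + i) mod N"] N(1) by (simp add: mod_simps)
    ultimately show ?thesis using N(1) by simp
  qed
qed

lemma embedded_drawing_exists:
  "\<exists>p. upward_leftward_outerplanar_L_drawing G p \<and> maintains_embedding G p \<sigma> f"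
  using L.place_drawing[OF refl refl] place_outer place_rotation
  by (auto simp: maintains_embedding_def)

end

section \<open>Cactuses with a single source\<close>

lemma cactus_source:
  assumes "pair_digraph G" "acyclic (parcs G)" "cactus G" "single_source G"
  obtains s where "merging_dag (pverts G) (parcs G) s"
proof -
  obtain s where "s \<in> pverts G" "\<And>v. v \<in> pverts G \<Longrightarrow> in_degree (with_proj G) v = 0 \<longleftrightarrow> v = s"
    using assms(4) unfolding single_source_def by blast
  then show thesis using that cactus_merging_dag[OF assms(1-3)] by blast
qed

lemma single_source_drawing:
  assumes "pair_digraph G" "acyclic (parcs G)" "cactus G" "single_source G"
  shows "\<exists>p. upward_leftward_outerplanar_L_drawing G p"
proof -
  obtain s where s: "merging_dag (pverts G) (parcs G) s" by (rule cactus_source[OF assms])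
  from merging_dag.orientation_exists[OF s]
  obtain R As Bs where or: "oriented_dag (pverts G) (parcs G) s R As Bs" by (elim exE)
  from oriented_dag.layout_exists[OF or]
  obtain rk where "layout (pverts G) (parcs G) s (oriented_dag.pX (parcs G) R As)
      (oriented_dag.pY (parcs G) R Bs) rk R As Bs" by (elim exE)
  from layout.place_drawing[OF this refl refl] show ?thesis by blast
qed

lemma single_source_embedding:
  assumes G: "pair_digraph G" "acyclic (parcs G)" "cactus G" "single_source G"
    and trans: "\<nexists>e. transitive_arc G e" and emb: "outerplanar_embedding G \<sigma> f"
  shows "\<exists>p. upward_leftward_outerplanar_L_drawing G p \<and> maintains_embedding G p \<sigma> f"
\<comment> \<open>\<open>planar_rotation\<close> assumes an arc; without arcs nothing has to be
  maintained.\<close>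
proof (cases "parcs G = {}")
  case True
  obtain p where p: "upward_leftward_outerplanar_L_drawing G p"
    using single_source_drawing[OF G] by blast
  have "clockwise_neighbours G p v = []" for v
    using True by (simp add: clockwise_neighbours_def sorted_key_list_of_empty_set)
  then have "maintains_embedding G p \<sigma> f"
    using True by (simp add: maintains_embedding_def maintains_rotation_def maintains_outer_face_def)
  then show ?thesis using p by blast
next
  case False
  obtain s where "merging_dag (pverts G) (parcs G) s" by (rule cactus_source[OF G])
  then interpret merging_dag "pverts G" "parcs G" s .
  interpret planar_rotation G \<sigma>
    by (rule planar_rotation.intro[OF G(1,2)])
      (use G(3) False emb in \<open>simp_all add: cactus_def outerplanar_embedding_def\<close>)
  interpret outerplanar_dag G \<sigma> s f
    using emb by unfold_locales (auto simp: outerplanar_embedding_def)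
  \<comment> \<open>The rotation dictates which path is the left one. Without transitive arcs,
    either path has an inner vertex, as \<open>oriented_dag\<close> requires of the left
    one.\<close>
  have left: "as \<noteq> []" if "diamond (parcs G) t r as bs" for t r as bs
  proof
    assume "as = []"
    then have "transitive_arc G (r, t)"
      unfolding transitive_arc_iff[OF G(1)] using that by (intro conjI exI[of _ bs]) (auto simp: diamond_def)
    then show False using trans by blast
  qed
  have "\<exists>x. \<forall>u w. (u, t) \<in> parcs G \<longrightarrow> (w, t) \<in> parcs G \<longrightarrow> u \<noteq> w \<longrightarrow>
    oriented t (fst x) (fst (snd x)) (snd (snd x))" for t
  proof (cases "\<exists>u w. (u, t) \<in> parcs G \<and> (w, t) \<in> parcs G \<and> u \<noteq> w")
    case True
    then obtain u w where "(u, t) \<in> parcs G" "(w, t) \<in> parcs G" "u \<noteq> w" by blast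
    then obtain r as bs where "diamond (parcs G) t r as bs" by (rule diamond_exists)
    then have "oriented t r as bs \<or> oriented t r bs as" by (rule oriented_exists)
    then show ?thesis
    proof
      assume "oriented t r as bs"
      then show ?thesis by (intro exI[of _ "(r, as, bs)"]) simp
    next
      assume "oriented t r bs as"
      then show ?thesis by (intro exI[of _ "(r, bs, as)"]) simp
    qed
  qed blast
  then have "\<forall>t. \<exists>x. \<forall>u w. (u, t) \<in> parcs G \<longrightarrow> (w, t) \<in> parcs G \<longrightarrow> u \<noteq> w \<longrightarrow>
    oriented t (fst x) (fst (snd x)) (snd (snd x))" ..
  from choice[OF this] obtain c where c: "\<And>t u w. (u, t) \<in> parcs G \<Longrightarrow> (w, t) \<in> parcs G \<Longrightarrow> u \<noteq> w \<Longrightarrow>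
    oriented t (fst (c t)) (fst (snd (c t))) (snd (snd (c t)))" by blast
  interpret O: oriented_dag "pverts G" "parcs G" s "\<lambda>t. fst (c t)" "\<lambda>t. fst (snd (c t))" "\<lambda>t. snd (snd (c t))"
  proof
    fix u t w assume "(u, t) \<in> parcs G" "(w, t) \<in> parcs G" "u \<noteq> w"
    then have "diamond (parcs G) t (fst (c t)) (fst (snd (c t))) (snd (snd (c t)))"
      using c unfolding oriented_def by blast
    then show "diamond (parcs G) t (fst (c t)) (fst (snd (c t))) (snd (snd (c t))) \<and> fst (snd (c t)) \<noteq> []"
      using left by blast
  qed
  interpret oriented_outerplanar G \<sigma> s f "\<lambda>t. fst (c t)" "\<lambda>t. fst (snd (c t))" "\<lambda>t. snd (snd (c t))"
  proof
    fix t assume "O.merge t"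
    then show "oriented t (fst (c t)) (fst (snd (c t))) (snd (snd (c t)))"
      unfolding O.merge_def using c by blast
  qed
  show ?thesis by (rule embedded_drawing_exists)
qed

subsection \<open>Reversal\<close>

definition reversed :: "'a pair_pre_digraph \<Rightarrow> 'a pair_pre_digraph" where
  "reversed G = \<lparr> pverts = pverts G, parcs = (parcs G)\<inverse> \<rparr>"

lemma reversed_simps [simp]: "pverts (reversed G) = pverts G" "parcs (reversed G) = (parcs G)\<inverse>"
  by (simp_all add: reversed_def)

lemma reversed_digraph: assumes "pair_digraph G" shows "pair_digraph (reversed G)"
proof -
  interpret pair_digraph G by fact
  show ?thesis
    by unfold_locales (auto simp: pair_finite_verts pair_finite_arcs dest: wellformed' no_loops')
qed

lemma mk_symmetric_reversed: "mk_symmetric (with_proj (reversed G)) = mk_symmetric (with_proj G)"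
proof -
  have "(x, y) \<in> darts (reversed G) \<longleftrightarrow> (x, y) \<in> darts G" for x y by (auto simp: darts_iff)
  then have "darts (reversed G) = darts G" by auto
  then show ?thesis by (simp add: darts_def mk_symmetric_def)
qed

lemma darts_reversed [simp]: "darts (reversed G) = darts G" "darts_at (reversed G) v = darts_at G v"
  by (simp_all add: darts_def darts_at_def mk_symmetric_reversed)

lemma undirected_cycle_reversed: "undirected_cycle (reversed G) = undirected_cycle G"
  by (simp add: undirected_cycle_def fun_eq_iff mk_symmetric_reversed)

lemma connected_reversed: "Digraph_Component.connected (with_proj (reversed G)) \<longleftrightarrow> Digraph_Component.connected (with_proj G)"
  by (simp add: connected_def mk_symmetric_reversed)

lemma cactus_reversed: assumes "cactus G" shows "cactus (reversed G)"
  unfolding cactus_def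
proof (intro conjI ballI)
  show "Digraph_Component.connected (with_proj (reversed G))"
    using assms by (simp add: connected_reversed cactus_def)
  fix e assume "e \<in> parcs (reversed G)"
  then obtain u v where e: "e = (u, v)" "(v, u) \<in> parcs G" by (cases e) auto
  then have "undirected_cycle G C \<and> undirected_cycle G D \<and> {v, u} \<in> C \<and> {v, u} \<in> D \<longrightarrow> C = D" for C D
    using assms unfolding cactus_def by blast
  then show "case e of (u, v) \<Rightarrow> \<forall>C D. undirected_cycle (reversed G) C \<and> undirected_cycle (reversed G) D \<and>
      {u, v} \<in> C \<and> {u, v} \<in> D \<longrightarrow> C = D"
    by (simp add: e undirected_cycle_reversed insert_commute)
qed

lemma single_source_reversed: assumes "single_sink G" shows "single_source (reversed G)"
proof -
  have "in_degree (with_proj (reversed G)) v = out_degree (with_proj G) v" for v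
  proof -
    have "in_arcs (with_proj (reversed G)) v = prod.swap ` out_arcs (with_proj G) v"
    proof (intro set_eqI)
      fix e show "e \<in> in_arcs (with_proj (reversed G)) v \<longleftrightarrow> e \<in> prod.swap ` out_arcs (with_proj G) v"
        by (cases e) (auto simp: in_arcs_def out_arcs_def intro: rev_image_eqI)
    qed
    moreover have "inj_on prod.swap (out_arcs (with_proj G) v)" by (rule inj_onI) (simp add: prod_eq_iff)
    ultimately show ?thesis by (simp add: in_degree_def out_degree_def card_image)
  qed
  then show ?thesis using assms by (simp add: single_source_def single_sink_def)
qed

lemma transitive_arc_reversed:
  assumes "pair_digraph G" "transitive_arc (reversed G) e"
  shows "\<exists>e. transitive_arc G e"
proof -
  obtain u v where e: "e = (u, v)" by fastforce
  obtain xs where xs: "(v, u) \<in> parcs G" "xs \<noteq> []" "set (path_arcs u xs v) \<subseteq> (parcs G)\<inverse>" "distinct (u # xs @ [v])"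
    using assms(2) unfolding e transitive_arc_iff[OF reversed_digraph[OF assms(1)]] by auto
  have "set (path_arcs v (rev xs) u) \<subseteq> parcs G"
    unfolding path_arcs_rev using xs(3) by auto
  then have "transitive_arc G (v, u)"
    unfolding transitive_arc_iff[OF assms(1)] using xs by (intro conjI exI[of _ "rev xs"]) auto
  then show ?thesis by blast
qed

section \<open>Reversal of an outerplanar embedding\<close>

lemma swap_swap_image: "prod.swap ` prod.swap ` S = S"
  by (simp add: image_image)

text \<open>Reflection makes clockwise counterclockwise, so the rotation is inverted. A face walk
  run backwards, with its darts reversed, is a face walk of the inverse rotation.\<close>

lemma outerplanar_embedding_reversed:
  assumes "pair_digraph G" "acyclic (parcs G)" "Digraph_Component.connected (with_proj G)" "parcs G \<noteq> {}"
    and emb: "outerplanar_embedding G \<sigma> f"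
  shows "outerplanar_embedding (reversed G) (inv \<sigma>) (prod.swap ` f)"
proof -
  interpret planar_rotation G \<sigma>
    by (rule planar_rotation.intro[OF assms(1-3)])
      (use assms(4) emb in \<open>simp_all add: outerplanar_embedding_def\<close>)
  let ?g = "perm_restrict next_dart (darts G)"
  have perm: "permutation \<sigma>" "permutation ?g"
    using rotation(1) next_dart_permutes finite_darts permutation_permutes by blast+
  have inv_\<sigma>: "\<sigma> (inv \<sigma> d) = d" "inv \<sigma> (\<sigma> d) = d" for d
    using permutes_inverses[OF rotation(1)] by simp_all
  have inv_in: "inv \<sigma> d \<in> darts G" if "d \<in> darts G" for d
    using permutes_in_image[OF permutes_inv[OF rotation(1)]] that by simp
  have inv_g: "inv ?g d = prod.swap (inv \<sigma> d)" if d: "d \<in> darts G" for d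
  proof -
    have "?g (prod.swap (inv \<sigma> d)) = d"
      using swap_dart[OF inv_in[OF d]] inv_\<sigma>(1) by (simp add: perm_restrict_def)
    then show ?thesis using permutes_inverses(2)[OF next_dart_permutes] by metis
  qed
  \<comment> \<open>Conjugation with the reversal of darts turns the inverse of the old face
    traversal into the new one.\<close>
  have face: "orbit (inv \<sigma> \<circ> prod.swap) (prod.swap d) = prod.swap ` orbit next_dart d" if d: "d \<in> darts G" for d
  proof -
    have "orbit ?g d = orbit next_dart d"
      by (rule orbit_cong0[of d "darts G"])
        (use d permutes_in_image[OF next_dart_permutes] in \<open>auto simp: perm_restrict_simps\<close>)
    then have orb: "orbit (inv ?g) d = orbit next_dart d" using orbit_inv_eq[OF perm(2)] by simp
    have "d \<in> orbit (inv ?g) d" unfolding orb by (rule face_cyclic(3)[OF d])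
    then have "prod.swap ` orbit (inv ?g) d = orbit (inv \<sigma> \<circ> prod.swap) (prod.swap d)"
    proof (rule orbit_inverse)
      fix x assume "x \<in> orbit (inv ?g) d"
      then have "x \<in> darts G" using orb face_cyclic(2)[OF d] by blast
      then show "(inv \<sigma> \<circ> prod.swap) (prod.swap x) = prod.swap (inv ?g x)" by (simp add: inv_g)
    qed
    then show ?thesis using orb by simp
  qed
  have nonempty: "darts G \<noteq> {}" using faces_eq emb unfolding outerplanar_embedding_def by force
  have swap_darts: "prod.swap ` darts G = darts G"
  proof
    show "prod.swap ` darts G \<subseteq> darts G" using swap_dart by blast
    show "darts G \<subseteq> prod.swap ` darts G" using swap_dart by (metis image_eqI subsetI swap_swap)
  qed
  have faces: "faces (reversed G) (inv \<sigma>) = (`) prod.swap ` faces G \<sigma>"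
  proof -
    have "faces (reversed G) (inv \<sigma>) = orbit (inv \<sigma> \<circ> prod.swap) ` (prod.swap ` darts G)"
      using nonempty by (simp add: faces_def swap_darts)
    also have "\<dots> = (`) prod.swap ` (orbit next_dart ` darts G)"
      using face by (simp add: image_image)
    finally show ?thesis using faces_eq by simp
  qed
  have inj: "inj ((`) (prod.swap :: 'a \<times> 'a \<Rightarrow> 'a \<times> 'a))"
    by (rule inj_on_inverseI[of _ "(`) prod.swap"]) (rule swap_swap_image)
  have card: "card (faces (reversed G) (inv \<sigma>)) = card (faces G \<sigma>)"
    unfolding faces by (rule card_image[OF inj_on_subset[OF inj subset_UNIV]])
  have "rotation_system (reversed G) (inv \<sigma>)"
    unfolding rotation_system_def
  proof (intro conjI ballI impI)
    show "inv \<sigma> permutes darts (reversed G)" using permutes_inv[OF rotation(1)] by simp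
    fix v assume "darts_at (reversed G) v \<noteq> {}"
    then have "cyclic_on \<sigma> (darts_at G v)" using rotation(2) by simp
    then show "cyclic_on (inv \<sigma>) (darts_at (reversed G) v)"
      by (simp add: cyclic_on_def orbit_inv_eq[OF perm(1)])
  qed
  then have "planar_rotation_system (reversed G) (inv \<sigma>)"
    using planar card by (simp add: planar_rotation_system_def)
  moreover have "prod.swap ` f \<in> faces (reversed G) (inv \<sigma>)"
    using emb unfolding faces outerplanar_embedding_def by blast
  moreover have "on_face (reversed G) v (prod.swap ` f)" if v: "v \<in> pverts G" for v
  proof (cases "darts_at G v = {}")
    case False
    have f: "f \<in> faces G \<sigma>" and "on_face G v f" using emb v by (auto simp: outerplanar_embedding_def)
    then obtain d where d: "d \<in> darts_at G v" "d \<in> f" using False unfolding on_face_def by blast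
    have closed: "closed_darts f" using closed_Union_faces[of "{f}"] f by simp
    have cyc: "cyclic_on \<sigma> (darts_at G v)" using rotation(2)[OF False] .
    then have at: "inv \<sigma> d \<in> darts_at G v"
      using cyclic_on_f_in[OF rotation(1) cyc, of "inv \<sigma> d"] d(1) inv_\<sigma>(1) by simp
    then have "inv \<sigma> d \<in> darts G" by (simp add: darts_at_def)
    \<comment> \<open>This dart precedes \<open>d\<close> on the face walk and arrives at
      \<open>v\<close>; its reverse is the dart at \<open>v\<close> on the reflected face.\<close>
    then have "prod.swap (inv \<sigma> d) \<in> f"
      using closed_rotate[OF closed, of "inv \<sigma> d"] d(2) inv_\<sigma>(1) by simp
    then have "inv \<sigma> d \<in> prod.swap ` f" by (rule rev_image_eqI) simp
    then show ?thesis using at by (auto simp: on_face_def)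
  qed (simp add: on_face_def)
  ultimately show ?thesis by (simp add: outerplanar_embedding_def)
qed

section \<open>Reflection of drawings at the diagonal\<close>

lemma linear_swap: "linear (prod.swap :: real \<times> real \<Rightarrow> real \<times> real)"
  by (rule linearI) (auto simp: prod_eq_iff)

lemma outside_swap:
  fixes S :: "(real \<times> real) set"
  shows "outside (prod.swap ` S) = prod.swap ` outside S"
proof -
  have sub: "prod.swap ` outside S \<subseteq> outside (prod.swap ` S)" for S :: "(real \<times> real) set"
  proof
    fix y assume "y \<in> prod.swap ` outside S"
    then obtain x where x: "x \<in> outside S" "y = prod.swap x" by blast
    let ?C = "connected_component_set (- S) x"
    have "x \<notin> S" "\<not> bounded ?C" using x(1) by (auto simp: outside_def)
    have "prod.swap ` ?C \<subseteq> connected_component_set (- prod.swap ` S) y"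
    proof (rule connected_component_maximal)
      show "y \<in> prod.swap ` ?C" using x(2) \<open>x \<notin> S\<close> by simp
      show "topological_space_class.connected (prod.swap ` ?C)"
        by (intro connected_continuous_image linear_continuous_on connected_connected_component
            linear_conv_bounded_linear[THEN iffD1] linear_swap)
      have "?C \<subseteq> - S" by (rule connected_component_subset)
      then show "prod.swap ` ?C \<subseteq> - prod.swap ` S" by auto
    qed
    moreover have "\<not> bounded (prod.swap ` ?C)"
    proof
      assume "bounded (prod.swap ` ?C)"
      then have "bounded (prod.swap ` prod.swap ` ?C)"
        by (rule bounded_linear_image[OF _ linear_conv_bounded_linear[THEN iffD1, OF linear_swap]])
      then show False using \<open>\<not> bounded ?C\<close> by (simp add: swap_swap_image)
    qed
    moreover have "y \<notin> prod.swap ` S" using x(2) \<open>x \<notin> S\<close> by (cases x) auto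
    ultimately show "y \<in> outside (prod.swap ` S)"
      using bounded_subset[of "connected_component_set (- prod.swap ` S) y"] by (auto simp: outside_def)
  qed
  have "prod.swap ` outside (prod.swap ` S) \<subseteq> outside S" using sub[of "prod.swap ` S"] by (simp add: swap_swap_image)
  then have "outside (prod.swap ` S) \<subseteq> prod.swap ` outside S"
    using image_mono[of "prod.swap ` outside (prod.swap ` S)" "outside S" prod.swap] by (simp add: swap_swap_image)
  then show ?thesis using sub by blast
qed

lemma frontier_swap:
  fixes S :: "(real \<times> real) set"
  shows "frontier (prod.swap ` S) = prod.swap ` frontier S"
proof -
  have inj: "inj (prod.swap :: real \<times> real \<Rightarrow> real \<times> real)" by (rule injI) (simp add: prod_eq_iff)
  show ?thesis
    unfolding frontier_def closure_injective_linear_image[OF linear_swap inj, symmetric]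
      interior_injective_linear_image[OF linear_swap inj] by (simp add: image_set_diff[OF inj])
qed

context
  fixes G :: "'a pair_pre_digraph" and p :: "'a \<Rightarrow> real \<times> real"
begin

abbreviation mirrored :: "'a \<Rightarrow> real \<times> real" where
  "mirrored v \<equiv> prod.swap (p v)"

text \<open>The reflection exchanges vertical and horizontal segments, and the reversal exchanges
  tail and head, so a reflected L-shape is the L-shape of the reversed arc.\<close>

lemma bend_mirrored: "bend mirrored e = prod.swap (bend p (prod.swap e))"
  by (simp add: bend_def)

lemma drawing_mirrored: "drawing G mirrored = prod.swap ` drawing (reversed G) p"
proof -
  have "edge_curve mirrored e = prod.swap ` edge_curve p (prod.swap e)" for e
    unfolding edge_curve_def bend_mirrored closed_segment_linear_image[OF linear_swap] image_Un
    by (simp add: closed_segment_commute Un_commute)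
  then have "(\<Union>e \<in> parcs G. edge_curve mirrored e) = prod.swap ` (\<Union>e \<in> parcs G. edge_curve p (prod.swap e))"
    by (simp add: image_UN)
  moreover have "(\<Union>e \<in> parcs G. edge_curve p (prod.swap e)) = (\<Union>e \<in> (parcs G)\<inverse>. edge_curve p e)"
    by fastforce
  ultimately show ?thesis unfolding drawing_def by (simp add: image_Un image_image)
qed

lemma drawing_of_reversed:
  assumes "upward_leftward_outerplanar_L_drawing (reversed G) p"
  shows "upward_leftward_outerplanar_L_drawing G mirrored"
proof -
  have inj: "inj (prod.swap :: real \<times> real \<Rightarrow> real \<times> real)" by (rule injI) (simp add: prod_eq_iff)
  have p: "L_drawing (reversed G) p" "upward (reversed G) p" "leftward (reversed G) p"
    "\<And>v. v \<in> pverts G \<Longrightarrow> p v \<in> frontier (outside (drawing (reversed G) p))"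
    "\<And>e e'. e \<in> (parcs G)\<inverse> \<Longrightarrow> e' \<in> (parcs G)\<inverse> \<Longrightarrow> e \<noteq> e' \<Longrightarrow> \<not> cross p e e'"
    using assms by (auto simp: upward_leftward_outerplanar_L_drawing_def outerplanar_L_drawing_def
        planar_L_drawing_def)
  have "\<not> cross mirrored e e'" if e: "e \<in> parcs G" "e' \<in> parcs G" "e \<noteq> e'" for e e'
  proof -
    have "prod.swap e \<in> (parcs G)\<inverse>" "prod.swap e' \<in> (parcs G)\<inverse>" "prod.swap e \<noteq> prod.swap e'"
      using e by (cases e; cases e'; auto)+
    then have "\<not> cross p (prod.swap e) (prod.swap e')" by (rule p(5))
    moreover have "cross mirrored e e' \<longleftrightarrow> cross p (prod.swap e) (prod.swap e')"
      unfolding cross_def bend_mirrored open_segment_linear_image[OF linear_swap inj]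
        image_Int[OF inj, symmetric] image_is_empty
      by (simp add: open_segment_commute Int_commute disj_commute)
    ultimately show ?thesis by simp
  qed
  moreover have "L_drawing G mirrored" using p(1) by (auto simp: L_drawing_def inj_on_def)
  moreover have "mirrored v \<in> frontier (outside (drawing G mirrored))" if "v \<in> pverts G" for v
    unfolding drawing_mirrored outside_swap frontier_swap using p(4)[OF that] by blast
  moreover have "upward G mirrored" "leftward G mirrored"
  proof -
    have "snd (p b) < snd (p a) \<and> fst (p a) < fst (p b)" if "(a, b) \<in> parcs G" for a b
    proof -
      have "(b, a) \<in> parcs (reversed G)" using that by simp
      then show ?thesis using p(2,3) unfolding upward_def leftward_def bend_def by fastforce
    qed
    then show "upward G mirrored" "leftward G mirrored"
      by (auto simp: upward_def leftward_def bend_def)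
  qed
  ultimately show ?thesis
    by (simp add: upward_leftward_outerplanar_L_drawing_def outerplanar_L_drawing_def planar_L_drawing_def)
qed

text \<open>The reflection reverses every clockwise list, which inverts the rotation again. The
  diagonal offset from a bend is fixed by the reflection, so the test for the outer face carries
  over.\<close>

lemma embedding_of_reversed:
  assumes perm: "\<sigma> permutes D" and emb: "maintains_embedding (reversed G) p (inv \<sigma>) (prod.swap ` f)"
  shows "maintains_embedding G mirrored \<sigma> f"
proof -
  have "maintains_rotation G mirrored \<sigma>"
    unfolding maintains_rotation_def Let_def
  proof (intro ballI allI impI)
    fix v i
    let ?ns = "clockwise_neighbours (reversed G) p v"
    let ?n = "length ?ns"
    assume v: "v \<in> pverts G" and "i < length (clockwise_neighbours G mirrored v)"
    moreover have rev: "clockwise_neighbours G mirrored v = rev ?ns"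
      by (simp add: clockwise_neighbours_def comp_def)
    ultimately have i: "i < ?n" by simp
    let ?k = "Suc i mod ?n"
    have k: "?k < ?n" by (rule mod_less_divisor) (use i in linarith)
    \<comment> \<open>A step forward in the reversed list is a step back in the list, also where the
      index wraps around.\<close>
    have shift: "Suc (n - 1 - Suc j mod n) mod n = n - 1 - j" if "j < n" for j n :: nat
    proof (cases "Suc j = n")
      case False
      then show ?thesis using that by simp
    qed auto
    have "inv \<sigma> (v, ?ns ! (?n - 1 - ?k)) = (v, ?ns ! (Suc (?n - 1 - ?k) mod ?n))"
      using emb v k unfolding maintains_embedding_def maintains_rotation_def Let_def by simp
    moreover have "Suc (?n - 1 - ?k) mod ?n = ?n - 1 - i" by (rule shift[OF i])
    ultimately have "inv \<sigma> (v, rev ?ns ! ?k) = (v, rev ?ns ! i)"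
      using i k by (simp add: rev_nth)
    then have "\<sigma> (v, rev ?ns ! i) = (v, rev ?ns ! ?k)"
      using permutes_inverses(1)[OF perm] by metis
    then show "\<sigma> (v, clockwise_neighbours G mirrored v ! i) =
      (v, clockwise_neighbours G mirrored v ! (Suc i mod length (clockwise_neighbours G mirrored v)))"
      unfolding rev by simp
  qed
  moreover have "maintains_outer_face G mirrored f"
    unfolding maintains_outer_face_def
  proof
    fix e assume "e \<in> parcs G \<inter> f"
    then have "prod.swap e \<in> parcs (reversed G) \<inter> prod.swap ` f" by (cases e) auto
    then have "\<forall>\<^sub>F x in at_right 0. bend p (prod.swap e) - (x, x) \<in> outside (drawing (reversed G) p)"
      using emb unfolding maintains_embedding_def maintains_outer_face_def by blast
    then show "\<forall>\<^sub>F x in at_right 0. bend mirrored e - (x, x) \<in> outside (drawing G mirrored)"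
    proof eventually_elim
      case (elim x)
      have "bend mirrored e - (x, x) = prod.swap (bend p (prod.swap e) - (x, x))"
        unfolding bend_mirrored by (simp add: prod_eq_iff)
      then show ?case unfolding drawing_mirrored outside_swap using elim by (simp only:) blast
    qed
  qed
  ultimately show ?thesis by (simp add: maintains_embedding_def)
qed

end

theorem theorem4:
  fixes G :: "'a pair_pre_digraph"
  assumes "pair_digraph G"
    and "acyclic (parcs G)"
    and "cactus G"
    and "single_source G \<or> single_sink G"
  shows "(\<exists>p. upward_leftward_outerplanar_L_drawing G p) \<and>
    ((\<nexists>e. transitive_arc G e) \<longrightarrow>
      (\<forall>\<sigma> f. outerplanar_embedding G \<sigma> f \<longrightarrow>
        (\<exists>p. upward_leftward_outerplanar_L_drawing G p \<and> maintains_embedding G p \<sigma> f))) \<and>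
    ((\<nexists>C. undirected_cycle G C) \<longrightarrow> (\<nexists>e. transitive_arc G e))"
proof (intro conjI impI allI)
  note G = assms(1-3)
  show "\<exists>p. upward_leftward_outerplanar_L_drawing G p"
    using assms(4)
  proof
    assume "single_sink G"
    then have "\<exists>p. upward_leftward_outerplanar_L_drawing (reversed G) p"
      using G by (intro single_source_drawing)
        (simp_all add: reversed_digraph cactus_reversed single_source_reversed)
    then show ?thesis using drawing_of_reversed by blast
  qed (rule single_source_drawing[OF G])
  show "\<exists>p. upward_leftward_outerplanar_L_drawing G p \<and> maintains_embedding G p \<sigma> f"
    if trans: "\<nexists>e. transitive_arc G e" and emb: "outerplanar_embedding G \<sigma> f" for \<sigma> f
    using assms(4)
  proof
    assume "single_source G"
    then show ?thesis by (rule single_source_embedding[OF G _ trans emb])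
  next
    assume sink: "single_sink G"
    show ?thesis
    \<comment> \<open>Reversing the embedding requires an arc. Without arcs, a single sink is the
      only vertex and thus also the single source.\<close>
    proof (cases "parcs G = {}")
      case True
      obtain v where "pverts G = {v}"
      proof -
        obtain v where "\<And>u. u \<in> pverts G \<longleftrightarrow> u = v"
          using sink True unfolding single_sink_def out_degree_def out_arcs_def by auto
        then show thesis using that by auto
      qed
      then have "single_source G"
        using True by (auto simp: single_source_def in_degree_def in_arcs_def)
      then show ?thesis by (rule single_source_embedding[OF G _ trans emb])
    next
      case False
      have "Digraph_Component.connected (with_proj G)" using G(3) by (simp add: cactus_def)
      then have "outerplanar_embedding (reversed G) (inv \<sigma>) (prod.swap ` f)"
        using outerplanar_embedding_reversed G False emb by blast
      moreover have "\<nexists>e. transitive_arc (reversed G) e"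
        using transitive_arc_reversed[OF G(1)] trans by blast
      ultimately obtain p where "upward_leftward_outerplanar_L_drawing (reversed G) p"
        "maintains_embedding (reversed G) p (inv \<sigma>) (prod.swap ` f)"
        using single_source_embedding[of "reversed G" "inv \<sigma>" "prod.swap ` f"] G sink
        by (auto simp: reversed_digraph cactus_reversed single_source_reversed)
      moreover have "\<sigma> permutes darts G"
        using emb by (simp add: outerplanar_embedding_def planar_rotation_system_def rotation_system_def)
      ultimately show ?thesis
        using drawing_of_reversed embedding_of_reversed by blast
    qed
  qed
  show "\<nexists>e. transitive_arc G e" if "\<nexists>C. undirected_cycle G C"
    using transitive_arc_undirected_cycle[OF G(1)] that by blast
qed

end
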